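(* Let $A=2h_0+h_{-1}+\bar h_{-1}$ be a constant with $h_0\in\mathfrak h_0\cap\mathfrak g_2$ and $h_{-1}\in\mathfrak h_{-1}$. Then the solution $(u_0,u_{-1}):\mathbb R\to(\mathfrak h_0\cap\mathfrak g_2)\times\mathfrak h_{-1}$ of $$(2u_0+u_{-1}+\bar u_{-1})_t=[\,2u_0+u_{-1}+\bar u_{-1},\ i(u_{-1}-\bar u_{-1})\,]\qquad(\ast)$$ with initial value $2u_0(0)+u_{-1}(0)+\bar u_{-1}(0)=A$ can be obtained as follows: (1) Set $\xi_0(\lambda)=2ih_0+ih_{-1}\lambda^{-1}+i\bar h_{-1}\lambda$, and let $g(t,\lambda)$ be the solution of $g^{-1}g_t=\xi_0(\lambda)$, $g(0,\lambda)=\mathrm I$, i.e. $g(t,\cdot)$ is the one-parameter subgroup of $\xi_0$ in $L^\sigma(G_2^{\mathbb C})$. (2) Factor $g(t,\lambda)=g_+(t,\lambda)g_-(t,\lambda)$ with $g_\pm(t,\cdot)\in L^\sigma_\pm(G_2^{\mathbb C})$. (3) Set $\xi(t,\lambda)=g_+(t,\lambda)^{-1}\xi_0(\lambda)g_+(t,\lambda)$. Then $$\xi(t,\lambda)=v_0(t)+v_{-1}(t)\lambda^{-1}-\bar v_{-1}(t)\lambda$$ for some $v_0(t)\in\mathfrak h_0\cap(i\mathfrak g_2)$ and $v_{-1}(t)\in\mathfrak h_{-1}$. (4) Set $u_0=-\frac i2v_0$, $u_{-1}=-iv_{-1}$, and $k(t)=g_+(t,1)$. Then $k(t)\in G_2$,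 $(u_0,u_{-1})$ satisfies $(\ast)$, and $$k^{-1}Ak=2u_0+u_{-1}+\bar u_{-1},\qquad k^{-1}k_t=i(u_{-1}-\bar u_{-1}).$$ Moreover, $f(s,t)=e^{As}k_1(t)$, where $k_1(t)$ is the first column of $k(t)$, is almost complex in $S^6$; that is, with $z=s+it$, $df(iv)=J_f(df(v))$ for all tangent vectors $v$ of $\mathbb C$.
   Context: Octonions. Let $\mathbb H$ be the quaternions with standard basis $1,\mathbf i,\mathbf j,\mathbf k$, and $\mathbb O=\mathbb H\oplus\mathbb H\mathbf e$ with product $(p+q\mathbf e)\cdot(r+s\mathbf e)=(pr-\bar s q)+(sp+q\bar r)\mathbf e$. Identify $\mathbb R^7$ with $\mathrm{Im}\,\mathbb O$ by sending the standard basis $e_1,\dots,e_7$ to $\mathbf i,\mathbf j,\mathbf k,\mathbf e,\mathbf i\mathbf e,\mathbf j\mathbf e,\mathbf k\mathbf e$. $G_2=\mathrm{Aut}(\mathbb O)$ is regarded as a subgroup of $SO(7)$ via its action on $\mathrm{Im}\,\mathbb O=\mathbb R^7$, with Lie algebra $\mathfrak g_2\subset\mathfrak{so}(7)$; $G_2^{\mathbb C}\subset GL(7,\mathbb C)$ is its complexification, with Lie algebra $\mathfrak g_2^{\mathbb C}=\mathfrak g_2\otimes\mathbb C$; bar denotes complex conjugation of matrices. The unit sphere $S^6\subset\mathbb R^7$ has the almost complex structure $J_x(v)=x\cdot v$. For $a,b,c,d,e\in\mathbb C$ let $$M(a,b,c,d,e)=\begin{pmatrix}0&-c&ic&0&0&0&0\\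 c&0&-a&-d&id&0&0\\ -ic&a&0&-id&-d&0&0\\ 0&d&id&0&-b&-e+\frac i2c&-ie+\frac12c\\ 0&-id&d&b&0&-ie-\frac12c&e+\frac i2c\\ 0&0&0&e-\frac i2c&ie+\frac12c&0&-a-b\\ 0&0&0&ie-\frac12c&-e-\frac i2c&a+b&0\end{pmatrix}\in\mathfrak g_2^{\mathbb C}.$$ Let $Y_3=M(1,0,0,0,0)$, $Z_5=M(0,1,0,0,0)$ (elements of $\mathfrak g_2$), $h=\exp(\frac{\pi}{3}(Y_3+2Z_5))\in G_2$, and $\sigma(g)=h^{-1}gh$, an order $6$ inner automorphism of $G_2$ and of $G_2^{\mathbb C}$. Let $\mathfrak h_j$ be the eigenspace of $d\sigma_e$ on $\mathfrak g_2^{\mathbb C}$ with eigenvalue $e^{j\pi i/3}$; then $\mathfrak h_0=\{M(a,b,0,0,0)\}$, $\mathfrak h_{-1}=\{M(0,0,c,d,e)\}$, and $\overline{\mathfrak h_j}=\mathfrak h_{-j}$. The space $\mathfrak t=\mathfrak h_0\cap\mathfrak g_2$ is a maximal abelian subalgebra of $\mathfrak g_2$. Loop groups. Let $B=\exp(i\mathfrak t)N\subset G_2^{\mathbb C}$ be the solvable subgroup in an Iwasawa decomposition $G_2^{\mathbb C}=G_2B$ (with $N$ the unipotent subgroup of a choice of positive roots relative to $\mathfrak t$), so multiplication $G_2\times B\to G_2^{\mathbb C}$ is a diffeomorphism. $L(G_2^{\mathbb C})$ is the group of smooth loops $g:S^1\to G_2^{\mathbb C}$; $L_+(G_2^{\mathbb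 C})$ is the subgroup of loops with $g(\lambda)\in G_2$ for all $\lambda\in S^1$; $L_-(G_2^{\mathbb C})$ is the subgroup of loops that extend holomorphically to $|\lambda|<1$ with value in $B$ at $\lambda=0$. The automorphism $\hat\sigma$ of $L(G_2^{\mathbb C})$ is $\hat\sigma(g)(\lambda)=\sigma(g(e^{-\pi i/3}\lambda))$, and $L^\sigma(G_2^{\mathbb C})$, $L^\sigma_\pm(G_2^{\mathbb C})$ are the subgroups of elements of $L(G_2^{\mathbb C})$, $L_\pm(G_2^{\mathbb C})$ fixed by $\hat\sigma$. Known fact (Iwasawa loop group factorization, Pressley–Segal): multiplication $L_+(G_2^{\mathbb C})\times L_-(G_2^{\mathbb C})\to L(G_2^{\mathbb C})$ is a diffeomorphism; moreover if $g\in L^\sigma(G_2^{\mathbb C})$ and $g=g_+g_-$ is this factorization, then $g_\pm\in L^\sigma_\pm(G_2^{\mathbb C})$. *)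

theory Defs
  imports "HOL-Analysis.Analysis"
begin

section \<open>Octonions\<close>

text \<open>
  The coefficients are kept generic: \<open>real\<close> gives the octonions, \<open>complex\<close> their
  complexification with the same structure constants. In particular \<open>qconj\<close> is linear
  over the coefficients and does not conjugate them.
\<close>

type_synonym 'a quat = "'a \<times> 'a \<times> 'a \<times> 'a"
type_synonym 'a oct = "'a quat \<times> 'a quat"

fun qmult :: "'a::field quat \<Rightarrow> 'a quat \<Rightarrow> 'a quat" where
  "qmult (a0, a1, a2, a3) (b0, b1, b2, b3) =
    (a0 * b0 - a1 * b1 - a2 * b2 - a3 * b3,
     a0 * b1 + a1 * b0 + a2 * b3 - a3 * b2,
     a0 * b2 - a1 * b3 + a2 * b0 + a3 * b1,
     a0 * b3 + a1 * b2 - a2 * b1 + a3 * b0)"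

fun qconj :: "'a::field quat \<Rightarrow> 'a quat" where
  "qconj (a0, a1, a2, a3) = (a0, - a1, - a2, - a3)"

text \<open>The pair \<open>(p, q)\<close> stands for \<open>p + q e\<close>.\<close>

fun omult :: "'a::field oct \<Rightarrow> 'a oct \<Rightarrow> 'a oct" where
  "omult (p, q) (r, s) = (qmult p r - qmult (qconj s) q, qmult s p + qmult q (qconj r))"

fun oscale :: "'a::field \<Rightarrow> 'a oct \<Rightarrow> 'a oct" where
  "oscale c ((a0, a1, a2, a3), (a4, a5, a6, a7)) =
    ((c * a0, c * a1, c * a2, c * a3), (c * a4, c * a5, c * a6, c * a7))"

definition oct_aut :: "('a::field oct \<Rightarrow> 'a oct) set" where
  "oct_aut = {\<phi>. bij \<phi> \<and> (\<forall>x y. \<phi> (x + y) = \<phi> x + \<phi> y) \<and> (\<forall>c x. \<phi> (oscale c x) = oscale c (\<phi> x))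
               \<and> (\<forall>x y. \<phi> (omult x y) = omult (\<phi> x) (\<phi> y))}"

definition im_oct :: "'a::field^7 \<Rightarrow> 'a oct" where
  "im_oct x = ((0, x $ 1, x $ 2, x $ 3), (x $ 4, x $ 5, x $ 6, x $ 7))"

definition oct_aut_im :: "('a::field^7^7) set" where
  "oct_aut_im = {A. \<exists>\<phi> \<in> oct_aut. \<forall>x. \<phi> (im_oct x) = im_oct (A *v x)}"


section \<open>Matrices\<close>

type_synonym cmat7 = "complex^7^7"

definition mexp :: "'a::real_normed_field^'n^'n \<Rightarrow> 'a^'n^'n" where
  "mexp A = (\<Sum>n. (1 / fact n) *\<^sub>R (((**) A ^^ n) (mat 1)))"

definition cscale :: "complex \<Rightarrow> complex^'n^'m \<Rightarrow> complex^'n^'m" (infixr "*\<^sub>C" 75) where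
  "c *\<^sub>C A = map_matrix (\<lambda>x. c * x) A"

definition mconj :: "complex^'n^'m \<Rightarrow> complex^'n^'m" where
  "mconj A = map_matrix cnj A"

definition mreal :: "real^'n^'m \<Rightarrow> complex^'n^'m" where
  "mreal A = map_matrix complex_of_real A"

definition bracket :: "complex^'n^'n \<Rightarrow> complex^'n^'n \<Rightarrow> complex^'n^'n" where
  "bracket X Y = X ** Y - Y ** X"

text \<open>\<open>left_log_deriv g t X\<close> says \<open>g\<inverse> g\<^sub>t = X\<close> at time \<open>t\<close>.\<close>

definition left_log_deriv :: "(real \<Rightarrow> complex^'n^'n) \<Rightarrow> real \<Rightarrow> complex^'n^'n \<Rightarrow> bool" where
  "left_log_deriv g t X \<longleftrightarrow>
     invertible (g t) \<and> (\<exists>D. (g has_vector_derivative D) (at t) \<and> matrix_inv (g t) ** D = X)"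


section \<open>The groups, their Lie algebras and the automorphism of order six\<close>

text \<open>
  Real matrices are regarded as complex ones throughout. The complexification of \<open>G2\<close> is the
  group of complex points of the same algebraic group, i.e. the automorphism group of the
  complexified octonions acting on the imaginary part.
\<close>

definition G2 :: "cmat7 set" where
  "G2 = mreal ` oct_aut_im"

definition G2C :: "cmat7 set" where
  "G2C = oct_aut_im"

definition g2 :: "cmat7 set" where
  "g2 = mreal ` {X. \<forall>s::real. mexp (s *\<^sub>R X) \<in> oct_aut_im}"

definition g2C :: "cmat7 set" where
  "g2C = {X + \<i> *\<^sub>C Y | X Y. X \<in> g2 \<and> Y \<in> g2}"

definition Mgen :: "complex \<Rightarrow> complex \<Rightarrow> complex \<Rightarrow> complex \<Rightarrow> complex \<Rightarrow> cmat7" where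
  "Mgen a b c d e = vector
    [vector [0, - c, \<i> * c, 0, 0, 0, 0],
     vector [c, 0, - a, - d, \<i> * d, 0, 0],
     vector [- \<i> * c, a, 0, - \<i> * d, - d, 0, 0],
     vector [0, d, \<i> * d, 0, - b, - e + \<i> / 2 * c, - \<i> * e + 1 / 2 * c],
     vector [0, - \<i> * d, d, b, 0, - \<i> * e - 1 / 2 * c, e + \<i> / 2 * c],
     vector [0, 0, 0, e - \<i> / 2 * c, \<i> * e + 1 / 2 * c, 0, - a - b],
     vector [0, 0, 0, \<i> * e - 1 / 2 * c, - e - \<i> / 2 * c, a + b, 0]]"

definition hmat :: cmat7 where
  "hmat = mexp ((pi / 3) *\<^sub>R (Mgen 1 0 0 0 0 + 2 *\<^sub>R Mgen 0 1 0 0 0))"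

definition sigma :: "cmat7 \<Rightarrow> cmat7" where
  "sigma g = matrix_inv hmat ** g ** hmat"

text \<open>
  Conjugation by a matrix is the restriction of a linear map, so the differential of \<open>sigma\<close>
  at the identity is given by the same formula \<open>X \<mapsto> h\<inverse> X h\<close>.
\<close>

definition eigsp :: "int \<Rightarrow> cmat7 set" where
  "eigsp j = {X \<in> g2C. sigma X = cis (of_int j * pi / 3) *\<^sub>C X}"

definition tor :: "cmat7 set" where
  "tor = eigsp 0 \<inter> g2"


section \<open>The solvable subgroup of an Iwasawa decomposition\<close>

text \<open>
  Roots are taken relative to \<open>i t\<close>, on which they are real; only the values of \<open>\<alpha>\<close> on
  \<open>i t\<close> matter. A choice of positive roots is given by a regular element.
\<close>

definition itor :: "cmat7 set" where
  "itor = (\<lambda>T. \<i> *\<^sub>C T) ` tor"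

definition root_space :: "(cmat7 \<Rightarrow> real) \<Rightarrow> cmat7 set" where
  "root_space \<alpha> = {X \<in> g2C. \<forall>H \<in> itor. bracket H X = \<alpha> H *\<^sub>R X}"

definition is_root :: "(cmat7 \<Rightarrow> real) \<Rightarrow> bool" where
  "is_root \<alpha> \<longleftrightarrow> (\<exists>H \<in> itor. \<alpha> H \<noteq> 0) \<and> (\<exists>X \<in> root_space \<alpha>. X \<noteq> 0)"

definition positive_roots :: "(cmat7 \<Rightarrow> real) set \<Rightarrow> bool" where
  "positive_roots P \<longleftrightarrow>
     (\<exists>H \<in> itor. (\<forall>\<alpha>. is_root \<alpha> \<longrightarrow> \<alpha> H \<noteq> 0) \<and> P = {\<alpha>. is_root \<alpha> \<and> 0 < \<alpha> H})"

text \<open>The root spaces are complex subspaces, so the real span is the complex one.\<close>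

definition nilp :: "(cmat7 \<Rightarrow> real) set \<Rightarrow> cmat7 set" where
  "nilp P = span (\<Union>\<alpha> \<in> P. root_space \<alpha>)"

text \<open>The connected subgroup with Lie algebra \<open>nilp P\<close>, which is generated by exponentials.\<close>

inductive_set unip :: "(cmat7 \<Rightarrow> real) set \<Rightarrow> cmat7 set" for P where
  unip_one: "mat 1 \<in> unip P"
| unip_exp: "X \<in> nilp P \<Longrightarrow> g \<in> unip P \<Longrightarrow> mexp X ** g \<in> unip P"

definition Bgrp :: "(cmat7 \<Rightarrow> real) set \<Rightarrow> cmat7 set" where
  "Bgrp P = {mexp H ** n | H n. H \<in> itor \<and> n \<in> unip P}"


section \<open>Loop groups\<close>

abbreviation S1 :: "complex set" where
  "S1 \<equiv> sphere 0 1"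

definition smooth :: "(real \<Rightarrow> 'a::real_normed_vector) \<Rightarrow> bool" where
  "smooth f \<longleftrightarrow> (\<exists>D. D 0 = f \<and> (\<forall>(n::nat) x. (D n has_vector_derivative D (Suc n) x) (at x)))"

text \<open>
  Loops are extensional functions on the circle (value \<open>undefined\<close> elsewhere), so that
  equality of loops is equality on the circle.
\<close>

definition loops :: "(complex \<Rightarrow> cmat7) set" where
  "loops = {g \<in> S1 \<rightarrow>\<^sub>E G2C. smooth (\<lambda>\<theta>. g (cis \<theta>))}"

definition loops_plus :: "(complex \<Rightarrow> cmat7) set" where
  "loops_plus = {g \<in> loops. \<forall>l \<in> S1. g l \<in> G2}"

definition loops_minus :: "(cmat7 \<Rightarrow> real) set \<Rightarrow> (complex \<Rightarrow> cmat7) set" where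
  "loops_minus P = {g \<in> loops. \<exists>G. (\<forall>l \<in> S1. G l = g l) \<and> continuous_on (cball 0 1) G
      \<and> (\<forall>i j. (\<lambda>z. G z $ i $ j) holomorphic_on ball 0 1)
      \<and> (\<forall>z \<in> ball 0 1. G z \<in> G2C) \<and> G 0 \<in> Bgrp P}"

definition sigma_hat :: "(complex \<Rightarrow> cmat7) \<Rightarrow> complex \<Rightarrow> cmat7" where
  "sigma_hat g = (\<lambda>l \<in> S1. sigma (g (cis (- pi / 3) * l)))"

definition twisted :: "(complex \<Rightarrow> cmat7) set \<Rightarrow> (complex \<Rightarrow> cmat7) set" where
  "twisted L = {g \<in> L. sigma_hat g = g}"

text \<open>\<open>loop_flow xi g\<close>: \<open>g t l\<close> solves \<open>g\<inverse> g\<^sub>t = xi l\<close>, \<open>g 0 l = I\<close> for \<open>l\<close> on the circle.\<close>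

definition loop_flow :: "(complex \<Rightarrow> cmat7) \<Rightarrow> (real \<Rightarrow> complex \<Rightarrow> cmat7) \<Rightarrow> bool" where
  "loop_flow xi g \<longleftrightarrow> (\<forall>t. g t \<in> extensional S1) \<and>
     (\<forall>l \<in> S1. g 0 l = mat 1 \<and> (\<forall>t. left_log_deriv (\<lambda>s. g s l) t (xi l)))"

definition loop_factors ::
    "(cmat7 \<Rightarrow> real) set \<Rightarrow> (complex \<Rightarrow> cmat7) \<Rightarrow> (complex \<Rightarrow> cmat7) \<Rightarrow> (complex \<Rightarrow> cmat7) \<Rightarrow> bool" where
  "loop_factors P g gp gm \<longleftrightarrow> gp \<in> twisted loops_plus \<and> gm \<in> twisted (loops_minus P) \<and>
     (\<forall>l \<in> S1. g l = gp l ** gm l)"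


section \<open>The equation and almost complex curves\<close>

definition lax_solution :: "(real \<Rightarrow> cmat7) \<Rightarrow> (real \<Rightarrow> cmat7) \<Rightarrow> bool" where
  "lax_solution u0 u1 \<longleftrightarrow> (\<forall>t. u0 t \<in> eigsp 0 \<inter> g2 \<and> u1 t \<in> eigsp (-1)) \<and>
     (\<forall>t. ((\<lambda>t. 2 *\<^sub>R u0 t + u1 t + mconj (u1 t)) has_vector_derivative
            bracket (2 *\<^sub>R u0 t + u1 t + mconj (u1 t)) (\<i> *\<^sub>C (u1 t - mconj (u1 t)))) (at t))"

definition almost_complex :: "(complex \<Rightarrow> real^7) \<Rightarrow> bool" where
  "almost_complex f \<longleftrightarrow> (\<forall>z. f z \<in> sphere 0 1) \<and>
     (\<forall>z. \<exists>D. (f has_derivative D) (at z) \<and>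
        (\<forall>v. im_oct (D (\<i> * v)) = omult (im_oct (f z)) (im_oct (D v))))"

end

theory Submission
  imports Defs "HOL-Complex_Analysis.Conformal_Mappings"
begin

text \<open>
  The Lax equation splits into \<open>u0' = -i [u1, mconj u1]\<close>, \<open>u1' = 2i [u0, u1]\<close>, a
  quadratic equation that conserves a norm and therefore has a global solution. Along this solution
  the loop \<open>xi = 2i u0 + i u1 / l + i l mconj u1\<close> satisfies \<open>xi' = [xi, xip]\<close> with
  \<open>xip = i u1 / l - i l mconj u1\<close>, which is real on the circle, and the rest
  \<open>xim = xi - xip\<close> is holomorphic in \<open>l\<close>. The solutions of \<open>Gp' = Gp xip\<close>
  and \<open>Gm' = xim Gm\<close> then factor the one-parameter subgroup of \<open>xi0\<close>; at
  \<open>l = 0\<close> the equation for \<open>Gm\<close> lives in the torus, so \<open>Gm\<close> takes a value in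
  \<open>exp (i t)\<close> there. So the general loop group factorization theorem is not needed.
  The factorization is unique because the quotient of two of them is holomorphic in the disc and real
  on the circle, hence a constant in the intersection of \<open>G2\<close> with the triangular group,
  which is trivial.
\<close>

section \<open>Ordinary differential equations\<close>

text \<open>The obstacle is that the objects are given implicitly: \<open>G2\<close> by octonion
  automorphisms, \<open>B\<close> by roots, loop groups by holomorphic extension. Two reformulations
  make them accessible to differential equations. An automorphism is an orthogonal matrix that
  preserves the cross product, so membership in the group is conserved by a linear equation whose
  coefficient is a derivation. In a unitary basis of weight vectors \<open>hmat\<close> and the
  torus are diagonal, and \<open>B\<close> is triangular with positive diagonal once the weights are
  ordered by the regular element that defines \<open>P\<close>.

  The conserved norm has a second use: it bounds the coefficients of the linear equations for the
  factors at all times, so these are solvable on the whole line.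

  The curve is almost complex because of the situation at the first basis vector: the torus
  annihilates it, and the eigenspace for -1 sends it to a vector on which the complex structure acts
  as multiplication by i. The matrices mexp (s A) k lie in \<open>G2\<close> and transport this to
  every point of the curve.\<close>

lemma ex_antiderivative:
  fixes f :: "real \<Rightarrow> 'a::banach"
  assumes "continuous_on UNIV f"
  shows "\<exists>G. G 0 = 0 \<and> (\<forall>t. (G has_vector_derivative f t) (at t))"
proof -
  \<comment> \<open>One of the two integrals is over an empty or degenerate interval, so the
    difference is the oriented integral from 0 to \<open>t\<close> for both signs of
    \<open>t\<close>.\<close>
  define G where "G t = integral {0..t} f - integral {t..0} f" for t
  have "(G has_vector_derivative f t) (at t)" for t
  proof -
  \<comment> \<open>With a base point to the left of both 0 and \<open>t\<close>, \<open>G\<close>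
    is near \<open>t\<close> an indefinite integral minus a constant, to which the standard
    derivative rule applies.\<close>
  define N where "N = \<bar>t\<bar> + 1"
  have int: "f integrable_on {a..b}" for a b
    using assms by (intro integrable_continuous_real) (rule continuous_on_subset, auto)
  have eq: "integral {-N..u} f - integral {-N..0} f = G u" if "u \<in> {-N<..<N}" for u
  proof (cases "u \<ge> 0")
    case True
    then show ?thesis
      using Henstock_Kurzweil_Integration.integral_combine[of "-N" 0 u f] int that
      by (cases "u = 0") (auto simp: G_def N_def algebra_simps)
  next
    case False
    then show ?thesis
      using Henstock_Kurzweil_Integration.integral_combine[of "-N" u 0 f] int that
      by (auto simp: G_def N_def algebra_simps)
  qed
  have "((\<lambda>u. integral {-N..u} f) has_vector_derivative f t) (at t within {-N..N})"
    by (rule integral_has_vector_derivative)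
      (use assms in \<open>auto simp: N_def intro: continuous_on_subset\<close>)
  then have "((\<lambda>u. integral {-N..u} f) has_vector_derivative f t) (at t)"
    by (subst (asm) at_within_interior) (auto simp: N_def)
  then have "((\<lambda>u. integral {-N..u} f - integral {-N..0} f) has_vector_derivative f t) (at t)"
    by (auto intro!: derivative_eq_intros)
  then show ?thesis
    by (rule has_vector_derivative_transform_within_open[of _ _ _ "{-N<..<N}"])
      (auto simp: eq, auto simp: N_def)
  qed
  moreover have "G 0 = 0" by (simp add: G_def)
  ultimately show ?thesis by blast
qed

lemma has_vector_derivative_reflect:
  fixes x :: "real \<Rightarrow> 'a::real_normed_vector"
  assumes "(x has_vector_derivative d) (at (- t))"
  shows "((\<lambda>s. x (- s)) has_vector_derivative - d) (at t)"
proof -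
  have "(uminus has_vector_derivative (- 1 :: real)) (at t)"
    by (auto intro!: derivative_eq_intros)
  from vector_diff_chain_at[OF this assms] show ?thesis by (simp add: o_def)
qed

text \<open>For s >= 0 the function (|x|^2 + M^2) exp (-(2 L + 1) s) does not increase, because 2
  |x| M <= |x|^2 + M^2 absorbs the inhomogeneity. The square of the norm is differentiable even
  where \<open>x\<close> vanishes. Negative times follow by reflection.\<close>

lemma gronwall:
  fixes x :: "real \<Rightarrow> 'a::real_inner"
  assumes deriv: "\<And>s. \<bar>s\<bar> \<le> T \<Longrightarrow> (x has_vector_derivative x' s) (at s)"
    and bound: "\<And>s. \<bar>s\<bar> \<le> T \<Longrightarrow> norm (x' s) \<le> L * norm (x s) + M"
    and "L \<ge> 0" "M \<ge> 0" "\<bar>t\<bar> \<le> T"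
  shows "(norm (x t))\<^sup>2 + M\<^sup>2 \<le> ((norm (x 0))\<^sup>2 + M\<^sup>2) * exp ((2 * L + 1) * \<bar>t\<bar>)"
proof -
  have fwd: "(norm (y t))\<^sup>2 + M\<^sup>2 \<le> ((norm (y 0))\<^sup>2 + M\<^sup>2) * exp ((2 * L + 1) * t)"
    if "0 \<le> t" "t \<le> T" and d: "\<And>s. \<bar>s\<bar> \<le> T \<Longrightarrow> (y has_vector_derivative y' s) (at s)"
      and b: "\<And>s. \<bar>s\<bar> \<le> T \<Longrightarrow> norm (y' s) \<le> L * norm (y s) + M"
    for y y' :: "real \<Rightarrow> 'a" and t
  proof -
    define c where "c = 2 * L + 1"
    define \<phi> where "\<phi> s = (y s \<bullet> y s + M\<^sup>2) * exp (- c * s)" for s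
    have "\<phi> t \<le> \<phi> 0"
    proof (rule DERIV_nonpos_imp_nonincreasing[OF \<open>0 \<le> t\<close>])
      fix s assume s: "0 \<le> s" "s \<le> t"
      then have s': "\<bar>s\<bar> \<le> T" using that by auto
      have "((\<lambda>s. y s \<bullet> y s) has_vector_derivative (y s \<bullet> y' s + y' s \<bullet> y s)) (at s)"
        using d[OF s'] by (intro bounded_bilinear.has_vector_derivative[OF bounded_bilinear_inner])
      then have "((\<lambda>s. y s \<bullet> y s) has_real_derivative (2 * (y s \<bullet> y' s))) (at s)"
        by (simp add: has_real_derivative_iff_has_vector_derivative inner_commute)
      then have D: "(\<phi> has_real_derivative
          (2 * (y s \<bullet> y' s) - c * (y s \<bullet> y s + M\<^sup>2)) * exp (- c * s)) (at s)"
        unfolding \<phi>_def by (auto intro!: derivative_eq_intros simp: algebra_simps)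
      have "y s \<bullet> y' s \<le> norm (y s) * (L * norm (y s) + M)"
        by (rule order_trans[OF norm_cauchy_schwarz]) (intro mult_left_mono b s', simp)
      moreover have "2 * norm (y s) * M \<le> (norm (y s))\<^sup>2 + M\<^sup>2"
        using sum_squares_bound[of "norm (y s)" M] by simp
      moreover have "0 \<le> L * M\<^sup>2" using \<open>L \<ge> 0\<close> by simp
      ultimately have "2 * (y s \<bullet> y' s) - c * (y s \<bullet> y s + M\<^sup>2) \<le> 0"
        unfolding c_def dot_square_norm by (simp add: algebra_simps power2_eq_square)
      then show "\<exists>d. (\<phi> has_real_derivative d) (at s) \<and> d \<le> 0"
        using D by (auto intro!: mult_nonpos_nonneg)
    qed
    then have "((norm (y t))\<^sup>2 + M\<^sup>2) * exp (- (c * t)) \<le> (norm (y 0))\<^sup>2 + M\<^sup>2"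
      by (simp add: \<phi>_def dot_square_norm)
    from mult_right_mono[OF this, of "exp (c * t)"] show ?thesis
      by (simp add: mult.assoc flip: exp_add c_def)
  qed
  show ?thesis
  proof (cases "t \<ge> 0")
    case True
    then show ?thesis using fwd[of t x x'] assms by auto
  next
    case False
    have "((\<lambda>s. x (- s)) has_vector_derivative - x' (- s)) (at s)" if "\<bar>s\<bar> \<le> T" for s
      using that by (intro has_vector_derivative_reflect deriv) auto
    then show ?thesis using fwd[of "- t" "\<lambda>s. x (- s)" "\<lambda>s. - x' (- s)"] False assms by auto
  qed
qed

lemma gronwall_zero:
  fixes x :: "real \<Rightarrow> 'a::real_inner"
  assumes "\<And>s. \<bar>s\<bar> \<le> \<bar>t\<bar> \<Longrightarrow> (x has_vector_derivative x' s) (at s)"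
    and "\<And>s. \<bar>s\<bar> \<le> \<bar>t\<bar> \<Longrightarrow> norm (x' s) \<le> L * norm (x s)" and "x 0 = 0"
  shows "x t = 0"
proof -
  have "norm (x' s) \<le> \<bar>L\<bar> * norm (x s) + 0" if "\<bar>s\<bar> \<le> \<bar>t\<bar>" for s
    using order_trans[OF assms(2)[OF that] mult_right_mono[OF abs_ge_self norm_ge_zero]] by simp
  from gronwall[where T = "\<bar>t\<bar>" and t = t, OF assms(1) this] show ?thesis using assms(3) by simp
qed

text \<open>With growing \<open>n\<close> this produces the factorials of the Picard iteration; with
  \<open>n\<close> = 0 it is the mean value inequality.\<close>

lemma norm_le_if_deriv_le:
  fixes G :: "real \<Rightarrow> 'a::real_normed_vector"
  assumes "\<And>s. \<bar>s\<bar> \<le> \<bar>t\<bar> \<Longrightarrow> (G has_vector_derivative g s) (at s)" and "G 0 = 0"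
    and "\<And>s. \<bar>s\<bar> \<le> \<bar>t\<bar> \<Longrightarrow> norm (g s) \<le> C * \<bar>s\<bar> ^ n"
  shows "norm (G t) \<le> C * \<bar>t\<bar> ^ Suc n / Suc n"
proof -
  have fwd: "norm (H t) \<le> C * t ^ Suc n / Suc n"
    if "t > 0" and d: "\<And>s. \<bar>s\<bar> \<le> t \<Longrightarrow> (H has_vector_derivative h s) (at s)" and "H 0 = 0"
      and b: "\<And>s. \<bar>s\<bar> \<le> t \<Longrightarrow> norm (h s) \<le> C * \<bar>s\<bar> ^ n"
    for t and H h :: "real \<Rightarrow> 'a"
  proof -
    have "norm (H t - H 0) \<le> C * t ^ Suc n / Suc n - C * 0 ^ Suc n / Suc n"
    proof (rule differentiable_bound_general[OF \<open>t > 0\<close>])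
      show "continuous_on {0..t} H"
        using d by (intro continuous_at_imp_continuous_on ballI)
          (rule has_vector_derivative_continuous, rule d, auto)
      fix s assume s: "0 < s" "s < t"
      show "(H has_vector_derivative h s) (at s)" using d s by auto
      show "((\<lambda>s. C * s ^ Suc n / real (Suc n)) has_vector_derivative C * s ^ n) (at s)"
        unfolding has_real_derivative_iff_has_vector_derivative[symmetric]
        by (rule derivative_eq_intros refl | simp)+
      show "norm (h s) \<le> C * s ^ n" using b[of s] s by auto
    qed (auto intro!: continuous_intros)
    then show ?thesis using \<open>H 0 = 0\<close> by simp
  qed
  consider "t > 0" | "t = 0" | "t < 0" by linarith
  then show ?thesis
  proof cases
    case 1
    then show ?thesis using fwd[of t G g] assms by auto
  next
    case 2
    then show ?thesis using assms by simp
  next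
    case 3
    have "((\<lambda>s. G (- s)) has_vector_derivative - g (- s)) (at s)" if "\<bar>s\<bar> \<le> \<bar>t\<bar>" for s
      using that by (intro has_vector_derivative_reflect assms) auto
    moreover have "norm (g (- s)) \<le> C * \<bar>s\<bar> ^ n" if "\<bar>s\<bar> \<le> \<bar>t\<bar>" for s
      using assms(3)[of "- s"] that by simp
    ultimately show ?thesis
      using fwd[of "- t" "\<lambda>s. G (- s)" "\<lambda>s. - g (- s)"] 3 assms(2) by auto
  qed
qed

lemma const_if_deriv_zero:
  fixes x :: "real \<Rightarrow> 'a::real_normed_vector"
  assumes "\<And>t. (x has_vector_derivative 0) (at t)"
  shows "x t = x 0"
proof -
  have "((\<lambda>t. x t - x 0) has_vector_derivative 0) (at s)" for s
    using assms[of s] by (auto intro!: derivative_eq_intros)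
  from norm_le_if_deriv_le[OF this, of t 0 0] show ?thesis by simp
qed

text \<open>The inner product of \<open>x\<close> with a vector orthogonal to \<open>S\<close> is
  constant and vanishes at 0, and the double orthogonal complement of \<open>S\<close> is
  \<open>S\<close> again.\<close>

lemma antiderivative_mem_subspace:
  fixes x :: "real \<Rightarrow> 'a::euclidean_space"
  assumes S: "subspace S" and "x 0 \<in> S"
    and "\<And>t. (x has_vector_derivative x' t) (at t)" and "\<And>t. x' t \<in> S"
  shows "x t \<in> S"
proof -
  have "y \<bullet> x t = 0" if y: "y \<in> S\<^sup>\<bottom>" for y
  proof -
    have "((\<lambda>t. y \<bullet> x t) has_vector_derivative 0) (at t)" for t
    proof -
      have "((\<lambda>t. y \<bullet> x t) has_vector_derivative y \<bullet> x' t) (at t)"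
        using assms(3) by (intro bounded_linear.has_vector_derivative[OF bounded_linear_inner_right])
      moreover have "y \<bullet> x' t = 0"
        using y assms(4)[of t] by (auto simp: orthogonal_comp_def orthogonal_def inner_commute)
      ultimately show ?thesis by simp
    qed
    then have "y \<bullet> x t = y \<bullet> x 0" by (rule const_if_deriv_zero)
    then show ?thesis
      using y assms(2) by (auto simp: orthogonal_comp_def orthogonal_def inner_commute)
  qed
  then have "x t \<in> S\<^sup>\<bottom>\<^sup>\<bottom>"
    by (auto simp: orthogonal_comp_def orthogonal_def)
  then show ?thesis using orthogonal_comp_self[OF S] by simp
qed


text \<open>Picard iteration works on the whole line at once because the Lipschitz constant depends
  neither on time nor on the point. All conditions concern \<open>S\<close> only, and continuity is
  demanded along curves in \<open>S\<close>, the form in which the iteration uses it.\<close>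

lemma global_ode_solution:
  fixes F :: "real \<Rightarrow> 'a::euclidean_space \<Rightarrow> 'a"
  assumes S: "subspace S" and x0: "x0 \<in> S"
    and cont: "\<And>x. continuous_on UNIV x \<Longrightarrow> range x \<subseteq> S \<Longrightarrow> continuous_on UNIV (\<lambda>t. F t (x t))"
    and lip: "\<And>t x y. x \<in> S \<Longrightarrow> y \<in> S \<Longrightarrow> norm (F t x - F t y) \<le> L * norm (x - y)"
    and inv: "\<And>t x. x \<in> S \<Longrightarrow> F t x \<in> S"
  obtains x where "x 0 = x0" "\<And>t. x t \<in> S" "\<And>t. (x has_vector_derivative F t (x t)) (at t)"
proof -
  define prim :: "(real \<Rightarrow> 'a) \<Rightarrow> real \<Rightarrow> 'a"
    where "prim f = (SOME G. G 0 = 0 \<and> (\<forall>t. (G has_vector_derivative f t) (at t)))" for f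
  have prim: "prim f 0 = 0" "(prim f has_vector_derivative f t) (at t)"
    if "continuous_on UNIV f" for f t
    using someI_ex[OF ex_antiderivative[OF that]] by (auto simp: prim_def)
  define X where "X = rec_nat (\<lambda>_. x0) (\<lambda>_ x t. x0 + prim (\<lambda>s. F s (x s)) t)"
  have X0: "X 0 = (\<lambda>_. x0)" and XS: "X (Suc n) = (\<lambda>t. x0 + prim (\<lambda>s. F s (X n s)) t)" for n
    by (simp_all add: X_def)
  have contd: "continuous_on UNIV y" if "\<And>t. (y has_vector_derivative y' t) (at t)"
    for y y' :: "real \<Rightarrow> 'a"
    using that by (intro continuous_at_imp_continuous_on ballI has_vector_derivative_continuous)
  have step: "\<forall>t. (X (Suc n) has_vector_derivative F t (X n t)) (at t)"
    if "continuous_on UNIV (X n)" "range (X n) \<subseteq> S" for n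
    unfolding XS using prim(2)[OF cont[OF that]] by (auto intro!: derivative_eq_intros)
  have X: "continuous_on UNIV (X n) \<and> range (X n) \<subseteq> S \<and>
      (\<forall>t. (X (Suc n) has_vector_derivative F t (X n t)) (at t))" for n
  proof (induction n)
    case 0
    show ?case using step[of 0] x0 by (auto simp: X0)
  next
    case (Suc n)
    have c: "continuous_on UNIV (X (Suc n))" by (rule contd) (use Suc in blast)
    have "X (Suc n) 0 = x0" using prim(1)[OF cont] Suc by (simp add: XS)
    then have "X (Suc n) t \<in> S" for t
      using antiderivative_mem_subspace[OF S, of "X (Suc n)" "\<lambda>t. F t (X n t)"] Suc x0 inv
      by (metis range_subsetD)
    then show ?case using step[of "Suc n"] c by (metis image_subsetI)
  qed
  have X_0: "X n 0 = x0" for n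
    using prim(1)[OF cont] X by (cases n) (auto simp: X0 XS)
  have L: "norm (F t x - F t y) \<le> \<bar>L\<bar> * norm (x - y)" if "x \<in> S" "y \<in> S" for t x y
    by (rule order_trans[OF lip[OF that] mult_right_mono[OF abs_ge_self norm_ge_zero]])
  define x where "x t = x0 + (\<Sum>n. X (Suc n) t - X n t)" for t
  have unif: "uniform_limit {-T..T} X x sequentially" for T
  proof (cases "T \<ge> 0")
    case False
    then show ?thesis by (simp add: uniform_limit_iff)
  next
    case True
    have "continuous_on {-T..T} (\<lambda>t. F t x0)"
      using cont[of "\<lambda>_. x0"] x0 continuous_on_subset by fastforce
    then have "bounded ((\<lambda>t. F t x0) ` {-T..T})"
      by (intro compact_imp_bounded compact_continuous_image) auto
    then obtain K where K: "\<And>t. t \<in> {-T..T} \<Longrightarrow> norm (F t x0) \<le> K"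
      unfolding bounded_iff by blast
    have est: "norm (X (Suc n) t - X n t) \<le> K * \<bar>L\<bar> ^ n / fact n * \<bar>t\<bar> ^ n * T"
      if "\<bar>t\<bar> \<le> T" for n t
    proof -
      \<comment> \<open>The induction carries the exact factor |t|^(n+1) / (n+1)!, since integrating
        it once more yields the next one. Only afterwards is |t| / (n+1) weakened to
        \<open>T\<close>.\<close>
      have "norm (X (Suc n) t - X n t) \<le> K * \<bar>L\<bar> ^ n / fact n * \<bar>t\<bar> ^ Suc n / Suc n"
        using that
      proof (induction n arbitrary: t)
        case 0
        have "norm (F s x0) \<le> K * \<bar>L\<bar> ^ 0 / fact 0 * \<bar>s\<bar> ^ 0" if "\<bar>s\<bar> \<le> \<bar>t\<bar>" for s
        proof -
          have "s \<in> {-T..T}" using that 0 by auto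
          then show ?thesis using K by simp
        qed
        moreover have "((\<lambda>t. X (Suc 0) t - X 0 t) has_vector_derivative F s x0) (at s)" for s
          using X[of 0] by (auto intro!: derivative_eq_intros simp: X0)
        moreover have "X (Suc 0) 0 - X 0 0 = 0" by (simp add: X_0)
        ultimately show ?case by (intro norm_le_if_deriv_le[where g = "\<lambda>s. F s x0"])
      next
        case (Suc n)
        have D: "((\<lambda>t. X (Suc (Suc n)) t - X (Suc n) t) has_vector_derivative
            F s (X (Suc n) s) - F s (X n s)) (at s)" for s
          using X[of n] X[of "Suc n"] by (auto intro!: derivative_intros)
        have B: "norm (F s (X (Suc n) s) - F s (X n s)) \<le>
            K * \<bar>L\<bar> ^ Suc n / fact (Suc n) * \<bar>s\<bar> ^ Suc n" if "\<bar>s\<bar> \<le> \<bar>t\<bar>" for s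
        proof -
          have "norm (F s (X (Suc n) s) - F s (X n s)) \<le> \<bar>L\<bar> * norm (X (Suc n) s - X n s)"
            using X[of n] X[of "Suc n"] by (intro L) auto
          also have "\<dots> \<le> \<bar>L\<bar> * (K * \<bar>L\<bar> ^ n / fact n * \<bar>s\<bar> ^ Suc n / Suc n)"
            using Suc.prems that by (intro mult_left_mono Suc.IH) auto
          also have "\<dots> = K * \<bar>L\<bar> ^ Suc n / fact (Suc n) * \<bar>s\<bar> ^ Suc n"
            by (simp add: field_simps)
          finally show ?thesis .
        qed
        show ?case by (rule norm_le_if_deriv_le[OF D _ B]) (auto simp: X_0)
      qed
      also have "\<dots> = (K * \<bar>L\<bar> ^ n / fact n * \<bar>t\<bar> ^ n) * (\<bar>t\<bar> / Suc n)" by simp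
      also have "\<dots> \<le> K * \<bar>L\<bar> ^ n / fact n * \<bar>t\<bar> ^ n * T"
      proof (intro mult_left_mono)
        have "\<bar>t\<bar> / Suc n \<le> \<bar>t\<bar> / 1" by (rule divide_left_mono) auto
        then show "\<bar>t\<bar> / Suc n \<le> T" using that by simp
        have "K \<ge> 0" using order_trans[OF norm_ge_zero K[of 0]] True by simp
        then show "0 \<le> K * \<bar>L\<bar> ^ n / fact n * \<bar>t\<bar> ^ n" by simp
      qed
      finally show ?thesis .
    qed
    have K0: "K \<ge> 0" using order_trans[OF norm_ge_zero K[of 0]] True by simp
    have "uniform_limit {-T..T} (\<lambda>n t. \<Sum>i<n. X (Suc i) t - X i t)
        (\<lambda>t. \<Sum>i. X (Suc i) t - X i t) sequentially"
    proof (rule Weierstrass_m_test)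
      show "norm (X (Suc n) t - X n t) \<le> K * T * ((\<bar>L\<bar> * T) ^ n /\<^sub>R fact n)"
        if "t \<in> {-T..T}" for n t
      proof -
        have "norm (X (Suc n) t - X n t) \<le> K * \<bar>L\<bar> ^ n / fact n * \<bar>t\<bar> ^ n * T"
          using that by (intro est) auto
        also have "\<dots> \<le> K * \<bar>L\<bar> ^ n / fact n * T ^ n * T"
          using that K0 True by (intro mult_right_mono mult_left_mono power_mono) auto
        finally show ?thesis by (simp add: field_simps power_mult_distrib)
      qed
      show "summable (\<lambda>n. K * T * ((\<bar>L\<bar> * T) ^ n /\<^sub>R fact n))"
        by (intro summable_mult summable_exp_generic)
    qed
    moreover have "(\<lambda>n t. \<Sum>i<n. X (Suc i) t - X i t) = (\<lambda>n t. X n t - x0)"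
      using sum_lessThan_telescope[of "\<lambda>n. X n t" for t] by (simp add: fun_eq_iff X0)
    ultimately have "uniform_limit {-T..T} (\<lambda>n t. x0 + (X n t - x0)) x sequentially"
      unfolding x_def by (intro uniform_limit_intros) auto
    then show ?thesis by simp
  qed
  have lim: "(\<lambda>n. X n t) \<longlonglongrightarrow> x t" for t
  proof -
    have "t \<in> {-\<bar>t\<bar>..\<bar>t\<bar>}" by auto
    then show ?thesis by (rule tendsto_uniform_limitI[OF unif])
  qed
  have contx: "continuous_on UNIV x"
  proof (rule continuous_at_imp_continuous_on, safe)
    fix t :: real
    have "continuous_on {-(\<bar>t\<bar>+1)..\<bar>t\<bar>+1} x"
    proof (rule uniform_limit_theorem[OF _ unif])
      show "\<forall>\<^sub>F n in sequentially. continuous_on {-(\<bar>t\<bar>+1)..\<bar>t\<bar>+1} (X n)"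
        using X by (intro always_eventually allI) (blast intro: continuous_on_subset)
    qed simp
    then show "isCont x t"
      by (rule continuous_on_interior) auto
  qed
  have xS: "x t \<in> S" for t
    by (rule closed_sequentially[OF closed_subspace[OF S] _ lim]) (use X in auto)
  \<comment> \<open>\<open>y\<close> is the Picard operator applied to the limit \<open>x\<close>.
    The iterates also converge to \<open>y\<close>, whence \<open>x = y\<close>, and
    \<open>x\<close> inherits the derivative.\<close>
  define y where "y t = x0 + prim (\<lambda>s. F s (x s)) t" for t
  have cF: "continuous_on UNIV (\<lambda>s. F s (x s))"
    using xS by (intro cont[OF contx]) auto
  have yd: "(y has_vector_derivative F t (x t)) (at t)" for t
    unfolding y_def using prim(2)[OF cF] by (auto intro!: derivative_eq_intros)
  have "(\<lambda>n. X (Suc n) t) \<longlonglongrightarrow> y t" for t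
  proof (rule metric_LIMSEQ_I)
    fix r :: real assume "r > 0"
    \<comment> \<open>Any positive bound of |L| |t| would serve; the summands 1 keep it positive,
      and the 2 in \<open>e\<close> makes the final inequality strict.\<close>
    define p where "p = (\<bar>L\<bar> + 1) * (\<bar>t\<bar> + 1)"
    have "p > 0" unfolding p_def by (intro mult_pos_pos) auto
    define e where "e = r / (2 * p)"
    have "e > 0" using \<open>r > 0\<close> \<open>p > 0\<close> by (simp add: e_def)
    then obtain N where N: "\<And>n s. n \<ge> N \<Longrightarrow> s \<in> {-\<bar>t\<bar>..\<bar>t\<bar>} \<Longrightarrow> dist (X n s) (x s) < e"
      using uniform_limitD[OF unif[of "\<bar>t\<bar>"]] unfolding eventually_sequentially by meson
    show "\<exists>no. \<forall>n\<ge>no. dist (X (Suc n) t) (y t) < r"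
    proof (intro exI allI impI)
      fix n assume n: "n \<ge> N"
      have "norm (X (Suc n) t - y t) \<le> (\<bar>L\<bar> * e) * \<bar>t\<bar> ^ Suc 0 / Suc 0"
      proof (rule norm_le_if_deriv_le)
        show "((\<lambda>t. X (Suc n) t - y t) has_vector_derivative F s (X n s) - F s (x s)) (at s)" for s
          using X[of n] yd by (auto intro!: derivative_intros)
        show "X (Suc n) 0 - y 0 = 0" by (simp add: X_0 y_def prim(1)[OF cF])
        fix s assume s: "\<bar>s\<bar> \<le> \<bar>t\<bar>"
        have "norm (F s (X n s) - F s (x s)) \<le> \<bar>L\<bar> * norm (X n s - x s)"
          using X xS by (intro L) auto
        also have "\<dots> \<le> \<bar>L\<bar> * e"
        proof (intro mult_left_mono)
          have "s \<in> {-\<bar>t\<bar>..\<bar>t\<bar>}" using s by (simp add: abs_le_iff minus_le_iff)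
          then show "norm (X n s - x s) \<le> e" using N[OF n, of s] by (simp add: dist_norm)
        qed simp
        finally show "norm (F s (X n s) - F s (x s)) \<le> \<bar>L\<bar> * e * \<bar>s\<bar> ^ 0" by simp
      qed
      also have "\<dots> \<le> (\<bar>L\<bar> + 1) * e * (\<bar>t\<bar> + 1)"
        using \<open>e > 0\<close> by (auto intro!: mult_mono)
      also have "\<dots> = p * e" by (simp add: p_def)
      also have "\<dots> = r / 2" using \<open>p > 0\<close> by (simp add: e_def)
      finally show "dist (X (Suc n) t) (y t) < r" using \<open>r > 0\<close> by (simp add: dist_norm)
    qed
  qed
  then have "x t = y t" for t
    using LIMSEQ_unique[OF LIMSEQ_Suc[OF lim]] by blast
  then have "x = y" by blast
  show ?thesis
  proof
    show "x 0 = x0" unfolding \<open>x = y\<close> by (simp add: y_def prim(1)[OF cF])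
    show "x t \<in> S" "(x has_vector_derivative F t (x t)) (at t)" for t
      using xS yd \<open>x = y\<close> by auto
  qed
qed

section \<open>Complex matrices and the matrix exponential\<close>

lemma matrix_mult_bounded_bilinear:
  "bounded_bilinear ((**) :: 'a::{real_normed_field,euclidean_space}^'n^'m \<Rightarrow> 'a^'k^'n \<Rightarrow> 'a^'k^'m)"
  unfolding bilinear_conv_bounded_bilinear[symmetric] bilinear_def
  by (auto intro!: linearI simp: matrix_add_ldistrib matrix_scalar_ac scalar_matrix_assoc
      matrix_matrix_mult_def vec_eq_iff sum.distrib algebra_simps scaleR_sum_right)

lemma matrix_vector_mult_bounded_bilinear:
  "bounded_bilinear ((*v) :: 'a::{real_normed_field,euclidean_space}^'n^'m \<Rightarrow> 'a^'n \<Rightarrow> 'a^'m)"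
  unfolding bilinear_conv_bounded_bilinear[symmetric] bilinear_def
  by (auto intro!: linearI simp: matrix_vector_mult_def vec_eq_iff sum.distrib algebra_simps scaleR_sum_right)

lemma cscale_bounded_bilinear: "bounded_bilinear (cscale :: complex \<Rightarrow> complex^'n^'m \<Rightarrow> _)"
  unfolding bilinear_conv_bounded_bilinear[symmetric] bilinear_def
  by (auto intro!: linearI simp: cscale_def vec_eq_iff algebra_simps)

interpretation mm: bounded_bilinear "(**) :: 'a::{real_normed_field,euclidean_space}^'n^'m \<Rightarrow> 'a^'k^'n \<Rightarrow> 'a^'k^'m"
  by (rule matrix_mult_bounded_bilinear)

interpretation mv: bounded_bilinear "(*v) :: 'a::{real_normed_field,euclidean_space}^'n^'m \<Rightarrow> 'a^'n \<Rightarrow> 'a^'m"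
  by (rule matrix_vector_mult_bounded_bilinear)

interpretation cs: bounded_bilinear "cscale :: complex \<Rightarrow> complex^'n^'m \<Rightarrow> complex^'n^'m"
  by (rule cscale_bounded_bilinear)

lemma cscale_nth [simp]: "(c *\<^sub>C A) $ i $ j = c * A $ i $ j"
  and mconj_nth [simp]: "mconj A $ i $ j = cnj (A $ i $ j)"
  and mreal_nth [simp]: "mreal B $ i $ j = complex_of_real (B $ i $ j)"
  by (simp_all add: cscale_def mconj_def mreal_def)

lemma cscale_cscale [simp]: "c *\<^sub>C d *\<^sub>C A = (c * d) *\<^sub>C A"
  and cscale_one [simp]: "1 *\<^sub>C A = A"
  and cscale_of_real: "complex_of_real r *\<^sub>C A = r *\<^sub>R A"
  and cscale_scaleR: "c *\<^sub>C (r *\<^sub>R A) = (c * of_real r) *\<^sub>C A"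
  by (simp_all add: vec_eq_iff scaleR_conv_of_real[where 'a = complex])

lemma cscale_mult_left: "(c *\<^sub>C A) ** B = c *\<^sub>C (A ** B)"
  and cscale_mult_right: "A ** (c *\<^sub>C B) = c *\<^sub>C (A ** B)"
  by (simp_all add: vec_eq_iff matrix_matrix_mult_def sum_distrib_left mult_ac)

lemma cscale_transpose: "transpose (c *\<^sub>C A) = c *\<^sub>C transpose A"
  by (simp add: vec_eq_iff transpose_def)

lemma mconj_add: "mconj (A + B) = mconj A + mconj B"
  and mconj_diff: "mconj (A - B) = mconj A - mconj B"
  and mconj_minus: "mconj (- A) = - mconj A"
  and mconj_cscale: "mconj (c *\<^sub>C A) = cnj c *\<^sub>C mconj A"
  and mconj_scaleR: "mconj (r *\<^sub>R A) = r *\<^sub>R mconj A"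
  and mconj_mconj [simp]: "mconj (mconj A) = A"
  and mconj_transpose: "mconj (transpose A) = transpose (mconj A)"
  and mconj_mult: "mconj (C ** D) = mconj C ** mconj D"
  and mconj_mat_1 [simp]: "mconj (mat 1) = mat 1"
  and mconj_mreal [simp]: "mconj (mreal E) = mreal E"
  by (simp_all add: vec_eq_iff transpose_def matrix_matrix_mult_def mat_def)

lemma mreal_ex: "mconj A = A \<Longrightarrow> \<exists>B. A = mreal B"
proof -
  assume "mconj A = A"
  then have "A $ i $ j \<in> \<real>" for i j
    by (metis mconj_nth Reals_cnj_iff)
  then have "A = mreal (\<chi> i j. Re (A $ i $ j))"
    by (simp add: vec_eq_iff of_real_Re)
  then show ?thesis ..
qed

lemma mconj_bounded_linear: "bounded_linear (mconj :: complex^'n^'m \<Rightarrow> _)"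
  unfolding linear_conv_bounded_linear[symmetric]
  by (intro linearI) (simp_all add: mconj_add mconj_scaleR)

lemma mreal_bounded_linear: "bounded_linear (mreal :: real^'n^'m \<Rightarrow> _)"
  unfolding linear_conv_bounded_linear[symmetric]
  by (intro linearI) (simp_all add: vec_eq_iff scaleR_conv_of_real[where 'a = complex])

lemma transpose_bounded_linear: "bounded_linear (transpose :: 'a::euclidean_space^'n^'m \<Rightarrow> _)"
  unfolding linear_conv_bounded_linear[symmetric]
  by (intro linearI) (simp_all add: vec_eq_iff transpose_def)

lemma mreal_mult: "mreal (A ** B) = mreal A ** mreal B"
  and mreal_mat_1 [simp]: "mreal (mat 1) = mat 1"
  by (simp_all add: vec_eq_iff matrix_matrix_mult_def mat_def)

lemma mreal_inj: "mreal A = mreal B \<longleftrightarrow> A = B"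
  by (simp add: vec_eq_iff)

lemma matrix_inv_eqI:
  fixes A B :: "'a::field^'n^'n"
  assumes "A ** B = mat 1"
  shows "matrix_inv A = B"
proof -
  have BA: "B ** A = mat 1" using assms by (simp add: matrix_left_right_inverse)
  have "A ** matrix_inv A = mat 1 \<and> matrix_inv A ** A = mat 1"
    unfolding matrix_inv_def by (rule someI[of _ B]) (use assms BA in auto)
  then show ?thesis
    by (metis BA matrix_mul_assoc matrix_mul_lid matrix_mul_rid)
qed

lemma invertibleI:
  fixes A B :: "'a::field^'n^'n"
  assumes "A ** B = mat 1"
  shows "invertible A"
  using assms by (auto simp: invertible_def matrix_left_right_inverse)

section \<open>The exponential series and linear equations\<close>

abbreviation mpow :: "'a::semiring_1^'n^'n \<Rightarrow> nat \<Rightarrow> 'a^'n^'n" where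
  "mpow A n \<equiv> ((**) A ^^ n) (mat 1)"

text \<open>The norm is submultiplicative only up to a factor \<open>K\<close>, so the majorant is
  the exponential series at norm A * K.\<close>

lemma mexp_summable:
  fixes A :: "'a::{real_normed_field,euclidean_space}^'n^'n"
  shows "summable (\<lambda>n. (1 / fact n) *\<^sub>R mpow A n)"
proof -
  obtain K where K: "\<And>(A::'a^'n^'n) (B::'a^'n^'n). norm (A ** B) \<le> norm A * norm B * K" and "K > 0"
    using mm.pos_bounded by blast
  have pow: "norm (mpow A n) \<le> (norm A * K) ^ n * norm (mat 1 :: 'a^'n^'n)" for n
  proof (induction n)
    case (Suc n)
    have "norm (mpow A (Suc n)) \<le> norm A * norm (mpow A n) * K" using K by simp
    also have "\<dots> \<le> norm A * ((norm A * K) ^ n * norm (mat 1 :: 'a^'n^'n)) * K"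
      using Suc \<open>K > 0\<close> by (intro mult_right_mono mult_left_mono) auto
    finally show ?case by (simp add: mult_ac)
  qed simp
  show ?thesis
  proof (rule summable_comparison_test')
    show "summable (\<lambda>n. ((norm A * K) ^ n /\<^sub>R fact n) * norm (mat 1 :: 'a^'n^'n))"
      by (intro summable_mult2 summable_exp_generic)
    show "norm ((1 / fact n) *\<^sub>R mpow A n) \<le> (norm A * K) ^ n /\<^sub>R fact n * norm (mat 1 :: 'a^'n^'n)" for n
      using mult_left_mono[OF pow[of n], of "1 / fact n"] by (simp add: divide_inverse mult_ac)
  qed
qed

lemma mreal_mexp: "mreal (mexp X) = mexp (mreal X)"
proof -
  have "mreal (mpow X n) = mpow (mreal X) n" for n
    by (induction n) (simp_all add: mreal_mult)
  then show ?thesis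
    unfolding mexp_def bounded_linear.suminf[OF mreal_bounded_linear mexp_summable]
    by (simp add: linear_scale[OF bounded_linear.linear[OF mreal_bounded_linear]])
qed

lemma mpow_cscale: "mpow (c *\<^sub>C A) n = c ^ n *\<^sub>C mpow A n"
  by (induction n) (simp_all add: cscale_mult_left cscale_mult_right)

lemma mexp_cscale_nth:
  "(\<lambda>n. mpow A n $ i $ j / fact n * c ^ n) sums mexp (c *\<^sub>C A) $ i $ j"
proof -
  have "(\<lambda>n. (1 / fact n) *\<^sub>R mpow (c *\<^sub>C A) n) sums mexp (c *\<^sub>C A)"
    unfolding mexp_def using mexp_summable by (rule summable_sums)
  from bounded_linear.sums[OF bounded_linear_vec_nth bounded_linear.sums[OF bounded_linear_vec_nth this]]
  show ?thesis by (simp add: mpow_cscale scaleR_conv_of_real[where 'a = complex] field_simps)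
qed

text \<open>Each entry of mexp (c A) is a power series in the complex variable \<open>c\<close> and
  may be differentiated term by term; shifting the coefficients amounts to one more factor
  \<open>A\<close> on the left.\<close>

lemma mexp_cscale_deriv:
  "((\<lambda>c. mexp (c *\<^sub>C A) $ i $ j) has_field_derivative (A ** mexp (c *\<^sub>C A)) $ i $ j) (at c)"
proof -
  define a where "a n = mpow A n $ i $ j / fact n" for n
  have "diffs a n = (\<Sum>k\<in>UNIV. A $ i $ k * (mpow A n $ k $ j / fact n))" for n
    by (simp add: a_def diffs_def matrix_matrix_mult_def flip: sum_divide_distrib del: of_nat_Suc)
  then have "(\<lambda>n. diffs a n * c ^ n) sums (\<Sum>k\<in>UNIV. A $ i $ k * mexp (c *\<^sub>C A) $ k $ j)"
    using sums_sum[where I = UNIV and f = "\<lambda>k n. A $ i $ k * (mpow A n $ k $ j / fact n * c ^ n)",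
        OF sums_mult[OF mexp_cscale_nth]]
    by (simp add: sum_distrib_right mult.assoc)
  then have "(\<Sum>n. diffs a n * c ^ n) = (A ** mexp (c *\<^sub>C A)) $ i $ j"
    by (simp add: sums_iff matrix_matrix_mult_def)
  moreover have "(\<lambda>c. mexp (c *\<^sub>C A) $ i $ j) = (\<lambda>c. \<Sum>n. a n * c ^ n)"
    unfolding a_def by (rule ext) (rule sums_unique[OF mexp_cscale_nth])
  moreover have "((\<lambda>c. \<Sum>n. a n * c ^ n) has_field_derivative (\<Sum>n. diffs a n * c ^ n)) (at c)"
    using mexp_cscale_nth unfolding a_def
    by (intro termdiffs_strong_converges_everywhere) (blast intro: sums_summable)
  ultimately show ?thesis by simp
qed

lemma has_vector_derivative_vec_nth:
  fixes f :: "real \<Rightarrow> 'a::euclidean_space^'n"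
  shows "(f has_vector_derivative f') (at t within S) \<longleftrightarrow>
    (\<forall>i. ((\<lambda>t. f t $ i) has_vector_derivative f' $ i) (at t within S))"
  unfolding has_vector_derivative_def
  by (subst (1 2) has_derivative_componentwise_within)
    (auto simp: Basis_vec_def inner_axis)

lemma mexp_scaleR_deriv:
  fixes A :: "complex^'n^'n"
  shows "((\<lambda>t. mexp (t *\<^sub>R A)) has_vector_derivative A ** mexp (t *\<^sub>R A)) (at t)"
  unfolding has_vector_derivative_vec_nth
proof (intro allI)
  fix i j
  have "((\<lambda>t. mexp (complex_of_real t *\<^sub>C A) $ i $ j) has_vector_derivative
      (A ** mexp (complex_of_real t *\<^sub>C A)) $ i $ j) (at t)"
    by (rule has_vector_derivative_real_field[OF mexp_cscale_deriv])
  then show "((\<lambda>t. mexp (t *\<^sub>R A) $ i $ j) has_vector_derivative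
      (A ** mexp (t *\<^sub>R A)) $ i $ j) (at t)"
    by (simp add: cscale_of_real)
qed

lemma mexp_0 [simp]: "mexp (0 :: complex^'n^'n) = mat 1"
proof -
  have "mexp (0 *\<^sub>C (0 :: complex^'n^'n)) $ i $ j = mat 1 $ i $ j" for i j
    using mexp_cscale_nth[of "0::complex^'n^'n" i j 0] powser_sums_zero_iff[of "\<lambda>n. mpow (0::complex^'n^'n) n $ i $ j / fact n"]
    by simp
  then have "mexp (0 *\<^sub>C (0 :: complex^'n^'n)) = mat 1" by (simp add: vec_eq_iff)
  then show ?thesis by (simp add: cs.zero_left)
qed

text \<open>The source of most matrix identities below, for exponentials, conjugates and images
  under \<open>sigma\<close>: both sides solve the same linear equation with the same initial value.
  Compactness of the interval around 0 reduces it to \<open>gronwall_zero\<close>.\<close>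

lemma linear_ode_unique:
  fixes C Y Z :: "real \<Rightarrow> complex^'n^'n"
  assumes C: "continuous_on UNIV C"
    and Y: "\<And>t. (Y has_vector_derivative C t ** Y t) (at t)"
    and Z: "\<And>t. (Z has_vector_derivative C t ** Z t) (at t)"
    and "Y 0 = Z 0"
  shows "Y t = Z t"
proof -
  have "bounded (C ` {-\<bar>t\<bar>..\<bar>t\<bar>})"
    using C by (intro compact_imp_bounded compact_continuous_image) (auto intro: continuous_on_subset)
  then obtain B where B: "\<And>s. \<bar>s\<bar> \<le> \<bar>t\<bar> \<Longrightarrow> norm (C s) \<le> B"
    unfolding bounded_iff by (force simp: abs_le_iff)
  obtain K where K: "\<And>(A::complex^'n^'n) (B::complex^'n^'n). norm (A ** B) \<le> norm A * norm B * K" and "K > 0"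
    using mm.pos_bounded by blast
  have "(\<lambda>t. Y t - Z t) t = 0"
  proof (rule gronwall_zero)
    show "((\<lambda>t. Y t - Z t) has_vector_derivative C s ** (Y s - Z s)) (at s)" for s
      using Y Z by (auto intro!: derivative_eq_intros simp: mm.diff_right)
    show "norm (C s ** (Y s - Z s)) \<le> B * K * norm (Y s - Z s)" if "\<bar>s\<bar> \<le> \<bar>t\<bar>" for s
    proof -
      have "norm (C s ** (Y s - Z s)) \<le> norm (C s) * norm (Y s - Z s) * K" by (rule K)
      also have "\<dots> \<le> B * norm (Y s - Z s) * K"
        using B[OF that] \<open>K > 0\<close> by (intro mult_right_mono) auto
      finally show ?thesis by (simp add: mult_ac)
    qed
  qed (use assms in auto)
  then show ?thesis by simp
qed

lemma mexp_unique:
  fixes A :: "complex^'n^'n"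
  assumes "\<And>t. (Y has_vector_derivative A ** Y t) (at t)" and "Y 0 = mat 1"
  shows "Y t = mexp (t *\<^sub>R A)"
  by (rule linear_ode_unique[where C = "\<lambda>_. A"]) (use assms mexp_scaleR_deriv in auto)

lemma mexp_conj:
  fixes A P Q :: "complex^'n^'n"
  assumes "P ** Q = mat 1"
  shows "P ** mexp A ** Q = mexp (P ** A ** Q)"
proof -
  have QP: "Q ** P = mat 1" using assms by (simp add: matrix_left_right_inverse)
  have "P ** mexp (1 *\<^sub>R A) ** Q = mexp (1 *\<^sub>R (P ** A ** Q))"
  proof (rule mexp_unique)
    fix t
    have "((\<lambda>t. P ** mexp (t *\<^sub>R A) ** Q) has_vector_derivative P ** (A ** mexp (t *\<^sub>R A)) ** Q) (at t)"
      by (intro bounded_linear.has_vector_derivative[OF mm.bounded_linear_left]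
          bounded_linear.has_vector_derivative[OF mm.bounded_linear_right] mexp_scaleR_deriv)
    also have "P ** (A ** mexp (t *\<^sub>R A)) ** Q = P ** A ** (Q ** P) ** mexp (t *\<^sub>R A) ** Q"
      by (simp add: QP matrix_mul_assoc)
    finally show "((\<lambda>t. P ** mexp (t *\<^sub>R A) ** Q) has_vector_derivative
        P ** A ** Q ** (P ** mexp (t *\<^sub>R A) ** Q)) (at t)"
      by (simp add: matrix_mul_assoc)
  qed (simp add: assms)
  then show ?thesis by simp
qed

lemma mexp_commute:
  fixes A :: "complex^'n^'n"
  shows "A ** mexp (t *\<^sub>R A) = mexp (t *\<^sub>R A) ** A"
proof (rule linear_ode_unique[where C = "\<lambda>_. A" and Y = "\<lambda>t. A ** mexp (t *\<^sub>R A)"])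
  show "((\<lambda>t. A ** mexp (t *\<^sub>R A)) has_vector_derivative A ** (A ** mexp (t *\<^sub>R A))) (at t)" for t
    by (intro bounded_linear.has_vector_derivative[OF mm.bounded_linear_right] mexp_scaleR_deriv)
  show "((\<lambda>t. mexp (t *\<^sub>R A) ** A) has_vector_derivative A ** (mexp (t *\<^sub>R A) ** A)) (at t)" for t
    unfolding matrix_mul_assoc
    by (intro bounded_linear.has_vector_derivative[OF mm.bounded_linear_left] mexp_scaleR_deriv)
qed auto

lemma mexp_minus:
  fixes A :: "complex^'n^'n"
  shows "mexp A ** mexp (- A) = mat 1"
proof -
  define f where "f t = mexp (t *\<^sub>R A) ** mexp (t *\<^sub>R (- A))" for t :: real
  have "f 1 = f 0"
  proof (rule const_if_deriv_zero)
    fix t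
    have "(f has_vector_derivative mexp (t *\<^sub>R A) ** (- A ** mexp (t *\<^sub>R (- A))) +
        A ** mexp (t *\<^sub>R A) ** mexp (t *\<^sub>R (- A))) (at t)"
      unfolding f_def by (intro mm.has_vector_derivative mexp_scaleR_deriv)
    then show "(f has_vector_derivative 0) (at t)"
      by (simp add: mexp_commute mm.minus_left mm.minus_right matrix_mul_assoc)
  qed
  then show ?thesis by (simp add: f_def)
qed

section \<open>The automorphism group of the octonions\<close>

lemma exhaust_7:
  fixes x :: 7
  shows "x = 1 \<or> x = 2 \<or> x = 3 \<or> x = 4 \<or> x = 5 \<or> x = 6 \<or> x = 7"
proof (induct x)
  case (of_int z)
  then have "z = 0 \<or> z = 1 \<or> z = 2 \<or> z = 3 \<or> z = 4 \<or> z = 5 \<or> z = 6" by fastforce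
  then show ?case by auto
qed

lemma forall_7: "(\<forall>i::7. P i) \<longleftrightarrow> P 1 \<and> P 2 \<and> P 3 \<and> P 4 \<and> P 5 \<and> P 6 \<and> P 7"
  by (metis exhaust_7)

lemma UNIV_7: "UNIV = {1::7, 2, 3, 4, 5, 6, 7}"
  using exhaust_7 by auto

lemma sum_7: "sum f (UNIV::7 set) = f 1 + f 2 + f 3 + f 4 + f 5 + f 6 + f 7"
  unfolding UNIV_7 by (simp add: ac_simps)

lemma vector_7 [simp]:
  "(vector [a, b, c, d, e, f, g] :: 'a::zero^7) $ 1 = a"
  "(vector [a, b, c, d, e, f, g] :: 'a::zero^7) $ 2 = b"
  "(vector [a, b, c, d, e, f, g] :: 'a::zero^7) $ 3 = c"
  "(vector [a, b, c, d, e, f, g] :: 'a::zero^7) $ 4 = d"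
  "(vector [a, b, c, d, e, f, g] :: 'a::zero^7) $ 5 = e"
  "(vector [a, b, c, d, e, f, g] :: 'a::zero^7) $ 6 = f"
  "(vector [a, b, c, d, e, f, g] :: 'a::zero^7) $ 7 = g"
  unfolding vector_def by simp_all

text \<open>Bilinear over the coefficients also in the complex case, so that its isometries are the
  complex orthogonal matrices and not the unitary ones.\<close>

definition dotp :: "'a::field^'n \<Rightarrow> 'a^'n \<Rightarrow> 'a" where
  "dotp x y = (\<Sum>i\<in>UNIV. x $ i * y $ i)"

text \<open>The imaginary part of the product of two imaginary octonions in the basis i, j, k, e,
  ie, je, ke; \<open>oct_of_mult\<close> checks the coordinates against
  \<open>omult\<close>.\<close>

definition cross :: "'a::field^7 \<Rightarrow> 'a^7 \<Rightarrow> 'a^7" where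
  "cross x y = vector
    [x$2 * y$3 - x$3 * y$2 + x$4 * y$5 - x$5 * y$4 + x$7 * y$6 - x$6 * y$7,
     x$3 * y$1 - x$1 * y$3 + x$4 * y$6 - x$6 * y$4 + x$5 * y$7 - x$7 * y$5,
     x$1 * y$2 - x$2 * y$1 + x$4 * y$7 - x$7 * y$4 + x$6 * y$5 - x$5 * y$6,
     x$5 * y$1 - x$1 * y$5 + x$6 * y$2 - x$2 * y$6 + x$7 * y$3 - x$3 * y$7,
     x$1 * y$4 - x$4 * y$1 + x$3 * y$6 - x$6 * y$3 + x$7 * y$2 - x$2 * y$7,
     x$2 * y$4 - x$4 * y$2 + x$1 * y$7 - x$7 * y$1 + x$5 * y$3 - x$3 * y$5,
     x$3 * y$4 - x$4 * y$3 + x$2 * y$5 - x$5 * y$2 + x$6 * y$1 - x$1 * y$6]"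

definition oct_of :: "'a::field \<Rightarrow> 'a^7 \<Rightarrow> 'a oct" where
  "oct_of r x = ((r, x $ 1, x $ 2, x $ 3), (x $ 4, x $ 5, x $ 6, x $ 7))"

lemma im_oct_eq: "im_oct x = oct_of 0 x"
  by (simp add: im_oct_def oct_of_def)

lemma oct_of_inject [simp]: "oct_of r x = oct_of s y \<longleftrightarrow> r = s \<and> x = y"
  by (auto simp: oct_of_def vec_eq_iff forall_7)

lemma oct_of_cases: obtains r x where "o' = oct_of r x"
proof -
  obtain a0 a1 a2 a3 where 1: "fst o' = (a0, a1, a2, a3)" by (rule prod_cases4)
  obtain a4 a5 a6 a7 where 2: "snd o' = (a4, a5, a6, a7)" by (rule prod_cases4)
  from 1 2 have "o' = ((a0, a1, a2, a3), (a4, a5, a6, a7))" by (metis prod.collapse)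
  then have "o' = oct_of a0 (vector [a1, a2, a3, a4, a5, a6, a7])" by (simp add: oct_of_def)
  then show ?thesis by (rule that)
qed

lemma oct_of_add: "oct_of r x + oct_of s y = oct_of (r + s) (x + y)"
  by (simp add: oct_of_def)

lemma oct_of_scale: "oscale c (oct_of r x) = oct_of (c * r) (c *s x)"
  by (simp add: oct_of_def)

lemma oct_of_mult:
  "omult (oct_of r x) (oct_of s y) = oct_of (r * s - dotp x y) (r *s y + s *s x + cross x y)"
  by (simp add: oct_of_def dotp_def sum_7 cross_def algebra_simps)

lemma dotp_matrix: "dotp (A *v x) (B *v y) = dotp x ((transpose A ** B) *v y)"
proof -
  have "dotp (A *v x) z = dotp x (transpose A *v z)" for z
  proof -
    have "dotp (A *v x) z = (\<Sum>i\<in>UNIV. \<Sum>j\<in>UNIV. A $ i $ j * x $ j * z $ i)"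
      by (simp add: dotp_def matrix_vector_mult_def sum_distrib_right)
    also have "\<dots> = (\<Sum>j\<in>UNIV. \<Sum>i\<in>UNIV. A $ i $ j * x $ j * z $ i)" by (rule sum.swap)
    also have "\<dots> = dotp x (transpose A *v z)"
      by (simp add: dotp_def matrix_vector_mult_def transpose_def sum_distrib_left mult_ac
          del: transpose_matrix_vector)
    finally show ?thesis .
  qed
  then show ?thesis by (simp add: matrix_vector_mul_assoc del: transpose_matrix_vector)
qed

lemma dotp_axis: "dotp (axis i 1) (A *v axis j 1) = A $ i $ j"
  by (simp add: dotp_def axis_def matrix_vector_mult_def if_distrib if_distribR cong: if_cong)

lemma matrix_eq_dotp: "A = B \<longleftrightarrow> (\<forall>x y. dotp x (A *v y) = dotp x (B *v y))"
  by (metis dotp_axis vec_eq_iff)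

text \<open>The product of two imaginary octonions has scalar part minus \<open>dotp\<close> and
  imaginary part \<open>cross\<close>. An automorphism fixes the scalars, hence respects both parts
  separately. The resulting equations can be differentiated, which gives the Lie algebra.\<close>

lemma oct_aut_im_iff:
  "A \<in> oct_aut_im \<longleftrightarrow> transpose A ** A = mat 1 \<and> (\<forall>x y. A *v cross x y = cross (A *v x) (A *v y))"
proof
  assume "A \<in> oct_aut_im"
  then obtain \<phi> where bij: "bij \<phi>" and add: "\<And>x y. \<phi> (x + y) = \<phi> x + \<phi> y"
    and sc: "\<And>c x. \<phi> (oscale c x) = oscale c (\<phi> x)"
    and mult: "\<And>x y. \<phi> (omult x y) = omult (\<phi> x) (\<phi> y)"
    and im: "\<And>x. \<phi> (oct_of 0 x) = oct_of 0 (A *v x)"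
    by (auto simp: oct_aut_im_def oct_aut_def im_oct_eq)
  \<comment> \<open>Preservation of the unit comes from surjectivity: for a preimage
    \<open>e\<close> of 1 one has \<phi> 1 = \<phi> 1 * \<phi> e = \<phi> (1 * e) = \<phi> e =
    1.\<close>
  obtain e where e: "\<phi> e = oct_of 1 0" using bij by (metis bij_pointE)
  have unit: "omult (oct_of 1 0) y = y" "omult y (oct_of 1 0) = y" for y :: "'a oct"
    by (cases y rule: oct_of_cases; simp add: oct_of_mult dotp_def cross_def vec_eq_iff forall_7)+
  have "\<phi> (oct_of 1 0) = omult (\<phi> (oct_of 1 0)) (\<phi> e)" by (simp add: e unit)
  also have "\<dots> = \<phi> (omult (oct_of 1 0) e)" by (rule mult[symmetric])
  also have "\<dots> = oct_of 1 0" by (simp only: unit e)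
  finally have one: "\<phi> (oct_of 1 0) = oct_of 1 0" .
  have \<phi>: "\<phi> (oct_of r x) = oct_of r (A *v x)" for r x
  proof -
    have "\<phi> (oct_of r 0) = oct_of r 0"
      using sc[of r "oct_of 1 0"] one by (simp add: oct_of_scale)
    then show ?thesis using add[of "oct_of r 0" "oct_of 0 x"] by (simp add: im oct_of_add)
  qed
  have "oct_of (- dotp x y) (A *v cross x y) = oct_of (- dotp (A *v x) (A *v y)) (cross (A *v x) (A *v y))" for x y
    using mult[of "oct_of 0 x" "oct_of 0 y"] by (simp add: oct_of_mult \<phi>)
  then have "dotp (A *v x) (A *v y) = dotp x y" "A *v cross x y = cross (A *v x) (A *v y)" for x y
    by auto
  then show "transpose A ** A = mat 1 \<and> (\<forall>x y. A *v cross x y = cross (A *v x) (A *v y))"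
    by (simp add: matrix_eq_dotp[of "transpose A ** A"] dotp_matrix)
next
  assume A: "transpose A ** A = mat 1 \<and> (\<forall>x y. A *v cross x y = cross (A *v x) (A *v y))"
  define \<phi> :: "'a oct \<Rightarrow> 'a oct" where
    "\<phi> o' = (THE p. \<exists>r x. o' = oct_of r x \<and> p = oct_of r (A *v x))" for o'
  have \<phi>: "\<phi> (oct_of r x) = oct_of r (A *v x)" for r x
    unfolding \<phi>_def by (rule the_equality) auto
  have AA: "A ** transpose A = mat 1" using A by (simp add: matrix_left_right_inverse)
  have dot: "dotp (A *v x) (A *v y) = dotp x y" for x y
    using A by (simp add: dotp_matrix)
  have lin: "A *v (c *s x) = c *s (A *v x)" for c x by (simp add: vector_scalar_commute)
  have "bij \<phi>"
  proof (rule bijI)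
    show "inj \<phi>"
    proof (rule injI)
      fix o1 o2 assume eq: "\<phi> o1 = \<phi> o2"
      obtain r x s y where o: "o1 = oct_of r x" "o2 = oct_of s y" by (metis oct_of_cases)
      then have "r = s" "A *v x = A *v y" using eq by (auto simp: \<phi>)
      then have "transpose A *v (A *v x) = transpose A *v (A *v y)" by metis
      then have "x = y" using A by (simp only: matrix_vector_mul_assoc matrix_vector_mul_lid)
      then show "o1 = o2" using o \<open>r = s\<close> by simp
    qed
    show "surj \<phi>"
    proof (rule surjI)
      show "\<phi> ((\<lambda>o'. THE p. \<exists>r x. o' = oct_of r x \<and> p = oct_of r (transpose A *v x)) o') = o'" for o'
      proof -
        obtain r x where o: "o' = oct_of r x" by (rule oct_of_cases)
        have "(THE p. \<exists>r x. o' = oct_of r x \<and> p = oct_of r (transpose A *v x)) = oct_of r (transpose A *v x)"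
          unfolding o by (rule the_equality) auto
        then show ?thesis
          by (simp add: \<phi> o matrix_vector_mul_assoc AA del: transpose_matrix_vector)
      qed
    qed
  qed
  moreover have "\<phi> (x + y) = \<phi> x + \<phi> y" for x y
    by (cases x rule: oct_of_cases; cases y rule: oct_of_cases)
      (simp add: oct_of_add \<phi> matrix_vector_right_distrib)
  moreover have "\<phi> (oscale c x) = oscale c (\<phi> x)" for c x
    by (cases x rule: oct_of_cases) (simp add: oct_of_scale \<phi> lin)
  moreover have "\<phi> (omult x y) = omult (\<phi> x) (\<phi> y)" for x y
    using A by (cases x rule: oct_of_cases; cases y rule: oct_of_cases)
      (simp add: oct_of_mult \<phi> matrix_vector_right_distrib lin dot)
  ultimately show "A \<in> oct_aut_im"
    unfolding oct_aut_im_def oct_aut_def by (auto simp: im_oct_eq \<phi> intro!: exI[of _ \<phi>])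
qed

section \<open>Real points of the complex automorphism group\<close>

lemma cross_bounded_bilinear:
  "bounded_bilinear (cross :: 'a::{real_normed_field,euclidean_space}^7 \<Rightarrow> 'a^7 \<Rightarrow> 'a^7)"
  unfolding bilinear_conv_bounded_bilinear[symmetric] bilinear_def
  by (auto intro!: linearI simp: cross_def vec_eq_iff forall_7 algebra_simps)

interpretation cr: bounded_bilinear "cross :: 'a::{real_normed_field,euclidean_space}^7 \<Rightarrow> 'a^7 \<Rightarrow> 'a^7"
  by (rule cross_bounded_bilinear)

text \<open>Testing on basis vectors frees the condition from the field over which the vectors
  range, so that a real matrix satisfies it over the reals iff it does over the complex
  numbers.\<close>

lemma cross_preserving_iff_axis:
  fixes A :: "'a::field^7^7"
  shows "(\<forall>x y. A *v cross x y = cross (A *v x) (A *v y)) \<longleftrightarrow>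
    (\<forall>i j. A *v cross (axis i 1) (axis j 1) = cross (column i A) (column j A))"
proof
  assume R: "\<forall>i j. A *v cross (axis i 1) (axis j 1) = cross (column i A) (column j A)"
  have cross_sum: "cross (\<Sum>i\<in>UNIV. a i *s u i) (\<Sum>j\<in>UNIV. b j *s v j) =
      (\<Sum>i\<in>UNIV. \<Sum>j\<in>UNIV. (a i * b j) *s cross (u i) (v j))" for a b :: "7 \<Rightarrow> 'a" and u v
  proof -
    have 1: "cross (u + u') v = cross u v + cross u' v" "cross v (u + u') = cross v u + cross v u'"
      "cross (c *s u) v = c *s cross u v" "cross u (c *s v) = c *s cross u v" for u u' v :: "'a^7" and c
      by (simp_all add: cross_def vec_eq_iff forall_7 algebra_simps)
    have 2: "cross 0 v = 0" "cross v 0 = 0" for v :: "'a^7"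
      by (simp_all add: cross_def vec_eq_iff forall_7)
    have 3: "cross (sum f I) v = (\<Sum>i\<in>I. cross (f i) v)" "cross v (sum f I) = (\<Sum>i\<in>I. cross v (f i))"
      if "finite I" for I :: "7 set" and f and v :: "'a^7"
      using that by (induction I) (simp_all add: 1 2)
    have "cross (\<Sum>i\<in>UNIV. a i *s u i) w = (\<Sum>i\<in>UNIV. a i *s cross (u i) w)" for w
      by (simp only: 3(1)[OF finite] 1(3))
    moreover have "cross (u i) (\<Sum>j\<in>UNIV. b j *s v j) = (\<Sum>j\<in>UNIV. b j *s cross (u i) (v j))" for i
      by (simp only: 3(2)[OF finite] 1(4))
    ultimately show ?thesis
      by (simp only: vec.scale_sum_right vec.scale_scale)
  qed
  have A_sum: "A *v (\<Sum>i\<in>I. f i) = (\<Sum>i\<in>I. A *v f i)" if "finite I" for I :: "7 set" and f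
    using that by (induction I) (simp_all add: matrix_vector_right_distrib)
  have col: "A *v x = (\<Sum>i\<in>UNIV. x $ i *s column i A)" for x
    by (simp add: matrix_mult_sum)
  show "\<forall>x y. A *v cross x y = cross (A *v x) (A *v y)"
  proof (intro allI)
    fix x y
    have "A *v cross x y = A *v cross (\<Sum>i\<in>UNIV. x $ i *s axis i 1) (\<Sum>i\<in>UNIV. y $ i *s axis i 1)"
      by (simp add: basis_expansion)
    also have "\<dots> = cross (A *v x) (A *v y)"
      unfolding col[of x] col[of y] cross_sum using R
      by (simp add: A_sum vector_scalar_commute)
    finally show "A *v cross x y = cross (A *v x) (A *v y)" .
  qed
next
  have "A *v axis i 1 = column i A" for i
    by (simp add: vec_eq_iff matrix_vector_mult_def column_def axis_def if_distrib cong: if_cong)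
  moreover assume "\<forall>x y. A *v cross x y = cross (A *v x) (A *v y)"
  ultimately show "\<forall>i j. A *v cross (axis i 1) (axis j 1) = cross (column i A) (column j A)"
    by simp
qed

lemma oct_aut_im_mreal: "mreal A \<in> oct_aut_im \<longleftrightarrow> A \<in> oct_aut_im"
proof -
  have "transpose (mreal A) = mreal (transpose A)" by (simp add: vec_eq_iff transpose_def)
  then have T: "transpose (mreal A) ** mreal A = mreal (transpose A ** A)" by (simp add: mreal_mult)
  define c :: "real^7 \<Rightarrow> complex^7" where "c x = (\<chi> k. complex_of_real (x $ k))" for x
  have c: "cross (c x) (c y) = c (cross x y)" "mreal A *v c x = c (A *v x)" "c x = c y \<longleftrightarrow> x = y" for x y
    by (simp_all add: c_def cross_def matrix_vector_mult_def vec_eq_iff forall_7)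
  have C: "axis i 1 = c (axis i 1)" "column i (mreal A) = c (column i A)" for i
    by (simp_all add: c_def axis_def column_def vec_eq_iff)
  have "mreal (transpose A ** A) = mat 1 \<longleftrightarrow> transpose A ** A = mat 1"
    by (metis mreal_inj mreal_mat_1)
  then show ?thesis
    unfolding oct_aut_im_iff cross_preserving_iff_axis T C c by simp
qed

section \<open>The groups and their Lie algebras as matrix conditions\<close>

lemma G2C_iff: "A \<in> G2C \<longleftrightarrow> transpose A ** A = mat 1 \<and> (\<forall>x y. A *v cross x y = cross (A *v x) (A *v y))"
  unfolding G2C_def by (rule oct_aut_im_iff)

lemma G2_iff: "A \<in> G2 \<longleftrightarrow> mconj A = A \<and> A \<in> G2C"
proof
  assume "A \<in> G2"
  then show "mconj A = A \<and> A \<in> G2C" by (auto simp: G2_def G2C_def oct_aut_im_mreal)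
next
  assume A: "mconj A = A \<and> A \<in> G2C"
  then obtain B where "A = mreal B" using mreal_ex by blast
  then show "A \<in> G2" using A by (auto simp: G2_def G2C_def oct_aut_im_mreal)
qed

lemma G2C_inverse:
  assumes "A \<in> G2C"
  shows "transpose A ** A = mat 1" "A ** transpose A = mat 1" "matrix_inv A = transpose A" "invertible A"
  using assms by (auto simp: G2C_iff matrix_left_right_inverse intro: matrix_inv_eqI invertibleI)

lemma G2C_mult: "A \<in> G2C \<Longrightarrow> B \<in> G2C \<Longrightarrow> A ** B \<in> G2C"
  by (simp add: G2C_iff matrix_transpose_mul flip: matrix_vector_mul_assoc)
    (metis matrix_mul_assoc matrix_mul_rid)

lemma G2C_transpose:
  assumes "A \<in> G2C"
  shows "transpose A \<in> G2C"
  unfolding G2C_iff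
proof (intro conjI allI)
  show "transpose (transpose A) ** transpose A = mat 1" using G2C_inverse[OF assms] by simp
  fix x y
  have "transpose A *v cross (A *v (transpose A *v x)) (A *v (transpose A *v y)) = transpose A *v (A *v cross (transpose A *v x) (transpose A *v y))"
    using assms by (simp only: G2C_iff)
  then show "transpose A *v cross x y = cross (transpose A *v x) (transpose A *v y)"
    by (simp only: matrix_vector_mul_assoc G2C_inverse[OF assms] matrix_vector_mul_lid)
qed

text \<open>The linearization of \<open>oct_aut_im_iff\<close> at the identity: skew matrices that
  are derivations of the cross product. This is the complex Lie algebra of type G2, see
  \<open>g2C_iff\<close>.\<close>

definition cder :: "cmat7 \<Rightarrow> bool" where
  "cder X \<longleftrightarrow> transpose X = - X \<and> (\<forall>x y. X *v cross x y = cross (X *v x) y + cross x (X *v y))"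

text \<open>The passage from Lie algebra to group: the defining equations of the group are constants
  of motion, also for a time-dependent coefficient.\<close>

lemma linear_ode_G2C:
  assumes Y: "\<And>t. (Y has_vector_derivative C t ** Y t) (at t)" and "Y 0 = mat 1"
    and C: "\<And>t. cder (C t)"
  shows "Y t \<in> G2C"
proof -
  have Yt: "((\<lambda>t. transpose (Y t)) has_vector_derivative - (transpose (Y t) ** C t)) (at t)" for t
    using bounded_linear.has_vector_derivative[OF transpose_bounded_linear Y[of t]] C[of t]
    by (simp add: matrix_transpose_mul cder_def mm.minus_right)
  have orth: "transpose (Y t) ** Y t = mat 1" for t
  proof -
    have "((\<lambda>t. transpose (Y t) ** Y t) has_vector_derivative 0) (at t)" for t
      using mm.has_vector_derivative[OF Yt[of t] Y[of t]] by (simp add: mm.minus_left matrix_mul_assoc)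
    from const_if_deriv_zero[of "\<lambda>t. transpose (Y t) ** Y t", OF this] show ?thesis
      using assms(2) by simp
  qed
  moreover have "Y t *v cross x y = cross (Y t *v x) (Y t *v y)" for x y
  proof -
    \<comment> \<open>The cross product pulled back by \<open>Y t\<close>; the transpose is the
      inverse by orthogonality. The derivation property of \<open>C t\<close> makes the derivative
      of \<open>w\<close> vanish.\<close>
    define w where "w t = transpose (Y t) *v cross (Y t *v x) (Y t *v y)" for t
    have "(w has_vector_derivative 0) (at t)" for t
    proof -
      have D: "((\<lambda>t. Y t *v z) has_vector_derivative C t *v (Y t *v z)) (at t)" for z
        using bounded_linear.has_vector_derivative[OF mv.bounded_linear_left Y[of t]]
        by (simp add: matrix_vector_mul_assoc)
      show ?thesis
        using mv.has_vector_derivative[OF Yt[of t] cr.has_vector_derivative[OF D[of x] D[of y]]] C[of t]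
        unfolding w_def by (simp add: cder_def mv.minus_left mv.add_right flip: matrix_vector_mul_assoc
          del: transpose_matrix_vector)
    qed
    then have "w t = w 0" by (rule const_if_deriv_zero)
    then have "Y t *v w t = Y t *v cross x y" using assms(2) by (simp add: w_def del: transpose_matrix_vector)
    moreover have "Y t ** transpose (Y t) = mat 1" using orth by (simp add: matrix_left_right_inverse)
    ultimately show ?thesis unfolding w_def by (simp only: matrix_vector_mul_assoc matrix_vector_mul_lid)
  qed
  ultimately show ?thesis by (simp add: G2C_iff)
qed

text \<open>One direction differentiates the two group conditions along the one-parameter group at
  0, the other integrates them by \<open>linear_ode_G2C\<close>.\<close>

lemma g2_iff: "X \<in> g2 \<longleftrightarrow> mconj X = X \<and> cder X"
proof
  assume "X \<in> g2"
  then obtain B where B: "X = mreal B" "\<And>s::real. mexp (s *\<^sub>R B) \<in> oct_aut_im" by (auto simp: g2_def)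
  define E where "E s = mexp (s *\<^sub>R X)" for s
  have E: "E s \<in> G2C" for s
    using oct_aut_im_mreal[of "mexp (s *\<^sub>R B)"] B
    by (simp add: mreal_mexp G2C_def E_def linear_scale[OF bounded_linear.linear[OF mreal_bounded_linear]])
  have E0: "E 0 = mat 1" by (simp add: E_def)
  have D: "(E has_vector_derivative X) (at 0)"
    using mexp_scaleR_deriv[of X 0] by (simp add: E_def[abs_def])
  have "((\<lambda>s. transpose (E s) ** E s) has_vector_derivative transpose X + X) (at 0)"
    using mm.has_vector_derivative[OF bounded_linear.has_vector_derivative[OF transpose_bounded_linear D] D] E0
    by (simp add: add.commute)
  moreover have "(\<lambda>s. transpose (E s) ** E s) = (\<lambda>s. mat 1)" using E by (simp add: G2C_iff)
  ultimately have "((\<lambda>s::real. mat 1) has_vector_derivative transpose X + X) (at 0)" by simp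
  from vector_derivative_unique_at[OF this has_vector_derivative_const]
  have 1: "transpose X + X = 0" .
  have 2: "X *v cross x y = cross (X *v x) y + cross x (X *v y)" for x y
  proof -
    have V: "((\<lambda>s. E s *v z) has_vector_derivative X *v z) (at 0)" for z
      by (rule bounded_linear.has_vector_derivative[OF mv.bounded_linear_left D])
    have "((\<lambda>s. cross (E s *v x) (E s *v y)) has_vector_derivative cross x (X *v y) + cross (X *v x) y) (at 0)"
      using cr.has_vector_derivative[OF V[of x] V[of y]] E0 by simp
    moreover have "(\<lambda>s. cross (E s *v x) (E s *v y)) = (\<lambda>s. E s *v cross x y)" using E by (simp add: G2C_iff)
    ultimately have "((\<lambda>s. E s *v cross x y) has_vector_derivative cross x (X *v y) + cross (X *v x) y) (at 0)"
      by simp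
    from vector_derivative_unique_at[OF V this] show ?thesis by (simp add: add.commute)
  qed
  show "mconj X = X \<and> cder X" using B 1 2 by (simp add: cder_def eq_neg_iff_add_eq_0)
next
  assume X: "mconj X = X \<and> cder X"
  then obtain B where B: "X = mreal B" using mreal_ex by blast
  have "mexp (s *\<^sub>R X) \<in> G2C" for s
    by (rule linear_ode_G2C[where C = "\<lambda>_. X"]) (use X mexp_scaleR_deriv in auto)
  then have "mexp (s *\<^sub>R B) \<in> oct_aut_im" for s
    by (simp add: B G2C_def oct_aut_im_mreal flip: mreal_mexp linear_scale[OF bounded_linear.linear[OF mreal_bounded_linear]])
  then show "X \<in> g2" by (auto simp: g2_def B)
qed

lemma cscale_vec: "(c *\<^sub>C A) *v x = c *s (A *v x)"
  by (simp add: vec_eq_iff matrix_vector_mult_def sum_distrib_left mult.assoc)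

lemma cross_smult: "cross (c *s x) y = c *s cross x y" "cross x (c *s y) = c *s cross x y"
  by (simp_all add: cross_def vec_eq_iff forall_7 algebra_simps)

lemma cder_add: "cder X \<Longrightarrow> cder Y \<Longrightarrow> cder (X + Y)"
  by (simp add: cder_def mv.add_left cr.add_left cr.add_right linear_add[OF bounded_linear.linear[OF transpose_bounded_linear]])

lemma cder_cscale: "cder X \<Longrightarrow> cder (c *\<^sub>C X)"
  by (simp add: cder_def cscale_vec cscale_transpose cs.minus_right cross_smult vector_add_ldistrib)

lemma cder_scaleR: "cder X \<Longrightarrow> cder (r *\<^sub>R X)"
  using cder_cscale[of X "of_real r"] by (simp add: cscale_of_real)

lemma cder_minus: "cder X \<Longrightarrow> cder (- X)"
  using cder_scaleR[of X "-1"] by simp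

lemma cder_diff: "cder X \<Longrightarrow> cder Y \<Longrightarrow> cder (X - Y)"
  using cder_add[of X "- Y"] cder_minus by simp

lemma cder_zero: "cder 0"
  by (simp add: cder_def vec_eq_iff transpose_def cr.zero_left cr.zero_right)

text \<open>The structure constants of the cross product are real, so conjugation of vectors
  commutes with it.\<close>

lemma cder_mconj:
  assumes "cder X"
  shows "cder (mconj X)"
proof -
  define c :: "complex^7 \<Rightarrow> complex^7" where "c x = (\<chi> i. cnj (x $ i))" for x
  have c: "mconj X *v x = c (X *v c x)" "cross (c x) (c y) = c (cross x y)" "c (c x) = x" "c (x + y) = c x + c y" for x y
    by (simp_all add: c_def vec_eq_iff matrix_vector_mult_def cross_def forall_7 sum_7)
  have "mconj X *v cross x y = cross (mconj X *v x) y + cross x (mconj X *v y)" for x y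
  proof -
    have "mconj X *v cross x y = c (X *v cross (c x) (c y))" by (simp add: c)
    also have "\<dots> = c (cross (X *v c x) (c y) + cross (c x) (X *v c y))" using assms by (simp add: cder_def)
    also have "\<dots> = cross (mconj X *v x) y + cross x (mconj X *v y)"
      by (simp only: c(4) c(2)[symmetric] c(3) c(1))
    finally show ?thesis .
  qed
  then show ?thesis using assms by (simp add: cder_def mconj_minus flip: mconj_transpose)
qed

lemma cder_bracket:
  assumes "cder X" "cder Y"
  shows "cder (bracket X Y)"
  using assms
  by (simp add: cder_def bracket_def mm.minus_left mm.minus_right matrix_transpose_mul mv.diff_left
      linear_diff[OF bounded_linear.linear[OF transpose_bounded_linear]]
      mv.add_right cr.diff_left cr.diff_right flip: matrix_vector_mul_assoc)

text \<open>Real and imaginary part of a complex derivation are real derivations. Membership in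
  \<open>eigsp\<close> thereby becomes a set of linear equations.\<close>

lemma g2C_iff: "X \<in> g2C \<longleftrightarrow> cder X"
proof
  assume "X \<in> g2C"
  then show "cder X" by (auto simp: g2C_def g2_iff intro: cder_add cder_cscale)
next
  assume X: "cder X"
  define U where "U = (1/2) *\<^sub>R (X + mconj X)"
  define V where "V = (- \<i> / 2) *\<^sub>C (X - mconj X)"
  have "U \<in> g2" using X unfolding g2_iff U_def
    by (simp add: mconj_scaleR mconj_add add.commute cder_scaleR cder_add cder_mconj)
  moreover have "V \<in> g2" using X unfolding g2_iff V_def
    by (simp add: cder_cscale cder_diff cder_mconj) (simp add: vec_eq_iff algebra_simps)
  moreover have "X = U + \<i> *\<^sub>C V" by (simp add: U_def V_def vec_eq_iff scaleR_conv_of_real[where 'a = complex] field_simps)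
  ultimately show "X \<in> g2C" unfolding g2C_def by blast
qed

section \<open>The torus and the eigenspaces of the automorphism\<close>

definition diagm :: "('n \<Rightarrow> complex) \<Rightarrow> complex^'n^'n" where
  "diagm d = (\<chi> i j. if i = j then d i else 0)"

lemma diagm_nth: "diagm d $ i $ j = (if i = j then d i else 0)"
  by (simp add: diagm_def)

lemma diagm_mult_left_nth: "(diagm d ** A) $ i $ j = d i * A $ i $ j"
  and diagm_mult_right_nth: "(A ** diagm d) $ i $ j = A $ i $ j * d j"
  by (simp_all add: matrix_matrix_mult_def diagm_nth if_distrib if_distribR cong: if_cong)

lemma diagm_mult: "diagm d ** diagm e = diagm (\<lambda>i. d i * e i)"
  by (simp add: vec_eq_iff diagm_mult_left_nth) (simp add: diagm_nth)

lemma diagm_one: "diagm (\<lambda>_. 1) = mat 1"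
  by (simp add: vec_eq_iff diagm_nth mat_def)

lemma mexp_diagm: "mexp (diagm d) = diagm (\<lambda>i. exp (d i))"
proof -
  define Y where "Y t = diagm (\<lambda>i. exp (of_real t * d i))" for t
  have "Y 1 = mexp (1 *\<^sub>R diagm d)"
  proof (rule mexp_unique)
    fix t
    have "((\<lambda>t. exp (of_real t * d i)) has_vector_derivative d i * exp (of_real t * d i)) (at t)" for i
      by (rule has_vector_derivative_real_field[where f = "\<lambda>z. exp (z * d i)"])
        (auto intro!: derivative_eq_intros)
    then show "(Y has_vector_derivative diagm d ** Y t) (at t)"
      unfolding Y_def has_vector_derivative_vec_nth diagm_mult by (auto simp: diagm_nth)
  qed (simp add: Y_def diagm_one)
  then show ?thesis by (simp add: Y_def)
qed

text \<open>The entries of \<open>Qm\<close> are named constants so that products of them are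
  evaluated by \<open>sqrt2_simps\<close> without unfolding square roots.\<close>

definition rsqrt2 :: complex where
  "rsqrt2 = complex_of_real (1 / sqrt 2)"

definition isqrt2 :: complex where
  "isqrt2 = \<i> * complex_of_real (1 / sqrt 2)"

lemma sqrt2_simps:
  "cnj rsqrt2 = rsqrt2" "cnj isqrt2 = - isqrt2"
  "rsqrt2 * rsqrt2 = 1 / 2" "isqrt2 * isqrt2 = - (1 / 2)"
  "rsqrt2 * \<i> = isqrt2" "isqrt2 * \<i> = - rsqrt2"
  by (simp_all add: rsqrt2_def isqrt2_def complex_eq_iff)

text \<open>A unitary matrix whose columns are weight vectors of the torus.\<close>

definition Qm :: cmat7 where
  "Qm = vector
    [vector [1, 0, 0, 0, 0, 0, 0],
     vector [0, rsqrt2, rsqrt2, 0, 0, 0, 0],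
     vector [0, - isqrt2, isqrt2, 0, 0, 0, 0],
     vector [0, 0, 0, rsqrt2, rsqrt2, 0, 0],
     vector [0, 0, 0, - isqrt2, isqrt2, 0, 0],
     vector [0, 0, 0, 0, 0, rsqrt2, rsqrt2],
     vector [0, 0, 0, 0, 0, - isqrt2, isqrt2]]"

lemma Qm_row:
  "Qm $ 1 = vector [1, 0, 0, 0, 0, 0, 0]"
  "Qm $ 2 = vector [0, rsqrt2, rsqrt2, 0, 0, 0, 0]"
  "Qm $ 3 = vector [0, - isqrt2, isqrt2, 0, 0, 0, 0]"
  "Qm $ 4 = vector [0, 0, 0, rsqrt2, rsqrt2, 0, 0]"
  "Qm $ 5 = vector [0, 0, 0, - isqrt2, isqrt2, 0, 0]"
  "Qm $ 6 = vector [0, 0, 0, 0, 0, rsqrt2, rsqrt2]"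
  "Qm $ 7 = vector [0, 0, 0, 0, 0, - isqrt2, isqrt2]"
  unfolding Qm_def by (simp_all only: vector_7)

definition adj :: "complex^'n^'m \<Rightarrow> complex^'m^'n" where
  "adj A = mconj (transpose A)"

lemma adj_nth [simp]: "adj A $ i $ j = cnj (A $ j $ i)"
  by (simp add: adj_def transpose_def)

lemma adj_adj [simp]: "adj (adj A) = A"
  by (simp add: vec_eq_iff)

lemma adj_mult: "adj (A ** B) = adj B ** adj A"
  by (simp add: adj_def matrix_transpose_mul mconj_mult)

lemma Qm_unitary: "adj Qm ** Qm = mat 1" "Qm ** adj Qm = mat 1"
proof -
  show "adj Qm ** Qm = mat 1"
    by (simp add: vec_eq_iff forall_7 matrix_matrix_mult_def sum_7 Qm_row mat_def sqrt2_simps)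
  then show "Qm ** adj Qm = mat 1" by (simp add: matrix_left_right_inverse)
qed

text \<open>The eigenvalues of \<open>hgen\<close> divided by i, in the order of the columns of
  \<open>Qm\<close>. The pair 3, -3 stems from the entry - a - b of \<open>Mgen\<close> at a = 1, b
  = 2.\<close>

definition wt :: "7 \<Rightarrow> real" where
  "wt j = vector [0, 1, - 1, 2, - 2, 3, - 3] $ j"

abbreviation hgen :: cmat7 where
  "hgen \<equiv> Mgen 1 0 0 0 0 + 2 *\<^sub>R Mgen 0 1 0 0 0"

lemma Mgen_row:
  "Mgen a b c d e $ 1 = vector [0, - c, \<i> * c, 0, 0, 0, 0]"
  "Mgen a b c d e $ 2 = vector [c, 0, - a, - d, \<i> * d, 0, 0]"
  "Mgen a b c d e $ 3 = vector [- \<i> * c, a, 0, - \<i> * d, - d, 0, 0]"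
  "Mgen a b c d e $ 4 = vector [0, d, \<i> * d, 0, - b, - e + \<i> / 2 * c, - \<i> * e + 1 / 2 * c]"
  "Mgen a b c d e $ 5 = vector [0, - \<i> * d, d, b, 0, - \<i> * e - 1 / 2 * c, e + \<i> / 2 * c]"
  "Mgen a b c d e $ 6 = vector [0, 0, 0, e - \<i> / 2 * c, \<i> * e + 1 / 2 * c, 0, - a - b]"
  "Mgen a b c d e $ 7 = vector [0, 0, 0, \<i> * e - 1 / 2 * c, - e - \<i> / 2 * c, a + b, 0]"
  unfolding Mgen_def by (simp_all only: vector_7)

lemma hgen_row:
  "hgen $ 1 = 0"
  "hgen $ 2 = vector [0, 0, - 1, 0, 0, 0, 0]"
  "hgen $ 3 = vector [0, 1, 0, 0, 0, 0, 0]"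
  "hgen $ 4 = vector [0, 0, 0, 0, - 2, 0, 0]"
  "hgen $ 5 = vector [0, 0, 0, 2, 0, 0, 0]"
  "hgen $ 6 = vector [0, 0, 0, 0, 0, 0, - 3]"
  "hgen $ 7 = vector [0, 0, 0, 0, 0, 3, 0]"
  unfolding vector_add_component vector_scaleR_component Mgen_row
  by (simp_all only: vec_eq_iff forall_7 vector_add_component vector_scaleR_component vector_7
      zero_index)
    (simp_all add: scaleR_conv_of_real[where 'a = complex])

lemma hgen_Qm: "hgen ** Qm = Qm ** diagm (\<lambda>j. \<i> * wt j)"
proof -
  define G where "G = hgen"
  have "\<forall>i j. (G ** Qm) $ i $ j = Qm $ i $ j * (\<i> * complex_of_real (wt j))"
    unfolding matrix_matrix_mult_def sum_7 vec_lambda_beta forall_7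
    by (simp only: hgen_row[folded G_def] Qm_row vector_7 wt_def zero_index)
      (simp add: isqrt2_def rsqrt2_def)
  then show ?thesis by (simp add: vec_eq_iff diagm_mult_right_nth G_def)
qed

lemma hgen_real: "mconj hgen = hgen"
  unfolding vec_eq_iff forall_7 mconj_nth hgen_row by simp

text \<open>The matrix in the weight basis. As \<open>Qm\<close> is unitary, \<open>qc\<close>
  respects products, exponentials and adjoints; transposes are not respected, so skew-symmetry has
  to be exploited before the change of basis.\<close>

definition qc :: "cmat7 \<Rightarrow> cmat7" where
  "qc A = adj Qm ** A ** Qm"

lemma qc_mult: "qc (A ** B) = qc A ** qc B"
proof -
  have "qc A ** qc B = adj Qm ** A ** (Qm ** adj Qm) ** B ** Qm"
    by (simp add: qc_def matrix_mul_assoc)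
  then show ?thesis by (simp add: Qm_unitary qc_def matrix_mul_assoc)
qed

lemma qc_one: "qc (mat 1) = mat 1"
  by (simp add: qc_def Qm_unitary)

lemma qc_inverse: "Qm ** qc A ** adj Qm = A"
proof -
  have "Qm ** qc A ** adj Qm = (Qm ** adj Qm) ** A ** (Qm ** adj Qm)"
    by (simp add: qc_def matrix_mul_assoc)
  then show ?thesis by (simp add: Qm_unitary)
qed

lemma qc_inject: "qc A = qc B \<longleftrightarrow> A = B"
  by (metis qc_inverse)

lemma qc_mexp: "qc (mexp A) = mexp (qc A)"
  unfolding qc_def by (rule mexp_conj) (rule Qm_unitary)

lemma qc_add: "qc (A + B) = qc A + qc B"
  and qc_diff: "qc (A - B) = qc A - qc B"
  and qc_scaleR: "qc (r *\<^sub>R A) = r *\<^sub>R qc A"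
  and qc_cscale: "qc (c *\<^sub>C A) = c *\<^sub>C qc A"
  and qc_adj: "qc (adj A) = adj (qc A)"
  by (simp_all add: qc_def mm.add_left mm.add_right mm.diff_left mm.diff_right mm.scaleR_left
      mm.scaleR_right cscale_mult_left cscale_mult_right adj_mult matrix_mul_assoc)

lemma qc_hmat: "qc hmat = diagm (\<lambda>j. cis (wt j * pi / 3))"
proof -
  have "qc hgen = adj Qm ** (hgen ** Qm)" by (simp add: qc_def matrix_mul_assoc)
  also have "\<dots> = diagm (\<lambda>j. \<i> * wt j)"
    by (simp add: hgen_Qm matrix_mul_assoc Qm_unitary)
  finally have "qc ((pi / 3) *\<^sub>R hgen) = diagm (\<lambda>j. \<i> * of_real (wt j * pi / 3))"
    by (simp add: qc_scaleR vec_eq_iff diagm_nth scaleR_conv_of_real[where 'a = complex])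
  then show ?thesis
    unfolding hmat_def qc_mexp by (simp add: mexp_diagm cis_conv_exp)
qed

lemma hmat_inv: "matrix_inv hmat ** hmat = mat 1" "hmat ** matrix_inv hmat = mat 1"
proof -
  have "mexp ((pi / 3) *\<^sub>R hgen) ** mexp (- ((pi / 3) *\<^sub>R hgen)) = mat 1" by (rule mexp_minus)
  then show "hmat ** matrix_inv hmat = mat 1" unfolding hmat_def by (simp add: matrix_inv_eqI)
  then show "matrix_inv hmat ** hmat = mat 1" by (simp add: matrix_left_right_inverse)
qed

lemma hmat_real: "mconj hmat = hmat"
proof -
  obtain B where "(pi / 3) *\<^sub>R hgen = mreal B"
    using mreal_ex[of "(pi / 3) *\<^sub>R hgen"] hgen_real by (auto simp: mconj_scaleR)
  then show ?thesis unfolding hmat_def by (simp flip: mreal_mexp)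
qed

lemma hmat_inv_real: "mconj (matrix_inv hmat) = matrix_inv hmat"
proof -
  have "hmat ** mconj (matrix_inv hmat) = mconj (hmat ** matrix_inv hmat)"
    by (simp add: mconj_mult hmat_real)
  then have "hmat ** mconj (matrix_inv hmat) = mat 1" by (simp add: hmat_inv)
  then show ?thesis by (rule matrix_inv_eqI[symmetric])
qed

section \<open>The automorphism of order six and its eigenspaces\<close>

lemma sigma_mult: "sigma (A ** B) = sigma A ** sigma B"
proof -
  have "sigma A ** sigma B = matrix_inv hmat ** A ** (hmat ** matrix_inv hmat) ** B ** hmat"
    by (simp add: sigma_def matrix_mul_assoc)
  then show ?thesis by (simp add: hmat_inv sigma_def matrix_mul_assoc)
qed

lemma sigma_one: "sigma (mat 1) = mat 1"
  by (simp add: sigma_def hmat_inv)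

lemma sigma_add: "sigma (A + B) = sigma A + sigma B"
  and sigma_diff: "sigma (A - B) = sigma A - sigma B"
  and sigma_cscale: "sigma (c *\<^sub>C A) = c *\<^sub>C sigma A"
  and sigma_scaleR: "sigma (r *\<^sub>R A) = r *\<^sub>R sigma A"
  and sigma_mconj: "sigma (mconj A) = mconj (sigma A)"
  by (simp_all add: sigma_def mm.add_left mm.add_right mm.diff_left mm.diff_right mm.scaleR_left
      mm.scaleR_right cscale_mult_left cscale_mult_right mconj_mult hmat_real hmat_inv_real)

lemma sigma_bounded_linear: "bounded_linear sigma"
  unfolding linear_conv_bounded_linear[symmetric]
  by (intro linearI) (simp_all add: sigma_add sigma_scaleR)

lemma eigsp_iff: "X \<in> eigsp j \<longleftrightarrow> cder X \<and> sigma X = cis (of_int j * pi / 3) *\<^sub>C X"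
  by (simp add: eigsp_def g2C_iff)

lemma eigsp_0_iff: "X \<in> eigsp 0 \<longleftrightarrow> cder X \<and> sigma X = X"
  by (simp add: eigsp_iff)

lemma eigsp_add: "X \<in> eigsp j \<Longrightarrow> Y \<in> eigsp j \<Longrightarrow> X + Y \<in> eigsp j"
  and eigsp_cscale: "X \<in> eigsp j \<Longrightarrow> c *\<^sub>C X \<in> eigsp j"
  and eigsp_zero: "0 \<in> eigsp j"
  using sigma_cscale[of 0 0]
  by (simp_all add: eigsp_iff cder_add cder_cscale cder_zero sigma_add sigma_cscale cs.add_right
      mult.commute cs.zero_right cs.zero_left)

lemma eigsp_scaleR: "X \<in> eigsp j \<Longrightarrow> r *\<^sub>R X \<in> eigsp j"
  using eigsp_cscale[of X j "of_real r"] by (simp add: cscale_of_real)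

lemma eigsp_mconj: "X \<in> eigsp j \<Longrightarrow> mconj X \<in> eigsp (- j)"
  by (simp add: eigsp_iff cder_mconj sigma_mconj mconj_cscale cis_cnj)

lemma eigsp_bracket: "X \<in> eigsp j \<Longrightarrow> Y \<in> eigsp k \<Longrightarrow> bracket X Y \<in> eigsp (j + k)"
  by (simp add: eigsp_iff cder_bracket)
    (simp add: bracket_def sigma_diff sigma_mult cscale_mult_left cscale_mult_right cs.diff_right
      cis_mult ring_distribs add_divide_distrib add.commute)

text \<open>Strictly triangular matrices once the indices are sorted by \<open>\<mu>\<close>.
  Entries between indices with equal values of \<open>\<mu>\<close> vanish, so no total order of the
  basis has to be chosen.\<close>

definition strict_upper :: "('n \<Rightarrow> real) \<Rightarrow> (complex^'n^'n) set" where
  "strict_upper \<mu> = {A. \<forall>i j. A $ i $ j \<noteq> 0 \<longrightarrow> \<mu> i > \<mu> j}"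

text \<open>The matrix picture of \<open>B\<close>: the diagonal comes from exp (i t), the rest from
  the unipotent group. Positivity of the diagonal separates it from the compact torus.\<close>

definition tri_pos :: "('n \<Rightarrow> real) \<Rightarrow> (complex^'n^'n) set" where
  "tri_pos \<mu> = {A. (\<forall>i. A $ i $ i \<in> \<real> \<and> Re (A $ i $ i) > 0) \<and>
    (\<forall>i j. i \<noteq> j \<longrightarrow> A $ i $ j \<noteq> 0 \<longrightarrow> \<mu> i > \<mu> j)}"

lemma strict_upper_subspace: "subspace (strict_upper \<mu>)"
  by (rule subspaceI) (auto simp: strict_upper_def, metis add.right_neutral)

lemma matrix_mult_nonzeroE:
  fixes A :: "complex^'n^'m"
  assumes "(A ** B) $ i $ j \<noteq> 0"
  obtains k where "A $ i $ k \<noteq> 0" "B $ k $ j \<noteq> 0"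
proof -
  have "\<exists>k. A $ i $ k * B $ k $ j \<noteq> 0"
    using assms unfolding matrix_matrix_mult_def by (metis (mono_tags, lifting) sum.neutral vec_lambda_beta)
  then show ?thesis using that by auto
qed

lemma strict_upper_mult:
  assumes "A \<in> strict_upper \<mu>" "B \<in> strict_upper \<mu>"
  shows "A ** B \<in> strict_upper \<mu>"
  unfolding strict_upper_def
proof (intro CollectI allI impI)
  fix i j assume "(A ** B) $ i $ j \<noteq> 0"
  then obtain k where "A $ i $ k \<noteq> 0" "B $ k $ j \<noteq> 0" by (rule matrix_mult_nonzeroE)
  then have "\<mu> i > \<mu> k" "\<mu> k > \<mu> j" using assms by (auto simp: strict_upper_def)
  then show "\<mu> i > \<mu> j" by simp
qed

text \<open>All powers with positive exponent stay in \<open>strict_upper\<close>, so every other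
  entry of the exponential receives only the identity term.\<close>

lemma mexp_strict_upper:
  assumes "A \<in> strict_upper \<mu>"
  shows "mexp A \<in> tri_pos \<mu>"
proof -
  have pow: "mpow A (Suc n) \<in> strict_upper \<mu>" for n
    by (induction n) (use assms strict_upper_mult in auto)
  have "mexp A $ i $ j = mat 1 $ i $ j" if "\<not> \<mu> i > \<mu> j" for i j
  proof -
    have "mpow A n $ i $ j / fact n * 1 ^ n = (if n = 0 then mat 1 $ i $ j else 0)" for n
      using pow[of "n - 1"] that by (cases n) (auto simp: strict_upper_def)
    then have "(\<lambda>n. mpow A n $ i $ j / fact n * 1 ^ n) sums mat 1 $ i $ j"
      using sums_single[of 0 "\<lambda>_. mat 1 $ i $ j :: complex"] by simp
    from sums_unique2[OF this mexp_cscale_nth] show ?thesis by simp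
  qed
  then show ?thesis by (auto simp: tri_pos_def mat_def) (metis not_less)+
qed

lemma tri_pos_mult:
  assumes A: "A \<in> tri_pos \<mu>" and B: "B \<in> tri_pos \<mu>"
  shows "A ** B \<in> tri_pos \<mu>"
  unfolding tri_pos_def
proof (intro CollectI conjI allI impI)
  fix i
  \<comment> \<open>A product that passes through another index would need \<mu> i > \<mu> k > \<mu>
    i, so the diagonal entries just multiply.\<close>
  have off: "A $ i $ k * B $ k $ i = 0" if "k \<noteq> i" for k
  proof (rule ccontr)
    assume "A $ i $ k * B $ k $ i \<noteq> 0"
    then have "\<mu> i > \<mu> k" "\<mu> k > \<mu> i" using A B that by (auto simp: tri_pos_def)
    then show False by simp
  qed
  have "(A ** B) $ i $ i = A $ i $ i * B $ i $ i + (\<Sum>k\<in>UNIV - {i}. A $ i $ k * B $ k $ i)"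
    unfolding matrix_matrix_mult_def by (simp add: sum.remove[of UNIV i])
  also have "(\<Sum>k\<in>UNIV - {i}. A $ i $ k * B $ k $ i) = 0"
    by (rule sum.neutral) (use off in blast)
  finally have "(A ** B) $ i $ i = A $ i $ i * B $ i $ i" by simp
  moreover have "A $ i $ i \<in> \<real>" "B $ i $ i \<in> \<real>" "Re (A $ i $ i) > 0" "Re (B $ i $ i) > 0"
    using A B by (auto simp: tri_pos_def)
  ultimately show "(A ** B) $ i $ i \<in> \<real>" "Re ((A ** B) $ i $ i) > 0"
    by (auto simp: complex_is_Real_iff)
next
  fix i j :: 'a assume "i \<noteq> j" "(A ** B) $ i $ j \<noteq> 0"
  then obtain k where "A $ i $ k \<noteq> 0" "B $ k $ j \<noteq> 0" by (meson matrix_mult_nonzeroE)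
  then have "i = k \<or> \<mu> i > \<mu> k" "k = j \<or> \<mu> k > \<mu> j"
    using A B by (auto simp: tri_pos_def)
  then show "\<mu> i > \<mu> j" using \<open>i \<noteq> j\<close> by auto
qed

lemma diagm_tri_pos: "diagm (\<lambda>i. exp (complex_of_real (d i))) \<in> tri_pos \<mu>"
  by (auto simp: tri_pos_def diagm_nth simp flip: of_real_exp)

text \<open>The uniqueness behind an Iwasawa decomposition: the adjoint is triangular in the
  opposite direction, so the matrix is diagonal, and positive diagonal entries of modulus 1 are
  1.\<close>

lemma unitary_tri_pos:
  assumes A: "A \<in> tri_pos \<mu>" and adj: "adj A \<in> tri_pos \<mu>" and u: "adj A ** A = mat 1"
  shows "A = mat 1"
proof -
  have off: "A $ i $ j = 0" if "i \<noteq> j" for i j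
  proof (rule ccontr)
    assume nz: "A $ i $ j \<noteq> 0"
    then have "\<mu> i > \<mu> j" using A that by (auto simp: tri_pos_def)
    moreover have "\<mu> j > \<mu> i" using adj that nz unfolding tri_pos_def by (auto dest!: spec[of _ j])
    ultimately show False by simp
  qed
  have diag: "A $ i $ i = 1" for i
  proof -
    have "(adj A ** A) $ i $ i = cnj (A $ i $ i) * A $ i $ i"
      unfolding matrix_matrix_mult_def using off by (simp add: sum.remove[of UNIV i])
    then have "cnj (A $ i $ i) * A $ i $ i = 1" using u by (simp add: mat_def)
    moreover obtain a where a: "A $ i $ i = complex_of_real a" "a > 0"
      using A unfolding tri_pos_def by (auto elim!: Reals_cases dest!: spec[of _ i])
    ultimately have "complex_of_real (a\<^sup>2) = 1" by (simp add: power2_eq_square)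
    then have "a\<^sup>2 = 1" by (simp only: of_real_eq_1_iff)
    then show ?thesis using a by (auto simp: power2_eq_1_iff)
  qed
  show ?thesis using off diag by (auto simp: vec_eq_iff mat_def)
qed

section \<open>Torus and solvable group in the weight basis\<close>

lemma cis_wt:
  "cis (wt 1 * pi / 3) = 1"
  "cis (wt 2 * pi / 3) = Complex (1 / 2) (sqrt 3 / 2)"
  "cis (wt 3 * pi / 3) = Complex (1 / 2) (- (sqrt 3 / 2))"
  "cis (wt 4 * pi / 3) = Complex (- (1 / 2)) (sqrt 3 / 2)"
  "cis (wt 5 * pi / 3) = Complex (- (1 / 2)) (- (sqrt 3 / 2))"
  "cis (wt 6 * pi / 3) = - 1"
  "cis (wt 7 * pi / 3) = - 1"
  by (simp_all add: wt_def complex_eq_iff cos_60 sin_60 cos_120 sin_120)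

text \<open>A fixed point of \<open>sigma\<close> commutes with \<open>hmat\<close>, so entries
  between different eigenvalues of \<open>hmat\<close> vanish in the weight basis. The weights 3 and
  -3 share the eigenvalue -1; the two entries between them are killed by skew-symmetry. A real skew
  matrix is anti-Hermitian, hence the imaginary diagonal.\<close>

lemma tor_diag:
  assumes "T \<in> tor"
  obtains \<theta> :: "7 \<Rightarrow> real" where "qc T = diagm (\<lambda>j. \<i> * \<theta> j)"
proof -
  have T: "transpose T = - T" "mconj T = T" "sigma T = T"
    using assms by (auto simp: tor_def eigsp_0_iff g2_iff cder_def)
  have "hmat ** sigma T = T ** hmat"
    by (simp add: sigma_def matrix_mul_assoc hmat_inv)
  then have "qc hmat ** qc T = qc T ** qc hmat"
    by (simp add: T flip: qc_mult)
  then have comm: "cis (wt i * pi / 3) * qc T $ i $ j = qc T $ i $ j * cis (wt j * pi / 3)" for i j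
    by (simp only: qc_hmat vec_eq_iff diagm_mult_left_nth diagm_mult_right_nth)
  have skew: "T $ i $ j = - T $ j $ i" for i j
    using arg_cong[OF T(1), of "\<lambda>A. A $ j $ i"] by (simp add: transpose_def)
  have skew0: "T $ i $ i = 0" for i
    using skew[of i i] by (simp add: eq_neg_iff_add_eq_0 flip: mult_2)
  \<comment> \<open>On the coordinates 6 and 7 a skew matrix is a multiple of the rotation
    generator, which the columns 6 and 7 of \<open>Qm\<close> diagonalize.\<close>
  have off: "qc T $ 6 $ 7 = 0" "qc T $ 7 $ 6 = 0"
    using skew[of 6 7]
    by (simp_all add: qc_def matrix_matrix_mult_def sum_7 Qm_row skew0 sqrt2_simps(1,2) algebra_simps)
  have "i = j \<or> qc T $ i $ j = 0 \<or> i = 6 \<and> j = 7 \<or> i = 7 \<and> j = 6" for i j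
  proof -
    have "\<forall>i j. cis (wt i * pi / 3) = cis (wt j * pi / 3) \<longrightarrow> i = j \<or> i = 6 \<and> j = 7 \<or> i = 7 \<and> j = 6"
      unfolding forall_7 cis_wt by (simp add: complex_eq_iff)
    then have "cis (wt i * pi / 3) = cis (wt j * pi / 3) \<Longrightarrow> i = j \<or> i = 6 \<and> j = 7 \<or> i = 7 \<and> j = 6"
      by blast
    moreover have "cis (wt i * pi / 3) = cis (wt j * pi / 3) \<or> qc T $ i $ j = 0"
      using comm[of i j] by (auto simp add: mult.commute)
    ultimately show ?thesis by blast
  qed
  then have 1: "qc T $ i $ j = 0" if "i \<noteq> j" for i j using off that by blast
  have "adj T = - T" by (simp add: adj_def T mconj_minus)
  then have adj: "adj (qc T) = - qc T"
    using qc_adj[of T] by (simp add: qc_def mm.minus_left mm.minus_right)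
  have "cnj (qc T $ j $ j) = - qc T $ j $ j" for j
    using arg_cong[OF adj, of "\<lambda>A. A $ j $ j"] by simp
  then have "qc T $ j $ j = \<i> * Im (qc T $ j $ j)" for j
    by (simp add: complex_eq_iff)
  then have "qc T = diagm (\<lambda>j. \<i> * Im (qc T $ j $ j))"
    using 1 by (simp add: vec_eq_iff diagm_nth)
  then show ?thesis by (rule that)
qed

text \<open>One ordering works for the whole group: let \<open>\<mu>\<close> be the eigenvalues of
  the regular element that defines \<open>P\<close>. A root vector of a positive root maps each
  weight vector to weight vectors with a larger value. The inverse is included because quotients of
  elements of \<open>B\<close> are needed.\<close>

lemma Bgrp_tri_pos:
  assumes "positive_roots P"
  obtains \<mu> where "\<And>b. b \<in> Bgrp P \<Longrightarrow> \<exists>b'. b ** b' = mat 1 \<and> qc b \<in> tri_pos \<mu> \<and> qc b' \<in> tri_pos \<mu>"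
proof -
  obtain H where H: "H \<in> itor" and P: "P = {\<alpha>. is_root \<alpha> \<and> 0 < \<alpha> H}"
    using assms by (auto simp: positive_roots_def)
  obtain T where T: "T \<in> tor" "H = \<i> *\<^sub>C T" using H by (auto simp: itor_def)
  obtain \<theta> where \<theta>: "qc T = diagm (\<lambda>j. \<i> * complex_of_real (\<theta> j))"
    using tor_diag[OF T(1)] by blast
  \<comment> \<open>The eigenvalues of H = i T, given that those of \<open>T\<close> are i
    \<theta>.\<close>
  define \<mu> where "\<mu> j = - \<theta> j" for j
  have qcH: "qc H = diagm (\<lambda>j. complex_of_real (\<mu> j))"
    by (simp add: T qc_cscale \<theta> vec_eq_iff diagm_nth \<mu>_def)
  have root: "X \<in> {X. qc X \<in> strict_upper \<mu>}" if X: "X \<in> root_space \<alpha>" and "\<alpha> \<in> P" for X \<alpha>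
  proof -
    have \<alpha>: "\<alpha> H > 0" using that P by auto
    have "bracket H X = \<alpha> H *\<^sub>R X" using X H by (simp add: root_space_def)
    then have "qc (bracket H X) = qc (\<alpha> H *\<^sub>R X)" by simp
    then have "qc H ** qc X - qc X ** qc H = \<alpha> H *\<^sub>R qc X"
      by (simp add: bracket_def qc_diff qc_mult qc_scaleR)
    then have "(\<mu> i - \<mu> j) * qc X $ i $ j = \<alpha> H * qc X $ i $ j" for i j
      by (simp add: qcH vec_eq_iff diagm_mult_left_nth diagm_mult_right_nth algebra_simps
          scaleR_conv_of_real[where 'a = complex])
    then have "\<mu> i - \<mu> j = \<alpha> H" if "qc X $ i $ j \<noteq> 0" for i j
      using that by (metis mult_cancel_right of_real_eq_iff of_real_diff)
    then show ?thesis using \<alpha> unfolding strict_upper_def by force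
  qed
  have "subspace {X. qc X \<in> strict_upper \<mu>}"
    using strict_upper_subspace[of \<mu>] qc_scaleR[of 0 0]
    by (intro subspaceI) (simp_all add: qc_add qc_scaleR subspace_add subspace_scale subspace_0)
  then have "nilp P \<subseteq> {X. qc X \<in> strict_upper \<mu>}"
    unfolding nilp_def using root by (intro span_minimal) blast+
  then have exp_tri: "qc (mexp X) \<in> tri_pos \<mu>" if "X \<in> nilp P" for X
    using that mexp_strict_upper by (auto simp: qc_mexp)
  have nilp_minus: "- X \<in> nilp P" if "X \<in> nilp P" for X
    using that unfolding nilp_def by (rule span_neg)
  have unip: "\<exists>b'. b ** b' = mat 1 \<and> qc b \<in> tri_pos \<mu> \<and> qc b' \<in> tri_pos \<mu>" if "b \<in> unip P" for b
    using that
  proof induction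
    case unip_one
    have "mat 1 \<in> tri_pos \<mu>" by (auto simp: tri_pos_def mat_def)
    then show ?case by (intro exI[of _ "mat 1"]) (simp add: qc_one)
  next
    case (unip_exp X g)
    then obtain g' where g': "g ** g' = mat 1" "qc g \<in> tri_pos \<mu>" "qc g' \<in> tri_pos \<mu>" by blast
    have "mexp X ** g ** (g' ** mexp (- X)) = mexp X ** (g ** g') ** mexp (- X)"
      by (simp add: matrix_mul_assoc)
    then have "mexp X ** g ** (g' ** mexp (- X)) = mat 1" by (simp add: g' mexp_minus)
    then show ?case
      using g' exp_tri unip_exp(1) nilp_minus by (metis qc_mult tri_pos_mult)
  qed
  have itor_tri: "qc (mexp K) \<in> tri_pos \<mu>" if K: "K \<in> itor" for K
  proof -
    obtain S where S: "S \<in> tor" "K = \<i> *\<^sub>C S" using K by (auto simp: itor_def)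
    obtain \<eta> where "qc S = diagm (\<lambda>j. \<i> * complex_of_real (\<eta> j))" using tor_diag[OF S(1)] by blast
    then have "qc K = diagm (\<lambda>j. complex_of_real (- \<eta> j))"
      by (simp add: S qc_cscale vec_eq_iff diagm_nth)
    then show ?thesis using diagm_tri_pos[of "\<lambda>j. - \<eta> j"] by (simp add: qc_mexp mexp_diagm)
  qed
  have itor_minus: "- K \<in> itor" if K: "K \<in> itor" for K
  proof -
    obtain S where S: "S \<in> tor" "K = \<i> *\<^sub>C S" using K by (auto simp: itor_def)
    have "- S \<in> tor" using S(1) eigsp_scaleR[of S 0 "-1"]
      by (simp add: tor_def g2_iff mconj_minus cder_minus)
    then show ?thesis unfolding S(2) itor_def by (auto simp: cs.minus_right intro!: image_eqI[of _ _ "- S"])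
  qed
  show ?thesis
  proof
    fix b assume "b \<in> Bgrp P"
    then obtain K n where b: "b = mexp K ** n" "K \<in> itor" "n \<in> unip P" by (auto simp: Bgrp_def)
    obtain n' where n': "n ** n' = mat 1" "qc n \<in> tri_pos \<mu>" "qc n' \<in> tri_pos \<mu>"
      using unip[OF b(3)] by blast
    have "b ** (n' ** mexp (- K)) = mexp K ** (n ** n') ** mexp (- K)"
      by (simp add: b matrix_mul_assoc)
    then have "b ** (n' ** mexp (- K)) = mat 1" by (simp add: n' mexp_minus)
    then show "\<exists>b'. b ** b' = mat 1 \<and> qc b \<in> tri_pos \<mu> \<and> qc b' \<in> tri_pos \<mu>"
      using n' b itor_tri itor_minus by (metis qc_mult tri_pos_mult)
  qed
qed

text \<open>Both \<open>g\<close> and its inverse, which is its adjoint, are quotients of elements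
  of \<open>B\<close>; in the weight basis both are therefore triangular for the same
  ordering.\<close>

lemma Bgrp_unitary_quotient:
  assumes P: "positive_roots P" and b: "b1 \<in> Bgrp P" "b2 \<in> Bgrp P"
    and g: "g ** b1 = b2" "adj g ** g = mat 1"
  shows "g = mat 1"
proof -
  obtain \<mu> where \<mu>: "\<And>b. b \<in> Bgrp P \<Longrightarrow> \<exists>b'. b ** b' = mat 1 \<and> qc b \<in> tri_pos \<mu> \<and> qc b' \<in> tri_pos \<mu>"
    using Bgrp_tri_pos[OF P] by blast
  obtain b1' where 1: "b1 ** b1' = mat 1" "qc b1 \<in> tri_pos \<mu>" "qc b1' \<in> tri_pos \<mu>" using \<mu> b by blast
  obtain b2' where 2: "b2 ** b2' = mat 1" "qc b2 \<in> tri_pos \<mu>" "qc b2' \<in> tri_pos \<mu>" using \<mu> b by blast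
  have "g = g ** b1 ** b1'" using 1 by (simp flip: matrix_mul_assoc)
  then have g1: "g = b2 ** b1'" using g by simp
  have "g ** (b1 ** b2') = mat 1" using g 2 by (simp add: matrix_mul_assoc)
  then have "adj g ** g ** (b1 ** b2') = adj g" by (simp flip: matrix_mul_assoc)
  then have g2: "adj g = b1 ** b2'" using g by simp
  have "qc g = mat 1"
  proof (rule unitary_tri_pos)
    show "qc g \<in> tri_pos \<mu>" using 1 2 by (simp add: g1 qc_mult tri_pos_mult)
    show "adj (qc g) \<in> tri_pos \<mu>" using 1 2 by (simp add: g2 qc_mult tri_pos_mult flip: qc_adj)
    show "adj (qc g) ** qc g = mat 1" using g by (simp add: qc_one flip: qc_adj qc_mult)
  qed
  then show ?thesis by (metis qc_inject qc_one)
qed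

lemma tor_subspace: "subspace tor"
  by (rule subspaceI)
    (auto simp: tor_def eigsp_zero eigsp_add eigsp_scaleR g2_iff mconj_add mconj_scaleR cder_add
      cder_scaleR cder_zero vec_eq_iff)

text \<open>The torus is simultaneously diagonal, hence commutative, so the exponential of i times a
  primitive of \<open>c\<close> solves the equation although the coefficient depends on time. The
  unipotent component of the solution is the identity, so any \<open>P\<close> is
  admissible.\<close>

lemma linear_ode_tor_Bgrp:
  assumes Y: "\<And>t. (Y has_vector_derivative (\<i> *\<^sub>C c t) ** Y t) (at t)" and Y0: "Y 0 = mat 1"
    and c: "\<And>t. c t \<in> tor" and cont: "continuous_on UNIV c"
  shows "Y t \<in> Bgrp P"
proof -
  obtain C where C: "C 0 = 0" "\<And>t. (C has_vector_derivative c t) (at t)"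
    using ex_antiderivative[OF cont] by blast
  have Ct: "C t \<in> tor" for t
    by (rule antiderivative_mem_subspace[OF tor_subspace _ C(2) c]) (simp add: C subspace_0 tor_subspace)
  have "\<forall>t. \<exists>\<theta>. qc (C t) = diagm (\<lambda>j. \<i> * complex_of_real (\<theta> j))"
    using tor_diag[OF Ct] by blast
  from choice[OF this] obtain \<theta> where \<theta>: "\<And>t. qc (C t) = diagm (\<lambda>j. \<i> * complex_of_real (\<theta> t j))" by blast
  have "\<forall>t. \<exists>\<eta>. qc (c t) = diagm (\<lambda>j. \<i> * complex_of_real (\<eta> j))"
    using tor_diag[OF c] by blast
  from choice[OF this] obtain \<eta> where \<eta>: "\<And>t. qc (c t) = diagm (\<lambda>j. \<i> * complex_of_real (\<eta> t j))" by blast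
  have qc_bl: "bounded_linear qc"
    unfolding linear_conv_bounded_linear[symmetric] by (intro linearI) (simp_all add: qc_add qc_scaleR)
  have "((\<lambda>t. qc (C t)) has_vector_derivative qc (c t)) (at t)" for t
    by (rule bounded_linear.has_vector_derivative[OF qc_bl C(2)])
  then have "((\<lambda>t. qc (C t) $ j $ j) has_vector_derivative qc (c t) $ j $ j) (at t)" for t j
    by (simp add: has_vector_derivative_vec_nth)
  then have d: "((\<lambda>t. \<i> * complex_of_real (\<theta> t j)) has_vector_derivative \<i> * complex_of_real (\<eta> t j)) (at t)" for t j
    by (simp only: \<theta> \<eta> diagm_nth refl if_True)
  have D: "((\<lambda>t. - complex_of_real (\<theta> t j)) has_vector_derivative - complex_of_real (\<eta> t j)) (at t)" for t j
    using bounded_linear.has_vector_derivative[OF bounded_linear_mult_right[of \<i>] d]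
    by (simp only: complex_i_mult_minus)
  define E where "E t = diagm (\<lambda>j. exp (- complex_of_real (\<theta> t j)))" for t
  have E: "(E has_vector_derivative diagm (\<lambda>j. - complex_of_real (\<eta> t j)) ** E t) (at t)" for t
  proof -
    have "((\<lambda>t. exp (- complex_of_real (\<theta> t j))) has_vector_derivative
        - complex_of_real (\<eta> t j) * exp (- complex_of_real (\<theta> t j))) (at t)" for j
      using field_vector_diff_chain_at[OF D DERIV_exp] by (simp add: o_def)
    then show ?thesis
      unfolding E_def has_vector_derivative_vec_nth diagm_mult by (auto simp: diagm_nth)
  qed
  define Z where "Z t = mexp (\<i> *\<^sub>C C t)" for t
  have qcZ: "qc (Z t) = E t" for t
    by (simp add: Z_def qc_mexp qc_cscale \<theta> E_def flip: mexp_diagm)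
      (rule arg_cong[of _ _ mexp], simp add: vec_eq_iff diagm_nth)
  have ic: "qc (\<i> *\<^sub>C c t) = diagm (\<lambda>j. - complex_of_real (\<eta> t j))" for t
    by (simp add: qc_cscale \<eta> vec_eq_iff diagm_nth)
  have "(Z has_vector_derivative (\<i> *\<^sub>C c t) ** Z t) (at t)" for t
  proof -
    have "((\<lambda>t. Qm ** E t ** adj Qm) has_vector_derivative Qm ** (qc (\<i> *\<^sub>C c t) ** E t) ** adj Qm) (at t)"
      unfolding ic by (intro bounded_linear.has_vector_derivative[OF mm.bounded_linear_left]
          bounded_linear.has_vector_derivative[OF mm.bounded_linear_right] E)
    then show ?thesis by (simp add: qc_inverse flip: qcZ qc_mult)
  qed
  moreover have "continuous_on UNIV (\<lambda>t. \<i> *\<^sub>C c t)"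
    by (rule cs.continuous_on[OF continuous_on_const cont])
  moreover have "Y 0 = Z 0" by (simp add: Y0 Z_def C cs.zero_right)
  ultimately have "Y t = Z t"
    using linear_ode_unique[where C = "\<lambda>t. \<i> *\<^sub>C c t" and Y = Y and Z = Z] Y by blast
  moreover have "Z t \<in> Bgrp P"
    unfolding Bgrp_def Z_def itor_def using Ct unip_one[of P]
    by (intro CollectI exI[of _ "\<i> *\<^sub>C C t"] exI[of _ "mat 1"]) auto
  ultimately show ?thesis by simp
qed

section \<open>The Lax equation\<close>

text \<open>The splitting B x x - B y y = B x (x - y) + B (x - y) y gives a Lipschitz estimate on
  bounded sets, and both solutions are bounded on the compact interval around 0.\<close>

lemma quadratic_ode_unique:
  fixes B :: "'a::real_inner \<Rightarrow> 'a \<Rightarrow> 'a"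
  assumes "bounded_bilinear B"
    and x: "\<And>t. (x has_vector_derivative B (x t) (x t)) (at t)"
    and y: "\<And>t. (y has_vector_derivative B (y t) (y t)) (at t)" and "x 0 = y 0"
  shows "x t = y t"
proof -
  interpret B: bounded_bilinear B by fact
  obtain K where K: "\<And>a b. norm (B a b) \<le> norm a * norm b * K" and "K > 0"
    using B.pos_bounded by blast
  have "continuous_on {-\<bar>t\<bar>..\<bar>t\<bar>} x" "continuous_on {-\<bar>t\<bar>..\<bar>t\<bar>} y"
    by (intro continuous_at_imp_continuous_on ballI has_vector_derivative_continuous, rule x y)+
  then have "bounded (x ` {-\<bar>t\<bar>..\<bar>t\<bar>})" "bounded (y ` {-\<bar>t\<bar>..\<bar>t\<bar>})"
    by (auto intro!: compact_imp_bounded compact_continuous_image)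
  then obtain M N where MN: "\<And>s. s \<in> {-\<bar>t\<bar>..\<bar>t\<bar>} \<Longrightarrow> norm (x s) \<le> M" "\<And>s. s \<in> {-\<bar>t\<bar>..\<bar>t\<bar>} \<Longrightarrow> norm (y s) \<le> N"
    unfolding bounded_iff by blast
  have "(\<lambda>t. x t - y t) t = 0"
  proof (rule gronwall_zero)
    show "((\<lambda>t. x t - y t) has_vector_derivative B (x s) (x s) - B (y s) (y s)) (at s)" for s
      by (intro has_vector_derivative_diff x y)
    show "norm (B (x s) (x s) - B (y s) (y s)) \<le> (M + N) * K * norm (x s - y s)" if "\<bar>s\<bar> \<le> \<bar>t\<bar>" for s
    proof -
      have s: "s \<in> {-\<bar>t\<bar>..\<bar>t\<bar>}" using that by (simp add: abs_le_iff minus_le_iff)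
      have "B (x s) (x s) - B (y s) (y s) = B (x s) (x s - y s) + B (x s - y s) (y s)"
        by (simp add: B.diff_left B.diff_right)
      then have "norm (B (x s) (x s) - B (y s) (y s)) \<le>
          norm (x s) * norm (x s - y s) * K + norm (x s - y s) * norm (y s) * K"
        by (simp add: norm_triangle_le add_mono K)
      also have "\<dots> \<le> M * norm (x s - y s) * K + norm (x s - y s) * N * K"
        using MN s \<open>K > 0\<close> by (intro add_mono mult_right_mono mult_left_mono) auto
      finally show ?thesis by (simp add: algebra_simps)
    qed
  qed (use assms in auto)
  then show ?thesis by simp
qed

text \<open>Identifies the radial retraction with the nearest-point projection onto a convex set,
  which supplies continuity and the Lipschitz constant 1.\<close>

lemma closest_point_cball:
  fixes x :: "'a::euclidean_space"
  assumes "R \<ge> 0"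
  shows "closest_point (cball 0 R) x = (if norm x \<le> R then x else (R / norm x) *\<^sub>R x)"
proof (cases "norm x \<le> R")
  case True
  then show ?thesis by (simp add: closest_point_self)
next
  case False
  then have "norm x > 0" using assms by linarith
  have "(R / norm x) *\<^sub>R x = closest_point (cball 0 R) x"
  proof (rule closest_point_unique)
    show "(R / norm x) *\<^sub>R x \<in> cball 0 R" using assms \<open>norm x > 0\<close> by simp
    show "\<forall>z\<in>cball 0 R. dist x ((R / norm x) *\<^sub>R x) \<le> dist x z"
    proof
      fix z :: 'a assume "z \<in> cball 0 R"
      have "x - (R / norm x) *\<^sub>R x = (1 - R / norm x) *\<^sub>R x" by (simp add: algebra_simps)
      then have "dist x ((R / norm x) *\<^sub>R x) = \<bar>1 - R / norm x\<bar> * norm x" by (simp add: dist_norm)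
      also have "\<dots> = \<bar>(1 - R / norm x) * norm x\<bar>" by (simp add: abs_mult)
      also have "\<dots> = norm x - R" using False \<open>norm x > 0\<close> by (simp add: algebra_simps)
      also have "\<dots> \<le> dist x z" using \<open>z \<in> cball 0 R\<close> norm_triangle_ineq2[of x z] by (simp add: dist_norm)
      finally show "dist x ((R / norm x) *\<^sub>R x) \<le> dist x z" .
    qed
  qed auto
  then show ?thesis using False by simp
qed

text \<open>
  The vector field is tangent to the spheres around the origin, also after composition with the
  radial retraction onto a ball, which makes it globally Lipschitz. So the solutions of the
  modified equation stay on their sphere and solve the original one.
\<close>

lemma quadratic_ode_solution:
  fixes B :: "'a::euclidean_space \<Rightarrow> 'a \<Rightarrow> 'a"
  assumes "bounded_bilinear B" and S: "subspace S" and x0: "x0 \<in> S"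
    and inv: "\<And>x. x \<in> S \<Longrightarrow> B x x \<in> S" and tangent: "\<And>x. x \<in> S \<Longrightarrow> x \<bullet> B x x = 0"
  obtains x where "x 0 = x0" "\<And>t. x t \<in> S" "\<And>t. norm (x t) = norm x0"
    "\<And>t. (x has_vector_derivative B (x t) (x t)) (at t)"
proof -
  interpret B: bounded_bilinear B by fact
  obtain K where K: "\<And>a b. norm (B a b) \<le> norm a * norm b * K" and "K > 0"
    using B.pos_bounded by blast
  define R where "R = norm x0"
  have "R \<ge> 0" by (simp add: R_def)
  define r :: "'a \<Rightarrow> 'a" where "r = closest_point (cball 0 R)"
  have r: "\<exists>c. r x = c *\<^sub>R x" for x
    unfolding r_def closest_point_cball[OF \<open>R \<ge> 0\<close>] by (metis scaleR_one)
  have r_id: "r x = x" if "norm x \<le> R" for x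
    unfolding r_def closest_point_cball[OF \<open>R \<ge> 0\<close>] using that by simp
  have r_norm: "norm (r x) \<le> R" for x
    unfolding r_def using closest_point_in_set[of "cball 0 R" x] \<open>R \<ge> 0\<close> by simp
  have r_lip: "norm (r x - r y) \<le> norm (x - y)" for x y
    unfolding r_def using closest_point_lipschitz[of "cball 0 R" x y] \<open>R \<ge> 0\<close> by (simp add: dist_norm)
  have r_cont: "continuous_on UNIV r"
    unfolding r_def using \<open>R \<ge> 0\<close> by (intro continuous_on_closest_point) auto
  have rS: "r x \<in> S" if "x \<in> S" for x
    using r[of x] that S by (auto intro: subspace_scale)
  obtain x where x: "x 0 = x0" "\<And>t. x t \<in> S" "\<And>t. (x has_vector_derivative B (r (x t)) (r (x t))) (at t)"
  proof (rule global_ode_solution[where F = "\<lambda>t x. B (r x) (r x)" and L = "2 * R * K", OF S x0])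
    fix x :: "real \<Rightarrow> 'a" assume "continuous_on UNIV x"
    then have "continuous_on UNIV (\<lambda>t. r (x t))"
      using continuous_on_compose[of UNIV x r] continuous_on_subset[OF r_cont] by (simp add: o_def)
    then show "continuous_on UNIV (\<lambda>t. B (r (x t)) (r (x t)))" by (intro B.continuous_on)
  next
    fix t x y
    have "B (r x) (r x) - B (r y) (r y) = B (r x) (r x - r y) + B (r x - r y) (r y)"
      by (simp add: B.diff_left B.diff_right)
    then have "norm (B (r x) (r x) - B (r y) (r y)) \<le>
        norm (r x) * norm (r x - r y) * K + norm (r x - r y) * norm (r y) * K"
      by (simp add: norm_triangle_le add_mono K)
    also have "\<dots> \<le> R * norm (x - y) * K + norm (x - y) * R * K"
      using r_norm r_lip \<open>K > 0\<close> \<open>R \<ge> 0\<close> by (intro add_mono mult_right_mono mult_mono) auto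
    finally show "norm (B (r x) (r x) - B (r y) (r y)) \<le> 2 * R * K * norm (x - y)"
      by (simp add: algebra_simps)
  next
    show "B (r x) (r x) \<in> S" if "x \<in> S" for x using inv rS that by blast
  qed blast
  have orth: "x t \<bullet> B (r (x t)) (r (x t)) = 0" for t
  proof -
    obtain c where "r (x t) = c *\<^sub>R x t" using r by blast
    then show ?thesis using tangent[OF x(2)[of t]] by (simp add: B.scaleR_left B.scaleR_right)
  qed
  have "((\<lambda>t. x t \<bullet> x t) has_vector_derivative 0) (at t)" for t
    using bounded_bilinear.has_vector_derivative[OF bounded_bilinear_inner x(3)[of t] x(3)[of t]] orth[of t]
    by (simp add: inner_commute)
  from const_if_deriv_zero[OF this] have "x t \<bullet> x t = x0 \<bullet> x0" for t using x(1) by simp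
  then have norm: "norm (x t) = R" for t by (simp add: norm_eq_sqrt_inner R_def)
  then have "(x has_vector_derivative B (x t) (x t)) (at t)" for t using x(3)[of t] by (simp add: r_id)
  then show ?thesis using that x norm R_def by blast
qed

section \<open>Brackets, the trace form and the split Lax equation\<close>

lemma bracket_bounded_bilinear: "bounded_bilinear (bracket :: complex^'n^'n \<Rightarrow> _)"
  unfolding bilinear_conv_bounded_bilinear[symmetric] bilinear_def bracket_def
  by (auto intro!: linearI simp: mm.add_left mm.add_right mm.scaleR_left mm.scaleR_right algebra_simps)

interpretation br: bounded_bilinear "bracket :: complex^'n^'n \<Rightarrow> _"
  by (rule bracket_bounded_bilinear)

lemma bracket_cscale: "bracket (c *\<^sub>C A) B = c *\<^sub>C bracket A B" "bracket A (c *\<^sub>C B) = c *\<^sub>C bracket A B"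
  by (simp_all add: bracket_def cscale_mult_left cscale_mult_right cs.diff_right)

lemma bracket_self: "bracket A A = 0"
  by (simp add: bracket_def)

lemma bracket_swap: "bracket A B = - bracket B A"
  by (simp add: bracket_def)

lemma mconj_bracket: "mconj (bracket A B) = bracket (mconj A) (mconj B)"
  by (simp add: bracket_def mconj_diff mconj_mult)

text \<open>The Euclidean inner product is the real part of the Hermitian trace form, so cyclic
  invariance of the trace yields conservation laws.\<close>

lemma inner_trace: "A \<bullet> B = Re (trace (adj A ** B))" for A B :: "complex^'n^'n"
proof -
  have "trace (adj A ** B) = (\<Sum>j\<in>UNIV. \<Sum>i\<in>UNIV. cnj (A $ i $ j) * B $ i $ j)"
    by (simp add: trace_def matrix_matrix_mult_def)
  also have "\<dots> = (\<Sum>i\<in>UNIV. \<Sum>j\<in>UNIV. cnj (A $ i $ j) * B $ i $ j)" by (rule sum.swap)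
  finally show ?thesis by (simp add: inner_vec_def inner_complex_def)
qed

lemma trace_cscale: "trace (c *\<^sub>C A) = c * trace A"
  by (simp add: trace_def sum_distrib_left)

lemma cder_adj: "cder A \<Longrightarrow> adj A = - mconj A"
  by (simp add: cder_def adj_def mconj_minus)

text \<open>With adj a = - a and adj b = - mconj b, both inner products reduce by cyclicity to the
  same difference of traces of \<open>a\<close>, \<open>b\<close>, \<open>mconj b\<close>, with
  opposite signs. This needs coefficients of equal modulus in the two equations.\<close>

lemma lax_pair_conserved:
  assumes "cder a" "mconj a = a" "cder b"
  shows "a \<bullet> ((- 2 * \<i>) *\<^sub>C bracket b (mconj b)) + b \<bullet> ((2 * \<i>) *\<^sub>C bracket a b) = 0"
proof -
  let ?c = "mconj b"
  have "trace (?c ** (a ** b)) = trace (a ** (b ** ?c))" "trace (?c ** (b ** a)) = trace (a ** (?c ** b))"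
    by (metis matrix_mul_assoc trace_mul_sym)+
  moreover have "a \<bullet> ((- 2 * \<i>) *\<^sub>C bracket b ?c) = Re (2 * \<i> * (trace (a ** (b ** ?c)) - trace (a ** (?c ** b))))"
    using assms by (simp add: inner_trace cder_adj cscale_mult_right mm.minus_left trace_cscale
        bracket_def mm.diff_right trace_sub flip: cs.minus_right)
  moreover have "b \<bullet> ((2 * \<i>) *\<^sub>C bracket a b) = - Re (2 * \<i> * (trace (?c ** (a ** b)) - trace (?c ** (b ** a))))"
    using assms by (simp add: inner_trace cder_adj cscale_mult_right mm.minus_left trace_cscale
        bracket_def mm.diff_right trace_sub flip: cs.minus_right)
  ultimately show ?thesis by simp
qed


text \<open>The uniform bound is part of the conclusion because it later bounds the coefficients of
  the linear equations for the loop factors.\<close>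

lemma lax_pair_solution:
  assumes "h0 \<in> tor" and "h1 \<in> eigsp (-1)"
  obtains u0 u1 where "u0 0 = h0" "u1 0 = h1" "\<And>t. u0 t \<in> tor" "\<And>t. u1 t \<in> eigsp (-1)"
    "\<And>t. (u0 has_vector_derivative (- \<i>) *\<^sub>C bracket (u1 t) (mconj (u1 t))) (at t)"
    "\<And>t. (u1 has_vector_derivative (2 * \<i>) *\<^sub>C bracket (u0 t) (u1 t)) (at t)"
    "\<exists>M. \<forall>t. norm (u0 t) \<le> M \<and> norm (u1 t) \<le> M"
proof -
  define B :: "cmat7 \<times> cmat7 \<Rightarrow> cmat7 \<times> cmat7 \<Rightarrow> cmat7 \<times> cmat7" where
    "B x y = ((- 2 * \<i>) *\<^sub>C bracket (snd x) (mconj (snd y)), (2 * \<i>) *\<^sub>C bracket (fst x) (snd y))" for x y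
  define S where "S = tor \<times> eigsp (-1)"
  \<comment> \<open>Dividing \<open>u1\<close> by sqrt 2 turns the coefficient - i of the first
    equation into - 2 i and leaves the second unchanged, so that \<open>lax_pair_conserved\<close>
    makes the Euclidean norm of the pair constant.\<close>
  define x0 where "x0 = (h0, (1 / sqrt 2) *\<^sub>R h1)"
  have B: "bounded_bilinear B"
    unfolding bilinear_conv_bounded_bilinear[symmetric] bilinear_def B_def
    by (auto intro!: linearI simp: br.add_left br.add_right br.scaleR_left br.scaleR_right
        mconj_add mconj_scaleR cs.add_right cs.scaleR_right)
  have S: "subspace S"
    unfolding S_def
    by (intro subspace_Times tor_subspace subspaceI) (auto simp: eigsp_zero eigsp_add eigsp_scaleR)
  have x0: "x0 \<in> S" using assms by (simp add: x0_def S_def eigsp_scaleR)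
  have inv: "B x x \<in> S" if "x \<in> S" for x
  proof -
    obtain a b where x: "x = (a, b)" by (cases x)
    have a: "a \<in> eigsp 0" "a \<in> g2" and b: "b \<in> eigsp (-1)" using that by (auto simp: x S_def tor_def)
    have "bracket b (mconj b) \<in> eigsp 0" using eigsp_bracket[OF b eigsp_mconj[OF b]] by simp
    then have 0: "(- 2 * \<i>) *\<^sub>C bracket b (mconj b) \<in> eigsp 0" by (rule eigsp_cscale)
    moreover have "mconj ((- 2 * \<i>) *\<^sub>C bracket b (mconj b)) = (- 2 * \<i>) *\<^sub>C bracket b (mconj b)"
      by (simp add: mconj_cscale mconj_bracket mconj_minus bracket_swap[of "mconj b"] cs.minus_left cs.minus_right)
    ultimately have "(- 2 * \<i>) *\<^sub>C bracket b (mconj b) \<in> tor" by (simp add: tor_def g2_iff eigsp_iff)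
    moreover have "(2 * \<i>) *\<^sub>C bracket a b \<in> eigsp (-1)"
      using eigsp_bracket[OF a(1) b] by (simp add: eigsp_cscale)
    ultimately show ?thesis by (simp add: x S_def B_def)
  qed
  have tangent: "x \<bullet> B x x = 0" if "x \<in> S" for x
    using that lax_pair_conserved[of "fst x" "snd x"]
    by (auto simp: S_def tor_def eigsp_iff g2_iff B_def inner_prod_def)
  obtain x where x: "x 0 = x0" "\<And>t. x t \<in> S" "\<And>t. norm (x t) = norm x0"
    "\<And>t. (x has_vector_derivative B (x t) (x t)) (at t)"
    using quadratic_ode_solution[OF B S x0 inv tangent] by blast
  define u0 where "u0 t = fst (x t)" for t
  define u1 where "u1 t = sqrt 2 *\<^sub>R snd (x t)" for t
  have sq: "complex_of_real (sqrt 2) * complex_of_real (sqrt 2) = 2"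
    by (metis of_real_mult of_real_numeral real_sqrt_mult_self abs_numeral)
  have d0: "(u0 has_vector_derivative (- \<i>) *\<^sub>C bracket (u1 t) (mconj (u1 t))) (at t)" for t
  proof -
    have "(u0 has_vector_derivative fst (B (x t) (x t))) (at t)"
      unfolding u0_def by (rule bounded_linear.has_vector_derivative[OF bounded_linear_fst x(4)])
    moreover have "fst (B (x t) (x t)) = (- \<i>) *\<^sub>C bracket (u1 t) (mconj (u1 t))"
      by (simp add: B_def u1_def mconj_scaleR br.scaleR_left br.scaleR_right cscale_scaleR mult.assoc sq mult.commute[of \<i>])
    ultimately show ?thesis by simp
  qed
  have d1: "(u1 has_vector_derivative (2 * \<i>) *\<^sub>C bracket (u0 t) (u1 t)) (at t)" for t
  proof -
    have "(u1 has_vector_derivative sqrt 2 *\<^sub>R snd (B (x t) (x t))) (at t)"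
      unfolding u1_def by (intro bounded_linear.has_vector_derivative[OF bounded_linear_scaleR_right]
          bounded_linear.has_vector_derivative[OF bounded_linear_snd x(4)])
    moreover have "sqrt 2 *\<^sub>R snd (B (x t) (x t)) = (2 * \<i>) *\<^sub>C bracket (u0 t) (u1 t)"
      by (simp add: B_def u1_def u0_def br.scaleR_right cs.scaleR_right)
    ultimately show ?thesis by simp
  qed
  have S': "u0 t \<in> tor" "u1 t \<in> eigsp (-1)" for t
    using x(2)[of t] by (auto simp: S_def u0_def u1_def eigsp_scaleR)
  have "norm (u0 t) \<le> sqrt 2 * norm x0 \<and> norm (u1 t) \<le> sqrt 2 * norm x0" for t
  proof -
    have "norm (u0 t) \<le> 1 * norm x0" using norm_fst_le[of "fst (x t)" "snd (x t)"] x(3)[of t] by (simp add: u0_def)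
    also have "\<dots> \<le> sqrt 2 * norm x0" by (rule mult_right_mono) auto
    finally show ?thesis using norm_snd_le[of "snd (x t)" "fst (x t)"] x(3)[of t] by (simp add: u1_def)
  qed
  then have "\<exists>M. \<forall>t. norm (u0 t) \<le> M \<and> norm (u1 t) \<le> M" by blast
  moreover have "u0 0 = h0" "u1 0 = h1" by (simp_all add: u0_def u1_def x(1) x0_def)
  ultimately show ?thesis using that[OF _ _ S' d0 d1] by blast
qed

lemma lax_pair_unique:
  fixes u0 u1 v0 v1 :: "real \<Rightarrow> cmat7"
  assumes u: "\<And>t. (u0 has_vector_derivative (- \<i>) *\<^sub>C bracket (u1 t) (mconj (u1 t))) (at t)"
    "\<And>t. (u1 has_vector_derivative (2 * \<i>) *\<^sub>C bracket (u0 t) (u1 t)) (at t)"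
    and v: "\<And>t. (v0 has_vector_derivative (- \<i>) *\<^sub>C bracket (v1 t) (mconj (v1 t))) (at t)"
    "\<And>t. (v1 has_vector_derivative (2 * \<i>) *\<^sub>C bracket (v0 t) (v1 t)) (at t)"
    and "u0 0 = v0 0" "u1 0 = v1 0"
  shows "u0 = v0 \<and> u1 = v1"
proof -
  define B :: "cmat7 \<times> cmat7 \<Rightarrow> cmat7 \<times> cmat7 \<Rightarrow> cmat7 \<times> cmat7" where
    "B x y = ((- \<i>) *\<^sub>C bracket (snd x) (mconj (snd y)), (2 * \<i>) *\<^sub>C bracket (fst x) (snd y))" for x y
  have B: "bounded_bilinear B"
    unfolding bilinear_conv_bounded_bilinear[symmetric] bilinear_def B_def
    by (auto intro!: linearI simp: br.add_left br.add_right br.scaleR_left br.scaleR_right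
        mconj_add mconj_scaleR cs.add_right cs.scaleR_right)
  have "(u0 t, u1 t) = (v0 t, v1 t)" for t
  proof (rule quadratic_ode_unique[OF B, of "\<lambda>t. (u0 t, u1 t)" "\<lambda>t. (v0 t, v1 t)"])
    show "((\<lambda>t. (u0 t, u1 t)) has_vector_derivative B (u0 t, u1 t) (u0 t, u1 t)) (at t)" for t
      unfolding B_def fst_conv snd_conv by (rule has_vector_derivative_Pair[OF u])
    show "((\<lambda>t. (v0 t, v1 t)) has_vector_derivative B (v0 t, v1 t) (v0 t, v1 t)) (at t)" for t
      unfolding B_def fst_conv snd_conv by (rule has_vector_derivative_Pair[OF v])
  qed (use assms in auto)
  then show ?thesis by auto
qed

text \<open>The right-hand side sorted by the eigenspaces for 0, -1 and 1. Brackets of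
  \<open>b\<close> or \<open>mconj b\<close> with itself, which would belong to -2 and 2,
  vanish.\<close>

lemma lax_bracket:
  fixes a b :: cmat7
  shows
  "bracket (2 *\<^sub>R a + b + mconj b) (\<i> *\<^sub>C (b - mconj b)) =
    2 *\<^sub>R ((- \<i>) *\<^sub>C bracket b (mconj b)) + (2 * \<i>) *\<^sub>C bracket a b + (- 2 * \<i>) *\<^sub>C bracket a (mconj b)"
proof -
  have two: "2 *\<^sub>R X = 2 *\<^sub>C X" for X :: cmat7 using cscale_of_real[of 2 X] by simp
  show ?thesis
    unfolding two by (simp add: br.add_left br.diff_right bracket_cscale bracket_self bracket_swap[of "mconj b" b]
        cs.add_right cs.diff_right cs.minus_right cs.minus_left vec_eq_iff algebra_simps)
qed

text \<open>Lagrange interpolation in \<open>sigma\<close>: with \<omega> = cis (pi / 3) and \<nu> =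
  cis (- pi / 3) this is (\<omega> - sigma) (sigma - 1) divided by its value at \<nu>. On the sum of
  the eigenspaces for 0, -1 and 1 it is the projection to the one for -1.\<close>

definition proj1 :: "cmat7 \<Rightarrow> cmat7" where
  "proj1 X = (1 / ((cis (- pi / 3) - 1) * (cis (pi / 3) - cis (- pi / 3)))) *\<^sub>C
    (cis (pi / 3) *\<^sub>C (sigma X - X) - (sigma (sigma X) - sigma X))"

lemma proj1_bounded_linear: "bounded_linear proj1"
  unfolding linear_conv_bounded_linear[symmetric] proj1_def
  by (intro linearI)
    (simp_all add: sigma_add sigma_scaleR sigma_diff cs.add_right cs.diff_right cs.scaleR_right algebra_simps)

lemma proj1_eq:
  assumes "a \<in> eigsp 0" "b \<in> eigsp (-1)" "c \<in> eigsp 1"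
  shows "proj1 (a + b + c) = b"
proof -
  define \<omega> where "\<omega> = cis (pi / 3)"
  define \<nu> where "\<nu> = cis (- pi / 3)"
  have a: "sigma a = a" and b: "sigma b = \<nu> *\<^sub>C b" and c: "sigma c = \<omega> *\<^sub>C c"
    using assms by (auto simp: eigsp_iff \<omega>_def \<nu>_def)
  have nz: "(\<nu> - 1) * (\<omega> - \<nu>) \<noteq> 0"
    by (simp add: \<nu>_def \<omega>_def complex_eq_iff cos_60 sin_60)
  have "\<omega> *\<^sub>C (sigma (a + b + c) - (a + b + c)) - (sigma (sigma (a + b + c)) - sigma (a + b + c)) =
      ((\<nu> - 1) * (\<omega> - \<nu>)) *\<^sub>C b"
    by (simp add: sigma_add sigma_cscale a b c vec_eq_iff algebra_simps)
  then show ?thesis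
    using nz unfolding proj1_def \<omega>_def[symmetric] \<nu>_def[symmetric] by simp
qed

text \<open>The derivative is assumed only for the sum. Applying the bounded linear map
  \<open>proj1\<close> to it isolates \<open>u1\<close>, conjugation gives the third summand, and
  \<open>u0\<close> is what remains.\<close>

lemma lax_solution_iff:
  "lax_solution u0 u1 \<longleftrightarrow> (\<forall>t. u0 t \<in> tor \<and> u1 t \<in> eigsp (-1) \<and>
    (u0 has_vector_derivative (- \<i>) *\<^sub>C bracket (u1 t) (mconj (u1 t))) (at t) \<and>
    (u1 has_vector_derivative (2 * \<i>) *\<^sub>C bracket (u0 t) (u1 t)) (at t))"
    (is "_ \<longleftrightarrow> (\<forall>t. ?R t)")
proof
  assume L: "lax_solution u0 u1"
  show "\<forall>t. ?R t"
  proof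
    fix t
    have u: "u0 t \<in> eigsp 0" "mconj (u0 t) = u0 t" "u1 t \<in> eigsp (-1)" "u0 t \<in> tor" for t
      using L by (auto simp: lax_solution_def tor_def g2_iff)
    have u': "mconj (u1 t) \<in> eigsp 1" for t using eigsp_mconj[OF u(3)] by simp
    let ?X = "\<lambda>t. 2 *\<^sub>R u0 t + u1 t + mconj (u1 t)"
    define b where "b = u1 t"
    define D where "D = 2 *\<^sub>R ((- \<i>) *\<^sub>C bracket b (mconj b)) + (2 * \<i>) *\<^sub>C bracket (u0 t) b +
        (- 2 * \<i>) *\<^sub>C bracket (u0 t) (mconj b)"
    have X: "(?X has_vector_derivative D) (at t)"
      using L unfolding lax_solution_def lax_bracket D_def b_def by blast
    have pX: "proj1 (?X t) = u1 t" for t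
      using u u' by (intro proj1_eq eigsp_scaleR)
    have pD: "proj1 D = (2 * \<i>) *\<^sub>C bracket (u0 t) b"
    proof -
      have "bracket b (mconj b) \<in> eigsp 0" "bracket (u0 t) b \<in> eigsp (-1)" "bracket (u0 t) (mconj b) \<in> eigsp 1"
        using eigsp_bracket[OF u(3) u'] eigsp_bracket[OF u(1) u(3)] eigsp_bracket[OF u(1) u'] by (simp_all add: b_def)
      then show ?thesis unfolding D_def by (intro proj1_eq eigsp_scaleR eigsp_cscale)
    qed
    have d1: "(u1 has_vector_derivative (2 * \<i>) *\<^sub>C bracket (u0 t) b) (at t)"
      using bounded_linear.has_vector_derivative[OF proj1_bounded_linear X] by (simp add: pX pD)
    have d1': "((\<lambda>t. mconj (u1 t)) has_vector_derivative (- 2 * \<i>) *\<^sub>C bracket (u0 t) (mconj b)) (at t)"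
      using bounded_linear.has_vector_derivative[OF mconj_bounded_linear d1] u(2)
      by (simp add: mconj_cscale mconj_bracket)
    have "((\<lambda>t. (1 / 2) *\<^sub>R (?X t - u1 t - mconj (u1 t))) has_vector_derivative
        (1 / 2) *\<^sub>R (D - (2 * \<i>) *\<^sub>C bracket (u0 t) b - (- 2 * \<i>) *\<^sub>C bracket (u0 t) (mconj b))) (at t)"
      by (intro bounded_linear.has_vector_derivative[OF bounded_linear_scaleR_right]
          has_vector_derivative_diff X d1 d1')
    then have "(u0 has_vector_derivative (- \<i>) *\<^sub>C bracket b (mconj b)) (at t)"
      by (simp add: D_def)
    then show "?R t" using u d1 by (simp add: b_def)
  qed
next
  assume R: "\<forall>t. ?R t"
  show "lax_solution u0 u1"
    unfolding lax_solution_def lax_bracket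
  proof (intro conjI allI)
    fix t
    show "u0 t \<in> eigsp 0 \<inter> g2" "u1 t \<in> eigsp (- 1)" using R by (auto simp: tor_def)
    have "mconj (u0 t) = u0 t" using R by (auto simp: tor_def g2_iff)
    moreover have "(u1 has_vector_derivative (2 * \<i>) *\<^sub>C bracket (u0 t) (u1 t)) (at t)" using R by blast
    from bounded_linear.has_vector_derivative[OF mconj_bounded_linear this]
    have "((\<lambda>t. mconj (u1 t)) has_vector_derivative (- 2 * \<i>) *\<^sub>C bracket (mconj (u0 t)) (mconj (u1 t))) (at t)"
      by (simp add: mconj_cscale mconj_bracket)
    ultimately have "((\<lambda>t. mconj (u1 t)) has_vector_derivative (- 2 * \<i>) *\<^sub>C bracket (u0 t) (mconj (u1 t))) (at t)"
      by simp
    then show "((\<lambda>t. 2 *\<^sub>R u0 t + u1 t + mconj (u1 t)) has_vector_derivative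
        2 *\<^sub>R ((- \<i>) *\<^sub>C bracket (u1 t) (mconj (u1 t))) + (2 * \<i>) *\<^sub>C bracket (u0 t) (u1 t) +
        (- 2 * \<i>) *\<^sub>C bracket (u0 t) (mconj (u1 t))) (at t)"
      using R by (intro has_vector_derivative_add
          bounded_linear.has_vector_derivative[OF bounded_linear_scaleR_right]) auto
  qed
qed

lemma lax_initial_value:
  assumes "a \<in> tor" "b \<in> eigsp (-1)" "a' \<in> tor" "b' \<in> eigsp (-1)"
    and "2 *\<^sub>R a + b + mconj b = 2 *\<^sub>R a' + b' + mconj b'"
  shows "a = a' \<and> b = b'"
proof -
  have "proj1 (2 *\<^sub>R c + d + mconj d) = d" if "c \<in> tor" "d \<in> eigsp (-1)" for c d
    using that eigsp_mconj[of d "-1"] by (intro proj1_eq eigsp_scaleR) (auto simp: tor_def)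
  from this[of a b] this[of a' b'] have "b = b'" using assms by simp
  then show ?thesis using assms(5) by simp
qed

lemma lax_solution_ex1:
  assumes "h0 \<in> eigsp 0 \<inter> g2" "h1 \<in> eigsp (-1)"
  shows "\<exists>!u. lax_solution (fst u) (snd u) \<and>
    2 *\<^sub>R fst u 0 + snd u 0 + mconj (snd u 0) = 2 *\<^sub>R h0 + h1 + mconj h1"
proof -
  have h: "h0 \<in> tor" "h1 \<in> eigsp (-1)" using assms by (auto simp: tor_def)
  obtain u0 u1 where u: "u0 0 = h0" "u1 0 = h1" "lax_solution u0 u1"
    using lax_pair_solution[OF h] unfolding lax_solution_iff by metis
  show ?thesis
  proof (rule ex1I[of _ "(u0, u1)"])
    fix v assume v: "lax_solution (fst v) (snd v) \<and>
      2 *\<^sub>R fst v 0 + snd v 0 + mconj (snd v 0) = 2 *\<^sub>R h0 + h1 + mconj h1"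
    then have "fst v 0 = h0 \<and> snd v 0 = h1"
      using h by (intro lax_initial_value) (auto simp: lax_solution_iff)
    then have "fst v = u0 \<and> snd v = u1"
      using v u by (intro lax_pair_unique) (auto simp: lax_solution_iff)
    then show "v = (u0, u1)" by (cases v) simp
  qed (use u in simp)
qed

section \<open>Loops\<close>

text \<open>The inhomogeneity \<open>F\<close> serves the variational equation in
  \<open>linear_ode_holomorphic\<close>; the factors themselves use F = 0.\<close>

lemma linear_ode_exists:
  fixes C F :: "real \<Rightarrow> complex^'n^'n"
  assumes C: "continuous_on UNIV C" and M: "\<And>t. norm (C t) \<le> M" and F: "continuous_on UNIV F"
  obtains Y where "Y 0 = Y0" "\<And>t. (Y has_vector_derivative C t ** Y t + F t) (at t)"
proof -
  obtain K where K: "\<And>(A::complex^'n^'n) (B::complex^'n^'n). norm (A ** B) \<le> norm A * norm B * K" and "K > 0"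
    using mm.pos_bounded by blast
  show ?thesis
  proof (rule global_ode_solution[where F = "\<lambda>t Y. C t ** Y + F t" and S = UNIV and ?x0.0 = Y0 and L = "M * K"])
    fix t and X X' :: "complex^'n^'n"
    have "norm (C t ** X + F t - (C t ** X' + F t)) = norm (C t ** (X - X'))"
      by (simp add: mm.diff_right)
    also have "\<dots> \<le> norm (C t) * norm (X - X') * K" by (rule K)
    also have "\<dots> \<le> M * norm (X - X') * K" using \<open>K > 0\<close> by (intro mult_right_mono M) auto
    finally show "norm (C t ** X + F t - (C t ** X' + F t)) \<le> M * K * norm (X - X')"
      by (simp add: mult_ac)
  next
    fix x :: "real \<Rightarrow> complex^'n^'n" assume "continuous_on UNIV x"
    then show "continuous_on UNIV (\<lambda>t. C t ** x t + F t)"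
      by (intro continuous_on_add mm.continuous_on C F)
  qed (use that in auto)
qed

section \<open>Holomorphic dependence on the loop parameter\<close>

lemma norm_cscale: "norm (c *\<^sub>C A) = norm c * norm A"
  by (simp add: norm_vec_def norm_mult flip: L2_set_right_distrib)

lemma continuous_norm_bound:
  fixes f :: "real \<Rightarrow> 'a::real_normed_vector"
  assumes "continuous_on UNIV f"
  obtains N where "N \<ge> 0" "\<And>s. \<bar>s\<bar> \<le> T \<Longrightarrow> norm (f s) \<le> N"
proof -
  have "bounded (f ` {-T..T})"
    using assms by (intro compact_imp_bounded compact_continuous_image) (auto intro: continuous_on_subset)
  then obtain N where N: "\<And>s. s \<in> {-T..T} \<Longrightarrow> norm (f s) \<le> N" unfolding bounded_iff by blast
  show ?thesis
  proof
    show "norm (f s) \<le> max 0 N" if "\<bar>s\<bar> \<le> T" for s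
    proof -
      have "s \<in> {-T..T}" using that by (simp add: abs_le_iff minus_le_iff)
      then show ?thesis using N by (simp add: le_max_iff_disj)
    qed
  qed simp
qed

text \<open>The derivative with respect to the parameter solves the variational equation.\<close>

lemma linear_ode_holomorphic:
  fixes P Q :: "real \<Rightarrow> complex^'n^'n" and Y :: "real \<Rightarrow> complex \<Rightarrow> complex^'n^'n"
  assumes P: "continuous_on UNIV P" "\<And>t. norm (P t) \<le> M"
    and Q: "continuous_on UNIV Q" "\<And>t. norm (Q t) \<le> M"
    and \<phi>: "\<phi> holomorphic_on U" and \<psi>: "\<psi> holomorphic_on U" and U: "open U"
    and Y: "\<And>t z. z \<in> U \<Longrightarrow> ((\<lambda>t. Y t z) has_vector_derivative (\<phi> z *\<^sub>C P t + \<psi> z *\<^sub>C Q t) ** Y t z) (at t)"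
    and Y0: "\<And>z. z \<in> U \<Longrightarrow> Y 0 z = Y0"
  shows "(\<lambda>z. Y t z $ i $ j) holomorphic_on U"
proof -
  have "((\<lambda>w. Y t w $ i $ j) field_differentiable at z)" if z: "z \<in> U" for z
  proof -
    obtain \<phi>' where \<phi>': "(\<phi> has_field_derivative \<phi>') (at z)"
      using holomorphic_on_imp_differentiable_at[OF \<phi> U z] by (auto simp: field_differentiable_def)
    obtain \<psi>' where \<psi>': "(\<psi> has_field_derivative \<psi>') (at z)"
      using holomorphic_on_imp_differentiable_at[OF \<psi> U z] by (auto simp: field_differentiable_def)
    define C where "C w t = \<phi> w *\<^sub>C P t + \<psi> w *\<^sub>C Q t" for w t
    have C_norm: "norm (C w t) \<le> (norm (\<phi> w) + norm (\<psi> w)) * M" for w t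
    proof -
      have "norm (C w t) \<le> norm (\<phi> w) * norm (P t) + norm (\<psi> w) * norm (Q t)"
        unfolding C_def by (metis norm_cscale norm_triangle_ineq)
      also have "\<dots> \<le> norm (\<phi> w) * M + norm (\<psi> w) * M"
        by (intro add_mono mult_left_mono P Q) auto
      finally show ?thesis by (simp add: algebra_simps)
    qed
    have C_cont: "continuous_on UNIV (C w)" for w
      unfolding C_def[abs_def] by (intro continuous_on_add cs.continuous_on continuous_on_const P Q)
    have Y_cont: "continuous_on UNIV (\<lambda>t. Y t z)"
      by (intro continuous_at_imp_continuous_on ballI has_vector_derivative_continuous, rule Y[OF z])
    \<comment> \<open>The candidate for the derivative with respect to \<open>z\<close>, from
      formally differentiating the equation and its constant initial value.\<close>
    obtain Z where Z: "Z 0 = 0"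
      "\<And>t. (Z has_vector_derivative C z t ** Z t + (\<phi>' *\<^sub>C P t + \<psi>' *\<^sub>C Q t) ** Y t z) (at t)"
    proof (rule linear_ode_exists[OF C_cont C_norm])
      show "continuous_on UNIV (\<lambda>t. (\<phi>' *\<^sub>C P t + \<psi>' *\<^sub>C Q t) ** Y t z)"
        by (intro mm.continuous_on continuous_on_add cs.continuous_on continuous_on_const P Q Y_cont)
    qed blast
    have Z_cont: "continuous_on UNIV Z"
      by (intro continuous_at_imp_continuous_on ballI has_vector_derivative_continuous, rule Z)
    obtain N1 where N1: "N1 \<ge> 0" "\<And>s. \<bar>s\<bar> \<le> \<bar>t\<bar> \<Longrightarrow> norm (P s ** Y s z) \<le> N1"
      using continuous_norm_bound[OF mm.continuous_on[OF P(1) Y_cont]] by blast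
    obtain N2 where N2: "N2 \<ge> 0" "\<And>s. \<bar>s\<bar> \<le> \<bar>t\<bar> \<Longrightarrow> norm (Q s ** Y s z) \<le> N2"
      using continuous_norm_bound[OF mm.continuous_on[OF Q(1) Y_cont]] by blast
    obtain N3 where N3: "N3 \<ge> 0" "\<And>s. \<bar>s\<bar> \<le> \<bar>t\<bar> \<Longrightarrow> norm (P s ** Z s) \<le> N3"
      using continuous_norm_bound[OF mm.continuous_on[OF P(1) Z_cont]] by blast
    obtain N4 where N4: "N4 \<ge> 0" "\<And>s. \<bar>s\<bar> \<le> \<bar>t\<bar> \<Longrightarrow> norm (Q s ** Z s) \<le> N4"
      using continuous_norm_bound[OF mm.continuous_on[OF Q(1) Z_cont]] by blast
    define a where "a w = (\<phi> w - \<phi> z) / (w - z) - \<phi>'" for w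
    define b where "b w = (\<psi> w - \<psi> z) / (w - z) - \<psi>'" for w
    define c where "c w = \<phi> w - \<phi> z" for w
    define d where "d w = \<psi> w - \<psi> z" for w
    \<comment> \<open>A bound for the forcing term \<open>E\<close> below: \<open>a\<close>,
      \<open>b\<close> are the errors of the difference quotients of the scalar coefficients,
      \<open>c\<close>, \<open>d\<close> their increments, and \<open>N1\<close> to
      \<open>N4\<close> bound the matrices they multiply. It tends to 0 at \<open>z\<close>.\<close>
    define e where "e w = norm (a w) * N1 + norm (b w) * N2 + norm (c w) * N3 + norm (d w) * N4" for w
    have \<phi>_lim: "(\<phi> \<longlongrightarrow> \<phi> z) (at z)" and \<psi>_lim: "(\<psi> \<longlongrightarrow> \<psi> z) (at z)"
      using DERIV_isCont[OF \<phi>'] DERIV_isCont[OF \<psi>'] by (simp_all add: isCont_def)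
    have "(a \<longlongrightarrow> 0) (at z)" "(b \<longlongrightarrow> 0) (at z)" "(c \<longlongrightarrow> 0) (at z)" "(d \<longlongrightarrow> 0) (at z)"
      using \<phi>' \<psi>' \<phi>_lim \<psi>_lim
      unfolding a_def[abs_def] b_def[abs_def] c_def[abs_def] d_def[abs_def] has_field_derivative_iff
      by (simp_all add: LIM_zero_iff)
    then have "(e \<longlongrightarrow> norm (0::complex) * N1 + norm (0::complex) * N2 + norm (0::complex) * N3 + norm (0::complex) * N4) (at z)"
      unfolding e_def[abs_def] by (intro tendsto_intros)
    then have e_lim: "(e \<longlongrightarrow> 0) (at z)" by simp
    have e_nonneg: "e w \<ge> 0" for w
      using N1(1) N2(1) N3(1) N4(1) by (simp add: e_def)
    obtain K where K: "\<And>(A::complex^'n^'n) (B::complex^'n^'n). norm (A ** B) \<le> norm A * norm B * K" and "K > 0"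
      using mm.pos_bounded by blast
    have "M \<ge> 0" using P(2)[of 0] norm_ge_zero order_trans by blast
    \<comment> \<open>A growth rate valid for all \<open>w\<close> near \<open>z\<close>: the
      summands 1 leave room for the variation of the norms of \<phi> and \<psi>.\<close>
    define L where "L = (norm (\<phi> z) + 1 + (norm (\<psi> z) + 1)) * M * K"
    have "L \<ge> 0" using \<open>M \<ge> 0\<close> \<open>K > 0\<close> by (simp add: L_def)
    define G where "G = sqrt (exp ((2 * L + 1) * \<bar>t\<bar>))"
    have bound: "norm ((Y t w $ i $ j - Y t z $ i $ j) / (w - z) - Z t $ i $ j) \<le> e w * G"
      if w: "w \<in> U" "w \<noteq> z" "norm (\<phi> w) \<le> norm (\<phi> z) + 1" "norm (\<psi> w) \<le> norm (\<psi> z) + 1" for w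
    proof -
      \<comment> \<open>The difference quotient minus its expected limit. It starts at 0 and solves
        D' = C w D + E, so \<open>gronwall\<close> with M = \<open>e w\<close> bounds it by
        \<open>e w\<close> times a factor independent of \<open>w\<close>.\<close>
      define D where "D s = (1 / (w - z)) *\<^sub>C (Y s w - Y s z) - Z s" for s
      define E where "E s = a w *\<^sub>C (P s ** Y s z) + b w *\<^sub>C (Q s ** Y s z) + c w *\<^sub>C (P s ** Z s) + d w *\<^sub>C (Q s ** Z s)" for s
      have wz: "w - z \<noteq> 0" using w by simp
      have D': "(D has_vector_derivative C w s ** D s + E s) (at s)" for s
      proof -
        have "(D has_vector_derivative (1 / (w - z)) *\<^sub>C (C w s ** Y s w - C z s ** Y s z) -
            (C z s ** Z s + (\<phi>' *\<^sub>C P s + \<psi>' *\<^sub>C Q s) ** Y s z)) (at s)"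
          unfolding D_def using Y[OF w(1), of s] Y[OF z, of s] Z(2)[of s]
          by (intro has_vector_derivative_diff bounded_linear.has_vector_derivative[OF cs.bounded_linear_right])
            (simp_all add: C_def)
        moreover have "(1 / (w - z)) *\<^sub>C (C w s ** Y s w - C z s ** Y s z) -
            (C z s ** Z s + (\<phi>' *\<^sub>C P s + \<psi>' *\<^sub>C Q s) ** Y s z) = C w s ** D s + E s"
        proof -
          \<comment> \<open>With 1 / (w - z) treated as an abstract factor, the identity becomes one
            of linear algebra without division.\<close>
          have aw: "a w = (1 / (w - z)) * c w - \<phi>'" "b w = (1 / (w - z)) * d w - \<psi>'"
            by (simp_all add: a_def b_def c_def d_def)
          have \<phi>w: "\<phi> w = \<phi> z + c w" "\<psi> w = \<psi> z + d w" by (simp_all add: c_def d_def)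
          define h where "h = 1 / (w - z)"
          show ?thesis
            unfolding D_def E_def C_def aw \<phi>w h_def[symmetric]
            by (simp add: mm.add_left mm.diff_right cscale_mult_left cscale_mult_right vec_eq_iff algebra_simps)
        qed
        ultimately show ?thesis by simp
      qed
      have "(norm (D t))\<^sup>2 + (e w)\<^sup>2 \<le> ((norm (D 0))\<^sup>2 + (e w)\<^sup>2) * exp ((2 * L + 1) * \<bar>t\<bar>)"
      proof (rule gronwall[where T = "\<bar>t\<bar>"])
        fix s assume s: "\<bar>s\<bar> \<le> \<bar>t\<bar>"
        show "(D has_vector_derivative C w s ** D s + E s) (at s)" by (rule D')
        have "norm (C w s) \<le> (norm (\<phi> z) + 1 + (norm (\<psi> z) + 1)) * M"
          using w \<open>M \<ge> 0\<close> by (intro order_trans[OF C_norm] mult_right_mono add_mono) auto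
        then have "norm (C w s ** D s) \<le> L * norm (D s)"
          using \<open>K > 0\<close> K[of "C w s" "D s"] unfolding L_def
          by (smt (verit, best) mult.assoc mult.commute mult_right_mono norm_ge_zero)
        moreover have "norm (E s) \<le> norm (a w *\<^sub>C (P s ** Y s z)) + norm (b w *\<^sub>C (Q s ** Y s z)) +
            norm (c w *\<^sub>C (P s ** Z s)) + norm (d w *\<^sub>C (Q s ** Z s))"
          unfolding E_def by (intro order_trans[OF norm_triangle_ineq] add_mono order_refl)
        moreover have "\<dots> \<le> e w"
          unfolding norm_cscale e_def by (intro add_mono mult_left_mono N1 N2 N3 N4 s) auto
        ultimately show "norm (C w s ** D s + E s) \<le> L * norm (D s) + e w"
          by (intro order_trans[OF norm_triangle_ineq] add_mono) linarith+
      qed (use \<open>L \<ge> 0\<close> e_nonneg in auto)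
      moreover have "D 0 = 0" using w z by (simp add: D_def Y0 Z cs.zero_right)
      ultimately have "(norm (D t))\<^sup>2 + (e w)\<^sup>2 \<le> (e w)\<^sup>2 * exp ((2 * L + 1) * \<bar>t\<bar>)" by simp
      then have "(norm (D t))\<^sup>2 \<le> (e w)\<^sup>2 * exp ((2 * L + 1) * \<bar>t\<bar>)"
        using zero_le_power2[of "e w"] by linarith
      then have "sqrt ((norm (D t))\<^sup>2) \<le> sqrt ((e w)\<^sup>2 * exp ((2 * L + 1) * \<bar>t\<bar>))"
        by (rule real_sqrt_le_mono)
      then have "norm (D t) \<le> e w * G"
        using e_nonneg by (simp add: real_sqrt_mult G_def)
      moreover have "norm (D t $ i $ j) \<le> norm (D t)"
        by (meson Finite_Cartesian_Product.norm_nth_le order_trans)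
      moreover have "D t $ i $ j = (Y t w $ i $ j - Y t z $ i $ j) / (w - z) - Z t $ i $ j"
        by (simp add: D_def)
      ultimately show ?thesis by simp
    qed
    have "((\<lambda>w. (Y t w $ i $ j - Y t z $ i $ j) / (w - z) - Z t $ i $ j) \<longlongrightarrow> 0) (at z)"
    proof (rule Lim_null_comparison)
      show "((\<lambda>w. e w * G) \<longlongrightarrow> 0) (at z)" using tendsto_mult_right[OF e_lim, of G] by simp
      have "\<forall>\<^sub>F w in at z. norm (\<phi> w) < norm (\<phi> z) + 1" "\<forall>\<^sub>F w in at z. norm (\<psi> w) < norm (\<psi> z) + 1"
        using order_tendstoD(2)[OF tendsto_norm[OF \<phi>_lim], of "norm (\<phi> z) + 1"]
          order_tendstoD(2)[OF tendsto_norm[OF \<psi>_lim], of "norm (\<psi> z) + 1"] by auto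
      moreover have "\<forall>\<^sub>F w in at z. w \<in> U \<and> w \<noteq> z"
        using eventually_at_in_open[OF U z] by (simp add: eventually_mono)
      ultimately show "\<forall>\<^sub>F w in at z. norm ((Y t w $ i $ j - Y t z $ i $ j) / (w - z) - Z t $ i $ j) \<le> e w * G"
        by eventually_elim (rule bound, auto)
    qed
    then have "((\<lambda>w. Y t w $ i $ j) has_field_derivative Z t $ i $ j) (at z)"
      unfolding has_field_derivative_iff by (simp add: LIM_zero_iff)
    then show ?thesis by (auto simp: field_differentiable_def)
  qed
  then show ?thesis using U by (simp add: holomorphic_on_def field_differentiable_at_within)
qed

text \<open>On the circle, differentiation by the angle is the operator \<delta> = i z d/dz, which
  maps holomorphic functions on \<open>U\<close> to holomorphic functions; its iterates provide all
  derivatives.\<close>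

lemma smooth_restrict_circle:
  fixes F :: "complex \<Rightarrow> complex^'n^'m"
  assumes U: "open U" "S1 \<subseteq> U" and F: "\<And>i j. (\<lambda>z. F z $ i $ j) holomorphic_on U"
  shows "smooth (\<lambda>\<theta>. F (cis \<theta>))"
proof -
  define \<delta> :: "(complex \<Rightarrow> complex) \<Rightarrow> complex \<Rightarrow> complex" where "\<delta> f z = \<i> * z * deriv f z" for f z
  have hol: "((\<delta> ^^ n) (\<lambda>z. F z $ i $ j)) holomorphic_on U" for n i j
  proof (induction n)
    case (Suc n)
    then have "(\<lambda>z. \<i> * z * deriv ((\<delta> ^^ n) (\<lambda>z. F z $ i $ j)) z) holomorphic_on U"
      by (intro holomorphic_intros holomorphic_deriv U)
    moreover have "(\<delta> ^^ Suc n) (\<lambda>z. F z $ i $ j) = (\<lambda>z. \<i> * z * deriv ((\<delta> ^^ n) (\<lambda>z. F z $ i $ j)) z)"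
      by (simp add: \<delta>_def[abs_def])
    ultimately show ?case by simp
  qed (simp add: F)
  define D where "D n \<theta> = (\<chi> i j. (\<delta> ^^ n) (\<lambda>z. F z $ i $ j) (cis \<theta>))" for n \<theta>
  have cis_deriv: "(cis has_vector_derivative \<i> * cis \<theta>) (at \<theta>)" for \<theta>
  proof -
    have "((\<lambda>\<theta>. exp (\<i> * complex_of_real \<theta>)) has_vector_derivative \<i> * exp (\<i> * complex_of_real \<theta>)) (at \<theta>)"
      by (rule has_vector_derivative_real_field[where f = "\<lambda>z. exp (\<i> * z)"]) (auto intro!: derivative_eq_intros)
    then show ?thesis by (simp add: cis_conv_exp[abs_def])
  qed
  have "(D n has_vector_derivative D (Suc n) \<theta>) (at \<theta>)" for n \<theta>
    unfolding has_vector_derivative_vec_nth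
  proof (intro allI)
    fix i j
    let ?f = "(\<delta> ^^ n) (\<lambda>z. F z $ i $ j)"
    have "(?f has_field_derivative deriv ?f (cis \<theta>)) (at (cis \<theta>))"
      using hol U by (intro holomorphic_derivI) auto
    from field_vector_diff_chain_at[OF cis_deriv this]
    show "((\<lambda>\<theta>. D n \<theta> $ i $ j) has_vector_derivative D (Suc n) \<theta> $ i $ j) (at \<theta>)"
      by (simp add: D_def o_def \<delta>_def)
  qed
  moreover have "D 0 = (\<lambda>\<theta>. F (cis \<theta>))" by (simp add: D_def fun_eq_iff vec_eq_iff)
  ultimately show ?thesis unfolding smooth_def by (intro exI[of _ D]) auto
qed

text \<open>The maximum principle for the real parts of i f and - i f shows that \<open>f\<close> is
  real in the disc. A nonconstant \<open>f\<close> would have an open image there, and the real line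
  contains no open set.\<close>

lemma real_on_circle_constant:
  assumes cont: "continuous_on (cball 0 1) f" and hol: "f holomorphic_on ball 0 1"
    and real: "\<And>z. z \<in> S1 \<Longrightarrow> Im (f z) = 0" and z: "z \<in> cball 0 1"
  shows "f z = f 0"
proof -
  have im: "Im (f w) = 0" if "w \<in> ball 0 1" for w
  proof -
    have "Re (c * f w) \<le> 0" if "Re c = 0" for c
      by (rule maximum_real_frontier[where S = "ball 0 1" and f = "\<lambda>w. c * f w"])
        (use cont hol real \<open>w \<in> ball 0 1\<close> that in \<open>auto intro!: holomorphic_intros continuous_intros\<close>)
    from this[of "\<i>"] this[of "- \<i>"] show ?thesis by simp
  qed
  have "f constant_on ball 0 1"
  proof (rule ccontr)
    assume "\<not> f constant_on ball 0 1"
    then have "open (f ` ball 0 1)" using open_mapping_thm[OF hol] by auto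
    moreover have "f 0 \<in> f ` ball 0 1" by simp
    ultimately obtain \<epsilon> where \<epsilon>: "\<epsilon> > 0" "ball (f 0) \<epsilon> \<subseteq> f ` ball 0 1"
      using open_contains_ball by blast
    have "f 0 + \<i> * (\<epsilon> / 2) \<in> ball (f 0) \<epsilon>" using \<epsilon> by (simp add: dist_norm norm_mult)
    then obtain w where "w \<in> ball 0 1" "f w = f 0 + \<i> * (\<epsilon> / 2)" using \<epsilon> by auto
    then show False using im[of w] im[of 0] \<epsilon> by simp
  qed
  then obtain a where a: "\<And>w. w \<in> ball 0 1 \<Longrightarrow> f w = a" by (auto simp: constant_on_def)
  have "f w = a" if "w \<in> cball 0 1" for w
    using continuous_constant_on_closure[of "ball 0 1" f a w] cont a that by simp
  then show ?thesis using z by simp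
qed

lemma loop_factors_unique:
  assumes P: "positive_roots P"
    and f: "loop_factors P g gp gm" and f': "loop_factors P g gp' gm'"
  shows "gp = gp' \<and> gm = gm'"
proof -
  have gp: "gp l \<in> G2" "gp' l \<in> G2" and gm: "gm l \<in> G2C" "gm' l \<in> G2C"
    and eq: "gp l ** gm l = gp' l ** gm' l" if "l \<in> S1" for l
    using f f' that
    unfolding loop_factors_def twisted_def loops_plus_def loops_minus_def loops_def by (auto simp: PiE_def)
  obtain G where G: "\<And>l. l \<in> S1 \<Longrightarrow> G l = gm l" "continuous_on (cball 0 1) G"
      "\<And>i j. (\<lambda>z. G z $ i $ j) holomorphic_on ball 0 1" "\<And>z. z \<in> ball 0 1 \<Longrightarrow> G z \<in> G2C" "G 0 \<in> Bgrp P"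
    using f unfolding loop_factors_def twisted_def loops_minus_def by blast
  obtain G' where G': "\<And>l. l \<in> S1 \<Longrightarrow> G' l = gm' l" "continuous_on (cball 0 1) G'"
      "\<And>i j. (\<lambda>z. G' z $ i $ j) holomorphic_on ball 0 1" "\<And>z. z \<in> ball 0 1 \<Longrightarrow> G' z \<in> G2C" "G' 0 \<in> Bgrp P"
    using f' unfolding loop_factors_def twisted_def loops_minus_def by blast
  \<comment> \<open>The quotient of the two minus factors. Inversion on \<open>G2C\<close> is
    transposition, so its entries are sums of products of holomorphic functions; on the circle it is
    also the quotient of the plus factors, which is real.\<close>
  define b where "b z = G' z ** transpose (G z)" for z
  have b_circle: "b l = transpose (gp' l) ** gp l" if "l \<in> S1" for l
  proof -
    have g: "gp' l \<in> G2C" "gp l \<in> G2C" "gm l \<in> G2C" using gp gm that by (auto simp: G2_iff)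
    have "transpose (gp' l) ** (gp l ** gm l) ** transpose (gm l) =
        transpose (gp' l) ** (gp' l ** gm' l) ** transpose (gm l)" by (simp add: eq[OF that])
    then have "transpose (gp' l) ** gp l ** (gm l ** transpose (gm l)) =
        (transpose (gp' l) ** gp' l) ** gm' l ** transpose (gm l)" by (simp add: matrix_mul_assoc)
    then show ?thesis using g that by (simp add: b_def G2C_inverse G G')
  qed
  have b_real: "mconj (b l) = b l" if "l \<in> S1" for l
    using gp[OF that] that by (simp add: b_circle G2_iff mconj_mult mconj_transpose)
  have b_entry: "b z $ i $ j = b 0 $ i $ j" if "z \<in> cball 0 1" for z i j
  proof (rule real_on_circle_constant[OF _ _ _ that])
    have "continuous_on (cball 0 1) b"
      unfolding b_def[abs_def]
      by (intro mm.continuous_on bounded_linear.continuous_on[OF transpose_bounded_linear] G G')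
    then show "continuous_on (cball 0 1) (\<lambda>z. b z $ i $ j)"
      by (intro bounded_linear.continuous_on[OF bounded_linear_vec_nth])
    have "(\<lambda>z. \<Sum>k\<in>UNIV. G' z $ i $ k * G z $ j $ k) holomorphic_on ball 0 1"
      by (intro holomorphic_intros G G')
    then show "(\<lambda>z. b z $ i $ j) holomorphic_on ball 0 1"
      by (simp add: b_def matrix_matrix_mult_def transpose_def)
    show "Im (b l $ i $ j) = 0" if "l \<in> S1" for l
      using arg_cong[OF b_real[OF that], of "\<lambda>A. A $ i $ j"] by (simp add: complex_eq_iff)
  qed
  have bc: "b z = b 0" if "z \<in> cball 0 1" for z
    unfolding vec_eq_iff using b_entry[OF that] by blast
  have G0: "G 0 \<in> G2C" "G' 0 \<in> G2C" using G G' by auto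
  \<comment> \<open>The point 1 lies on the circle, so the value at 0, where membership in
    \<open>Bgrp P\<close> is known, is real too. A real matrix in \<open>G2C\<close> is
    unitary.\<close>
  have "b 0 = b 1" using bc[of 1] by simp
  then have "mconj (b 0) = b 0" using b_real[of 1] by simp
  then have adj: "adj (b 0) = transpose (b 0)" by (simp add: adj_def mconj_transpose)
  have "b 0 \<in> G2C" using G0 by (simp add: b_def G2C_mult G2C_transpose)
  then have unit: "adj (b 0) ** b 0 = mat 1" by (simp add: adj G2C_inverse)
  have "b 0 ** G 0 = G' 0"
    using G0 by (simp add: b_def G2C_inverse flip: matrix_mul_assoc)
  then have b1: "b 0 = mat 1" using Bgrp_unitary_quotient[OF P G(5) G'(5)] unit by blast
  have "gp l = gp' l \<and> gm l = gm' l" if l: "l \<in> S1" for l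
  proof -
    have "b l = mat 1" using bc[of l] b1 l by simp
    then have 1: "transpose (gp' l) ** gp l = mat 1" "gm' l ** transpose (gm l) = mat 1"
      using b_circle[OF l] l by (auto simp: b_def G G')
    have g: "gp' l \<in> G2C" "gm l \<in> G2C" using gp gm l by (auto simp: G2_iff)
    have "gp' l ** (transpose (gp' l) ** gp l) = gp' l" "(gm' l ** transpose (gm l)) ** gm l = gm l"
      using 1 by simp_all
    then have "(gp' l ** transpose (gp' l)) ** gp l = gp' l" "gm' l ** (transpose (gm l) ** gm l) = gm l"
      by (simp_all add: matrix_mul_assoc)
    then show ?thesis using G2C_inverse[OF g(1)] G2C_inverse[OF g(2)] by simp
  qed
  moreover have "gp \<in> extensional S1" "gp' \<in> extensional S1" "gm \<in> extensional S1" "gm' \<in> extensional S1"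
    using f f' unfolding loop_factors_def twisted_def loops_plus_def loops_minus_def loops_def by (auto simp: PiE_def)
  ultimately show ?thesis by (blast intro: extensionalityI)
qed

lemma mconj_norm: "norm (mconj A) = norm A"
  by (simp add: norm_vec_def)

text \<open>The two-term coefficient covers both factors: multiples of \<open>u1\<close> and
  \<open>mconj u1\<close> for the inverse of the plus factor, of \<open>u0\<close> and
  \<open>mconj u1\<close> for the minus factor.\<close>

lemma affine_ode_exists:
  fixes P Q :: "real \<Rightarrow> complex^'n^'n" and \<phi> \<psi> :: "complex \<Rightarrow> complex"
  assumes P: "continuous_on UNIV P" "\<And>t. norm (P t) \<le> M"
    and Q: "continuous_on UNIV Q" "\<And>t. norm (Q t) \<le> M"
  obtains Y where "\<And>z. Y 0 z = mat 1"
    "\<And>t z. ((\<lambda>t. Y t z) has_vector_derivative (\<phi> z *\<^sub>C P t + \<psi> z *\<^sub>C Q t) ** Y t z) (at t)"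
proof -
  have "\<exists>Y. Y 0 = mat 1 \<and> (\<forall>t. (Y has_vector_derivative (\<phi> z *\<^sub>C P t + \<psi> z *\<^sub>C Q t) ** Y t) (at t))" for z
  proof -
    have c: "continuous_on UNIV (\<lambda>t. \<phi> z *\<^sub>C P t + \<psi> z *\<^sub>C Q t)"
      by (intro continuous_on_add cs.continuous_on continuous_on_const P Q)
    have n: "norm (\<phi> z *\<^sub>C P t + \<psi> z *\<^sub>C Q t) \<le> norm (\<phi> z) * M + norm (\<psi> z) * M" for t
      by (rule order_trans[OF norm_triangle_ineq]) (auto simp: norm_cscale intro!: add_mono mult_left_mono P Q)
    from linear_ode_exists[OF c n continuous_on_const[of _ 0], where ?Y0.0 = "mat 1"]
    obtain Y where "Y 0 = mat 1"
      "\<And>t. (Y has_vector_derivative (\<phi> z *\<^sub>C P t + \<psi> z *\<^sub>C Q t) ** Y t + 0) (at t)" by blast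
    then show ?thesis by (intro exI[of _ Y]) simp
  qed
  then have "\<forall>z. \<exists>Y. Y 0 = mat 1 \<and> (\<forall>t. (Y has_vector_derivative (\<phi> z *\<^sub>C P t + \<psi> z *\<^sub>C Q t) ** Y t) (at t))"
    by blast
  from choice[OF this] obtain Y where "\<forall>z. Y z 0 = mat 1 \<and>
      (\<forall>t. (Y z has_vector_derivative (\<phi> z *\<^sub>C P t + \<psi> z *\<^sub>C Q t) ** Y z t) (at t))" by blast
  then show ?thesis using that[of "\<lambda>t z. Y z t"] by simp
qed

section \<open>Symmetries of solutions and one-parameter subgroups\<close>

lemma linear_ode_sigma:
  assumes Y: "\<And>t. (Y has_vector_derivative C t ** Y t) (at t)" "Y 0 = mat 1"
    and Z: "\<And>t. (Z has_vector_derivative C' t ** Z t) (at t)" "Z 0 = mat 1"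
    and "\<And>t. sigma (C t) = C' t" and cont: "continuous_on UNIV C'"
  shows "sigma (Y t) = Z t"
proof (rule linear_ode_unique[OF cont _ Z(1)])
  show "((\<lambda>t. sigma (Y t)) has_vector_derivative C' t ** sigma (Y t)) (at t)" for t
    using bounded_linear.has_vector_derivative[OF sigma_bounded_linear Y(1)[of t]]
    by (simp add: sigma_mult assms)
qed (simp add: Y Z sigma_one)

lemma linear_ode_real:
  assumes Y: "\<And>t. (Y has_vector_derivative C t ** Y t) (at t)" "Y 0 = mat 1"
    and "\<And>t. mconj (C t) = C t" and cont: "continuous_on UNIV C"
  shows "mconj (Y t) = Y t"
proof (rule linear_ode_unique[OF cont _ Y(1)])
  show "((\<lambda>t. mconj (Y t)) has_vector_derivative C t ** mconj (Y t)) (at t)" for t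
    using bounded_linear.has_vector_derivative[OF mconj_bounded_linear Y(1)[of t]]
    by (simp add: mconj_mult assms)
qed (simp add: Y)

text \<open>Transposition moves the coefficient to the left, where \<open>linear_ode_unique\<close>
  applies.\<close>

lemma mexp_unique_right:
  fixes A :: "complex^'n^'n"
  assumes "\<And>t. (Y has_vector_derivative Y t ** A) (at t)" and "Y 0 = mat 1"
  shows "Y t = mexp (t *\<^sub>R A)"
proof -
  have "transpose (Y t) = transpose (mexp (t *\<^sub>R A))"
  proof (rule linear_ode_unique[where C = "\<lambda>_. transpose A"])
    show "((\<lambda>t. transpose (Y t)) has_vector_derivative transpose A ** transpose (Y t)) (at t)" for t
      using bounded_linear.has_vector_derivative[OF transpose_bounded_linear assms(1)[of t]]
      by (simp add: matrix_transpose_mul)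
    show "((\<lambda>t. transpose (mexp (t *\<^sub>R A))) has_vector_derivative transpose A ** transpose (mexp (t *\<^sub>R A))) (at t)" for t
      using bounded_linear.has_vector_derivative[OF transpose_bounded_linear mexp_scaleR_deriv[of A t]]
      by (simp add: mexp_commute matrix_transpose_mul)
  qed (simp_all add: assms)
  then show ?thesis by (metis transpose_transpose)
qed

lemma matrix_inv_inverse:
  fixes A :: "'a::field^'n^'n"
  assumes "invertible A"
  shows "A ** matrix_inv A = mat 1" "matrix_inv A ** A = mat 1"
  using assms matrix_inv_eqI[of A] by (auto simp: invertible_def)

lemma left_log_deriv_iff:
  "left_log_deriv g t X \<longleftrightarrow> invertible (g t) \<and> (g has_vector_derivative g t ** X) (at t)"
proof
  assume "left_log_deriv g t X"
  then obtain D where D: "invertible (g t)" "(g has_vector_derivative D) (at t)" "matrix_inv (g t) ** D = X"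
    by (auto simp: left_log_deriv_def)
  have "g t ** X = g t ** matrix_inv (g t) ** D" by (simp add: D(3)[symmetric] matrix_mul_assoc)
  then have "g t ** X = D" using matrix_inv_inverse[OF D(1)] by simp
  then show "invertible (g t) \<and> (g has_vector_derivative g t ** X) (at t)" using D by simp
next
  assume "invertible (g t) \<and> (g has_vector_derivative g t ** X) (at t)"
  then show "left_log_deriv g t X"
    unfolding left_log_deriv_def using matrix_inv_inverse[of "g t"]
    by (auto intro!: exI[of _ "g t ** X"] simp: matrix_mul_assoc)
qed

lemma loop_flow_iff: "loop_flow xi g \<longleftrightarrow> g = (\<lambda>t. \<lambda>l\<in>S1. mexp (t *\<^sub>R xi l))"
proof
  assume L: "loop_flow xi g"
  show "g = (\<lambda>t. \<lambda>l\<in>S1. mexp (t *\<^sub>R xi l))"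
  proof (rule ext, rule extensionalityI[of _ S1])
    fix t show "g t \<in> extensional S1" using L by (simp add: loop_flow_def)
    fix l assume l: "l \<in> S1"
    have "(\<lambda>t. g t l) t = mexp (t *\<^sub>R xi l)"
      by (rule mexp_unique_right) (use L l in \<open>auto simp: loop_flow_def left_log_deriv_iff\<close>)
    then show "g t l = (\<lambda>l\<in>S1. mexp (t *\<^sub>R xi l)) l" using l by simp
  qed simp
next
  assume g: "g = (\<lambda>t. \<lambda>l\<in>S1. mexp (t *\<^sub>R xi l))"
  have "invertible (mexp (t *\<^sub>R xi l))" for t l
    by (rule invertibleI[OF mexp_minus])
  moreover have "((\<lambda>t. mexp (t *\<^sub>R xi l)) has_vector_derivative mexp (t *\<^sub>R xi l) ** xi l) (at t)" for t l
    using mexp_scaleR_deriv[of "xi l" t] by (simp add: mexp_commute)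
  ultimately show "loop_flow xi g" by (simp add: loop_flow_def left_log_deriv_iff g)
qed

lemma twisted_loopI:
  assumes U: "open U" "S1 \<subseteq> U" and hol: "\<And>i j. (\<lambda>z. F z $ i $ j) holomorphic_on U"
    and G2C: "\<And>l. l \<in> S1 \<Longrightarrow> F l \<in> G2C"
    and tw: "\<And>l. l \<in> S1 \<Longrightarrow> sigma (F (cis (- pi / 3) * l)) = F l"
  shows "restrict F S1 \<in> loops" "sigma_hat (restrict F S1) = restrict F S1"
proof -
  have "smooth (\<lambda>\<theta>. F (cis \<theta>))" by (rule smooth_restrict_circle[OF U hol])
  then show "restrict F S1 \<in> loops" using G2C by (simp add: loops_def)
  show "sigma_hat (restrict F S1) = restrict F S1"
    unfolding sigma_hat_def using tw by (auto simp: fun_eq_iff restrict_def norm_mult)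
qed

text \<open>The Lax equation with spectral parameter: the coefficients of the powers -1, 0 and 1 of
  \<open>z\<close> are the equations for \<open>u1\<close>, \<open>u0\<close> and
  \<open>mconj u1\<close>, while the powers -2 and 2 cancel as brackets of an element with
  itself.\<close>

lemma loop_lax:
  fixes u0 u1 :: "real \<Rightarrow> cmat7"
  assumes d0: "(u0 has_vector_derivative (- \<i>) *\<^sub>C bracket (u1 t) (mconj (u1 t))) (at t)"
    and d1: "(u1 has_vector_derivative (2 * \<i>) *\<^sub>C bracket (u0 t) (u1 t)) (at t)"
    and real: "mconj (u0 t) = u0 t" and z: "z \<noteq> 0"
  shows "((\<lambda>t. (2 * \<i>) *\<^sub>C u0 t + (\<i> * inverse z) *\<^sub>C u1 t + (\<i> * z) *\<^sub>C mconj (u1 t)) has_vector_derivative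
    bracket ((2 * \<i>) *\<^sub>C u0 t + (\<i> * inverse z) *\<^sub>C u1 t + (\<i> * z) *\<^sub>C mconj (u1 t))
      ((\<i> * inverse z) *\<^sub>C u1 t - (\<i> * z) *\<^sub>C mconj (u1 t))) (at t)"
proof -
  have "((\<lambda>t. (2 * \<i>) *\<^sub>C u0 t + (\<i> * inverse z) *\<^sub>C u1 t + (\<i> * z) *\<^sub>C mconj (u1 t)) has_vector_derivative
    (2 * \<i>) *\<^sub>C (- \<i>) *\<^sub>C bracket (u1 t) (mconj (u1 t)) + (\<i> * inverse z) *\<^sub>C (2 * \<i>) *\<^sub>C bracket (u0 t) (u1 t) +
    (\<i> * z) *\<^sub>C mconj ((2 * \<i>) *\<^sub>C bracket (u0 t) (u1 t))) (at t)"
    by (intro has_vector_derivative_add bounded_linear.has_vector_derivative[OF cs.bounded_linear_right]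
        bounded_linear.has_vector_derivative[OF mconj_bounded_linear] d0 d1)
  moreover have "(2 * \<i>) *\<^sub>C (- \<i>) *\<^sub>C bracket a (mconj a) + (\<i> * inverse z) *\<^sub>C (2 * \<i>) *\<^sub>C bracket (u0 t) a +
      (\<i> * z) *\<^sub>C mconj ((2 * \<i>) *\<^sub>C bracket (u0 t) a) =
    bracket ((2 * \<i>) *\<^sub>C u0 t + (\<i> * inverse z) *\<^sub>C a + (\<i> * z) *\<^sub>C mconj a)
      ((\<i> * inverse z) *\<^sub>C a - (\<i> * z) *\<^sub>C mconj a)" for a
    using z by (simp add: mconj_cscale mconj_bracket real br.add_left br.diff_right bracket_cscale bracket_self
        bracket_swap[of "mconj a" a] vec_eq_iff algebra_simps)
  ultimately show ?thesis by simp
qed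

text \<open>
  The factors of the one-parameter subgroup solve linear equations along the solution of the Lax
  equation: their logarithmic derivatives are the real part \<open>xip\<close> and the part \<open>xim\<close>
  without negative powers of the loop \<open>xi\<close>.
\<close>

lemma loop_factorization:
  fixes u0 u1 :: "real \<Rightarrow> cmat7"
  assumes u: "\<And>t. u0 t \<in> tor" "\<And>t. u1 t \<in> eigsp (-1)"
    and d0: "\<And>t. (u0 has_vector_derivative (- \<i>) *\<^sub>C bracket (u1 t) (mconj (u1 t))) (at t)"
    and d1: "\<And>t. (u1 has_vector_derivative (2 * \<i>) *\<^sub>C bracket (u0 t) (u1 t)) (at t)"
    and M: "\<And>t. norm (u0 t) \<le> M" "\<And>t. norm (u1 t) \<le> M"
    and xi: "\<And>t z. xi t z = (2 * \<i>) *\<^sub>C u0 t + (\<i> * inverse z) *\<^sub>C u1 t + (\<i> * z) *\<^sub>C mconj (u1 t)"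
  obtains Gp Gm where "\<And>t. loop_factors P (\<lambda>l\<in>S1. mexp (t *\<^sub>R xi 0 l)) (Gp t) (Gm t)"
    "\<And>t. (\<lambda>l\<in>S1. mexp (t *\<^sub>R xi 0 l)) \<in> twisted loops"
    "\<And>t l. l \<in> S1 \<Longrightarrow> transpose (Gp t l) ** xi 0 l ** Gp t l = xi t l"
    "\<And>t. ((\<lambda>t. Gp t 1) has_vector_derivative Gp t 1 ** (\<i> *\<^sub>C (u1 t - mconj (u1 t)))) (at t)"
proof -
  define xip where "xip t z = (\<i> * inverse z) *\<^sub>C u1 t - (\<i> * z) *\<^sub>C mconj (u1 t)" for t z
  define xim where "xim t z = (2 * \<i>) *\<^sub>C u0 t + (2 * \<i> * z) *\<^sub>C mconj (u1 t)" for t z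
  define \<omega> where "\<omega> = cis (- pi / 3)"
  have xi_split: "xi t z = xip t z + xim t z" for t z
    by (simp add: xi xip_def xim_def vec_eq_iff algebra_simps)
  have u': "cder (u0 t)" "mconj (u0 t) = u0 t" "sigma (u0 t) = u0 t" "cder (u1 t)" "cder (mconj (u1 t))"
    "sigma (u1 t) = \<omega> *\<^sub>C u1 t" "sigma (mconj (u1 t)) = cnj \<omega> *\<^sub>C mconj (u1 t)" for t
    using u[of t] by (auto simp: tor_def eigsp_iff g2_iff cder_mconj sigma_mconj mconj_cscale \<omega>_def)
  have \<omega>: "\<omega> \<noteq> 0" "cnj \<omega> = inverse \<omega>" by (simp_all add: \<omega>_def cis_cnj)
  have c0: "continuous_on UNIV u0"
    by (intro continuous_at_imp_continuous_on ballI has_vector_derivative_continuous, rule d0)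
  have c1: "continuous_on UNIV u1"
    by (intro continuous_at_imp_continuous_on ballI has_vector_derivative_continuous, rule d1)
  have c1': "continuous_on UNIV (\<lambda>t. mconj (u1 t))"
    by (rule bounded_linear.continuous_on[OF mconj_bounded_linear c1])
  have M': "norm (mconj (u1 t)) \<le> M" for t using M(2) by (simp add: mconj_norm)
  have cp: "continuous_on UNIV (\<lambda>t. - xip t z)" and cm: "continuous_on UNIV (\<lambda>t. xim t z)" for z
    unfolding xip_def xim_def
    by (intro continuous_on_minus continuous_on_add continuous_on_diff cs.continuous_on continuous_on_const c0 c1 c1')+

  \<comment> \<open>The plus factor has its coefficient on the right. Its inverse \<open>W\<close>
    has it on the left, as the lemmas on linear equations require, and transposing \<open>W\<close>
    recovers the factor with entries still holomorphic away from 0.\<close>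
  obtain W where W0: "\<And>z. W 0 z = mat 1"
    and W'': "\<And>t z. ((\<lambda>t. W t z) has_vector_derivative
      ((- (\<i> * inverse z)) *\<^sub>C u1 t + (\<i> * z) *\<^sub>C mconj (u1 t)) ** W t z) (at t)"
    using affine_ode_exists[OF c1 M(2) c1' M', of "\<lambda>z. - (\<i> * inverse z)" "\<lambda>z. \<i> * z"] by blast
  have W': "((\<lambda>t. W t z) has_vector_derivative (- xip t z) ** W t z) (at t)" for t z
    using W''[where t = t and z = z] by (simp add: xip_def cs.minus_left)
  obtain Gm where Gm0: "\<And>z. Gm 0 z = mat 1"
    and Gm'': "\<And>t z. ((\<lambda>t. Gm t z) has_vector_derivative
      ((2 * \<i>) *\<^sub>C u0 t + (2 * \<i> * z) *\<^sub>C mconj (u1 t)) ** Gm t z) (at t)"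
    using affine_ode_exists[OF c0 M(1) c1' M', of "\<lambda>z. 2 * \<i>" "\<lambda>z. 2 * \<i> * z"] by blast
  have Gm': "((\<lambda>t. Gm t z) has_vector_derivative xim t z ** Gm t z) (at t)" for t z
    using Gm''[where t = t and z = z] by (simp add: xim_def)
  define Gp where "Gp t z = transpose (W t z)" for t z

  have W_hol: "(\<lambda>z. W t z $ i $ j) holomorphic_on - {0}" for t i j
    by (rule linear_ode_holomorphic[OF c1 M(2) c1' M' _ _ _ W'' W0])
      (auto intro!: holomorphic_intros)
  have Gm_hol: "(\<lambda>z. Gm t z $ i $ j) holomorphic_on UNIV" for t i j
    by (rule linear_ode_holomorphic[OF c0 M(1) c1' M' _ _ _ Gm'' Gm0])
      (auto intro!: holomorphic_intros)
  have Gp_hol: "(\<lambda>z. Gp t z $ i $ j) holomorphic_on - {0}" for t i j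
    using W_hol by (simp add: Gp_def transpose_def)

  have cder_p: "cder (xip t z)" and cder_m: "cder (xim t z)" for t z
    unfolding xip_def xim_def by (intro cder_add cder_diff cder_cscale u')+
  have W_G2C: "W t z \<in> G2C" for t z
    by (rule linear_ode_G2C[where Y = "\<lambda>t. W t z", OF W' W0 cder_minus[OF cder_p]])
  have Gm_G2C: "Gm t z \<in> G2C" for t z
    by (rule linear_ode_G2C[where Y = "\<lambda>t. Gm t z", OF Gm' Gm0 cder_m])
  have Gp_G2C: "Gp t z \<in> G2C" for t z unfolding Gp_def by (rule G2C_transpose[OF W_G2C])
  have inv: "W t z ** Gp t z = mat 1" "Gp t z ** W t z = mat 1" for t z
    using G2C_inverse[OF W_G2C] by (simp_all add: Gp_def)
  have Gp': "((\<lambda>t. Gp t z) has_vector_derivative Gp t z ** xip t z) (at t)" for t z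
    using bounded_linear.has_vector_derivative[OF transpose_bounded_linear W'[where t = t and z = z]] cder_p[of t z]
    by (simp add: Gp_def matrix_transpose_mul cder_def linear_neg[OF bounded_linear.linear[OF transpose_bounded_linear]])

  have W_sigma: "sigma (W t (\<omega> * z)) = W t z" for t z
  proof (rule linear_ode_sigma[where Y = "\<lambda>t. W t (\<omega> * z)", OF W' W0 W' W0 _ cp])
    \<comment> \<open>At z = 0 the first identity holds by the convention inverse 0 = 0, so the
      twisting is obtained for every \<open>z\<close>.\<close>
    have e: "\<i> * inverse (\<omega> * z) * \<omega> = \<i> * inverse z" "\<i> * (\<omega> * z) * cnj \<omega> = \<i> * z"
      using \<omega>(1) unfolding \<omega>(2) by (cases "z = 0"; simp add: field_simps)+
    show "sigma (- xip t (\<omega> * z)) = - xip t z" for t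
      using sigma_scaleR[of "-1" "xip t (\<omega> * z)"]
      by (simp add: xip_def sigma_diff sigma_cscale u' e del: inverse_mult_distrib)
  qed
  have Gm_sigma: "sigma (Gm t (\<omega> * z)) = Gm t z" for t z
  proof (rule linear_ode_sigma[where Y = "\<lambda>t. Gm t (\<omega> * z)", OF Gm' Gm0 Gm' Gm0 _ cm])
    show "sigma (xim t (\<omega> * z)) = xim t z" for t
      using \<omega> by (simp add: xim_def sigma_add sigma_cscale u' vec_eq_iff)
  qed
  have Gp_sigma: "sigma (Gp t (\<omega> * z)) = Gp t z" for t z
  proof -
    have "sigma (Gp t (\<omega> * z)) ** W t z = mat 1"
      using arg_cong[OF inv(2)[of t "\<omega> * z"], of sigma] by (simp add: sigma_mult sigma_one W_sigma)
    then have "sigma (Gp t (\<omega> * z)) ** W t z ** Gp t z = Gp t z" by simp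
    then show ?thesis using inv by (simp flip: matrix_mul_assoc)
  qed
  have Gp_real: "Gp t l \<in> G2" if l: "l \<in> S1" for t l
  proof -
    have "l * cnj l = 1" using l by (simp add: complex_norm_square[symmetric])
    then have "cnj l = inverse l" by (rule inverse_unique[symmetric])
    \<comment> \<open>On the circle conjugation exchanges the two terms of \<open>xip\<close> with
      the right signs, so \<open>xip t l\<close> is real.\<close>
    then have il: "inverse l = cnj l" "cnj (inverse l) = l" by (metis complex_cnj_cnj)+
    have "mconj (W t l) = W t l"
    proof (rule linear_ode_real[where Y = "\<lambda>t. W t l", OF W' W0 _ cp])
      show "mconj (- xip t l) = - xip t l" for t
        by (simp add: xip_def mconj_minus mconj_diff mconj_cscale il cs.minus_left del: complex_cnj_inverse)
    qed
    then show ?thesis using Gp_G2C by (simp add: G2_iff Gp_def mconj_transpose)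
  qed

  \<comment> \<open>The equation xi' = [xi, xip] says precisely that conjugation by
    \<open>Gp\<close> freezes the loop at its initial value.\<close>
  have conj: "Gp t z ** xi t z ** W t z = xi 0 z" if "z \<noteq> 0" for t z
  proof -
    have xi': "((\<lambda>t. xi t z) has_vector_derivative bracket (xi t z) (xip t z)) (at t)" for t
      unfolding xi xip_def by (rule loop_lax[OF d0 d1 u'(2) that])
    have "((\<lambda>t. Gp t z ** xi t z ** W t z) has_vector_derivative 0) (at t)" for t
    proof -
      have "((\<lambda>t. Gp t z ** xi t z ** W t z) has_vector_derivative Gp t z ** xi t z ** (- xip t z ** W t z) +
          (Gp t z ** bracket (xi t z) (xip t z) + Gp t z ** xip t z ** xi t z) ** W t z) (at t)"
        by (intro mm.has_vector_derivative Gp' W' xi')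
      then show ?thesis
        by (simp add: bracket_def mm.diff_right mm.diff_left mm.add_left mm.minus_left mm.minus_right matrix_mul_assoc)
    qed
    from const_if_deriv_zero[OF this] show ?thesis by (simp add: W0 Gp_def)
  qed
  have xi_t: "W t z ** xi 0 z ** Gp t z = xi t z" if "z \<noteq> 0" for t z
  proof -
    have "W t z ** (Gp t z ** xi t z ** W t z) ** Gp t z = (W t z ** Gp t z) ** xi t z ** (W t z ** Gp t z)"
      by (simp add: matrix_mul_assoc)
    then show ?thesis using inv conj[OF that] by simp
  qed
  \<comment> \<open>The derivative of the product is Gp (xip + xim) Gm = Gp xi Gm, and Gp xi = xi0
    Gp by the preceding conjugation; so the product solves the equation of the exponential.\<close>
  have prod: "Gp t z ** Gm t z = mexp (t *\<^sub>R xi 0 z)" if "z \<noteq> 0" for t z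
  proof (rule mexp_unique[where Y = "\<lambda>t. Gp t z ** Gm t z"])
    fix t
    have "Gp t z ** xi t z = (Gp t z ** xi t z) ** (W t z ** Gp t z)" using inv by simp
    then have *: "Gp t z ** xi t z = xi 0 z ** Gp t z" using conj[OF that, of t] by (simp add: matrix_mul_assoc)
    have "((\<lambda>t. Gp t z ** Gm t z) has_vector_derivative
        Gp t z ** (xim t z ** Gm t z) + Gp t z ** xip t z ** Gm t z) (at t)"
      by (intro mm.has_vector_derivative Gp' Gm')
    moreover have "Gp t z ** (xim t z ** Gm t z) + Gp t z ** xip t z ** Gm t z = Gp t z ** xi t z ** Gm t z"
      by (simp add: xi_split mm.add_left mm.add_right matrix_mul_assoc)
    ultimately show "((\<lambda>t. Gp t z ** Gm t z) has_vector_derivative xi 0 z ** (Gp t z ** Gm t z)) (at t)"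
      by (simp add: * matrix_mul_assoc)
  qed (simp add: Gm0 Gp_def W0)

  have nz: "l \<noteq> 0" if "l \<in> S1" for l :: complex using that by auto
  have S1: "open (- {0 :: complex})" "S1 \<subseteq> - {0 :: complex}" by (auto simp: open_Compl)
  have plus: "restrict (Gp t) S1 \<in> twisted loops_plus" for t
    using twisted_loopI[OF S1 Gp_hol[of t] Gp_G2C] Gp_sigma[of t] Gp_real[of _ t]
    by (simp add: twisted_def loops_plus_def \<omega>_def)
  have minus: "restrict (Gm t) S1 \<in> twisted (loops_minus P)" for t
  proof -
    have "continuous_on (cball 0 1) (Gm t)"
    proof -
      have "continuous_on (cball 0 1) (\<lambda>z. \<chi> i j. Gm t z $ i $ j)"
        by (intro continuous_on_vec_lambda holomorphic_on_imp_continuous_on holomorphic_on_subset[OF Gm_hol]) auto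
      then show ?thesis by simp
    qed
    moreover have "Gm t 0 \<in> Bgrp P"
    proof (rule linear_ode_tor_Bgrp[where Y = "\<lambda>t. Gm t 0" and c = "\<lambda>t. 2 *\<^sub>R u0 t"])
      show "((\<lambda>t. Gm t 0) has_vector_derivative \<i> *\<^sub>C (2 *\<^sub>R u0 t) ** Gm t 0) (at t)" for t
        using Gm'[where t = t and z = 0] by (simp add: xim_def cs.zero_left cscale_scaleR mult.commute)
      show "2 *\<^sub>R u0 t \<in> tor" for t using u(1) by (simp add: subspace_scale[OF tor_subspace])
      show "continuous_on UNIV (\<lambda>t. 2 *\<^sub>R u0 t)" by (intro continuous_on_scaleR continuous_on_const c0)
    qed (rule Gm0)
    moreover have "(\<lambda>z. Gm t z $ i $ j) holomorphic_on ball 0 1" for i j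
      using Gm_hol holomorphic_on_subset by blast
    ultimately have "\<exists>G. (\<forall>l\<in>S1. G l = restrict (Gm t) S1 l) \<and> continuous_on (cball 0 1) G \<and>
        (\<forall>i j. (\<lambda>z. G z $ i $ j) holomorphic_on ball 0 1) \<and> (\<forall>z\<in>ball 0 1. G z \<in> G2C) \<and> G 0 \<in> Bgrp P"
      using Gm_G2C by (intro exI[of _ "Gm t"]) simp
    then show ?thesis
      using twisted_loopI[OF open_UNIV _ Gm_hol[of t] Gm_G2C] Gm_sigma[of t]
      by (simp add: twisted_def loops_minus_def \<omega>_def)
  qed
  have loop: "(\<lambda>l\<in>S1. mexp (t *\<^sub>R xi 0 l)) \<in> twisted loops" for t
  proof -
    have "(\<lambda>l\<in>S1. mexp (t *\<^sub>R xi 0 l)) = restrict (\<lambda>z. Gp t z ** Gm t z) S1"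
      using prod nz by (auto simp: fun_eq_iff restrict_def)
    moreover have "(\<lambda>z. (Gp t z ** Gm t z) $ i $ j) holomorphic_on - {0}" for i j
    proof -
      have "(\<lambda>z. \<Sum>k\<in>UNIV. Gp t z $ i $ k * Gm t z $ k $ j) holomorphic_on - {0}"
        by (intro holomorphic_intros Gp_hol holomorphic_on_subset[OF Gm_hol]) auto
      then show ?thesis by (simp add: matrix_matrix_mult_def)
    qed
    moreover have "Gp t z ** Gm t z \<in> G2C" for z by (intro G2C_mult Gp_G2C Gm_G2C)
    moreover have "sigma (Gp t (\<omega> * z) ** Gm t (\<omega> * z)) = Gp t z ** Gm t z" for z
      by (simp add: sigma_mult Gp_sigma Gm_sigma)
    ultimately show ?thesis
      using twisted_loopI[OF S1, of "\<lambda>z. Gp t z ** Gm t z"] by (simp add: twisted_def \<omega>_def)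
  qed
  show ?thesis
  proof
    show "loop_factors P (\<lambda>l\<in>S1. mexp (t *\<^sub>R xi 0 l)) (restrict (Gp t) S1) (restrict (Gm t) S1)" for t
      unfolding loop_factors_def using plus minus prod nz by auto
    show "(\<lambda>l\<in>S1. mexp (t *\<^sub>R xi 0 l)) \<in> twisted loops" for t by (rule loop)
    show "transpose (restrict (Gp t) S1 l) ** xi 0 l ** restrict (Gp t) S1 l = xi t l" if "l \<in> S1" for t l
      using xi_t[OF nz[OF that], of t] that by (simp add: Gp_def)
    show "((\<lambda>t. restrict (Gp t) S1 1) has_vector_derivative
        restrict (Gp t) S1 1 ** (\<i> *\<^sub>C (u1 t - mconj (u1 t)))) (at t)" for t
      using Gp'[where t = t and z = 1] by (simp add: xip_def cs.diff_right)
  qed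
qed

section \<open>Almost complex curves\<close>

text \<open>The first row of \<open>Qm\<close> is a basis vector, so the change of basis on the
  right leaves the first column alone.\<close>

lemma column_1_qc: "T $ i $ 1 = (\<Sum>j\<in>UNIV. Qm $ i $ j * qc T $ j $ 1)"
proof -
  have Q1: "adj Qm $ j $ 1 = (if j = 1 then 1 else 0)" for j
    using exhaust_7[of j] by (auto simp: Qm_row)
  have "T = Qm ** qc T ** adj Qm" by (rule qc_inverse[symmetric])
  then have "T $ i $ 1 = (Qm ** qc T ** adj Qm) $ i $ 1" by simp
  also have "\<dots> = (\<Sum>j\<in>UNIV. (Qm ** qc T) $ i $ j * (if j = 1 then 1 else 0))"
    by (subst matrix_matrix_mult_def) (simp only: vec_lambda_beta Q1)
  also have "\<dots> = (Qm ** qc T) $ i $ 1" by (simp add: if_distrib cong: if_cong)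
  finally show ?thesis by (simp add: matrix_matrix_mult_def)
qed

text \<open>The first basis vector is a weight vector of the torus, and its eigenvalue is the
  diagonal entry of a skew matrix, hence 0.\<close>

lemma tor_column:
  assumes "T \<in> tor"
  shows "T $ i $ 1 = 0"
proof -
  obtain \<theta> where \<theta>: "qc T = diagm (\<lambda>j. \<i> * complex_of_real (\<theta> j))" using tor_diag[OF assms] by blast
  then have T: "T $ i $ 1 = Qm $ i $ 1 * (\<i> * complex_of_real (\<theta> 1))" for i
    unfolding column_1_qc[of T] by (simp add: \<theta> diagm_nth if_distrib cong: if_cong)
  have "transpose T = - T" using assms by (simp add: tor_def g2_iff cder_def)
  from arg_cong[OF this, of "\<lambda>A. A $ 1 $ 1"] have "T $ 1 $ 1 = 0"
    by (simp add: transpose_def eq_neg_iff_add_eq_0 flip: mult_2)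
  then have "\<theta> 1 = 0" using T[of 1] by (simp add: Qm_row)
  then show ?thesis using T by simp
qed

text \<open>Comparing eigenvalues of \<open>hmat\<close>, the image of the first basis vector under
  \<open>b\<close> can only have a component with cis (wt j * pi / 3) = cis (pi / 3). This leaves j
  = 2, the column of \<open>Qm\<close> proportional to e2 - i e3.\<close>

lemma eigsp_minus_1_column:
  assumes b: "b \<in> eigsp (-1)"
  shows "b $ 1 $ 1 = 0" "b $ 3 $ 1 = - \<i> * b $ 2 $ 1" "b $ 4 $ 1 = 0" "b $ 5 $ 1 = 0" "b $ 6 $ 1 = 0" "b $ 7 $ 1 = 0"
proof -
  have sb: "sigma b = cis (- pi / 3) *\<^sub>C b" using b by (simp add: eigsp_iff)
  have "hmat ** sigma b = b ** hmat" by (simp add: sigma_def matrix_mul_assoc hmat_inv)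
  then have "qc hmat ** qc (sigma b) = qc b ** qc hmat" by (simp flip: qc_mult)
  then have "(qc hmat ** (cis (- pi / 3) *\<^sub>C qc b)) $ j $ 1 = (qc b ** qc hmat) $ j $ 1" for j
    by (simp only: sb qc_cscale)
  then have e: "cis (wt j * pi / 3) * cis (- pi / 3) * qc b $ j $ 1 = qc b $ j $ 1" for j
    by (simp add: qc_hmat diagm_mult_left_nth diagm_mult_right_nth cis_wt mult.assoc)
  have cm: "cis (- pi / 3) = Complex (1 / 2) (- (sqrt 3 / 2))"
    by (simp add: complex_eq_iff cos_60 sin_60)
  have "cis (wt j * pi / 3) * cis (- pi / 3) \<noteq> 1" if "j \<noteq> 2" for j
    using exhaust_7[of j] that by (elim disjE; simp only: cis_wt cm; simp add: complex_eq_iff)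
  then have z: "qc b $ j $ 1 = 0" if "j \<noteq> 2" for j
    using e[of j] that by (metis mult_cancel_right1)
  have col: "b $ i $ 1 = Qm $ i $ 2 * qc b $ 2 $ 1" for i
    unfolding column_1_qc[of b] sum_7 by (simp add: z)
  show "b $ 1 $ 1 = 0" "b $ 4 $ 1 = 0" "b $ 5 $ 1 = 0" "b $ 6 $ 1 = 0" "b $ 7 $ 1 = 0"
    by (simp_all add: col Qm_row)
  show "b $ 3 $ 1 = - \<i> * b $ 2 $ 1"
    by (simp add: col Qm_row rsqrt2_def isqrt2_def)
qed

lemma matrix_vector_axis: "(A *v axis j 1) $ i = A $ i $ j"
  by (simp add: matrix_vector_mult_def axis_def if_distrib cong: if_cong)

text \<open>Since e1 x e2 = e3 and e1 x e3 = - e2, the cross product with e1 acts on e2 - i e3 as i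
  and on its conjugate as - i. So it maps the column of \<open>X\<close> to that of
  \<open>W\<close>, and that of \<open>W\<close> to minus that of \<open>X\<close>.\<close>

lemma cross_column:
  assumes a: "a \<in> tor" and b: "b \<in> eigsp (-1)"
  defines "X \<equiv> 2 *\<^sub>R a + b + mconj b" and "W \<equiv> \<i> *\<^sub>C (b - mconj b)"
  shows "cross (axis 1 1) (X *v axis 1 1) = W *v axis 1 1" "cross (axis 1 1) (W *v axis 1 1) = - (X *v axis 1 1)"
proof -
  note c = tor_column[OF a] eigsp_minus_1_column[OF b]
  show "cross (axis 1 1) (X *v axis 1 1) = W *v axis 1 1"
    unfolding cross_def vec_eq_iff forall_7 vector_7 matrix_vector_axis
    by (simp add: axis_def X_def W_def c algebra_simps)
  show "cross (axis 1 1) (W *v axis 1 1) = - (X *v axis 1 1)"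
    unfolding cross_def vec_eq_iff forall_7 vector_7 matrix_vector_axis vector_uminus_component
    by (simp add: axis_def X_def W_def c algebra_simps)
qed

lemma mexp_G2:
  assumes "cder A" "mconj A = A"
  shows "mexp (s *\<^sub>R A) \<in> G2"
proof -
  have "mexp (s *\<^sub>R A) \<in> G2C"
    by (rule linear_ode_G2C[where C = "\<lambda>_. A"]) (use assms mexp_scaleR_deriv in auto)
  moreover have "mconj (mexp (s *\<^sub>R A)) = mexp (s *\<^sub>R A)"
    by (rule linear_ode_real[where C = "\<lambda>_. A" and Y = "\<lambda>s. mexp (s *\<^sub>R A)"])
      (use assms mexp_scaleR_deriv in auto)
  ultimately show ?thesis by (simp add: G2_iff)
qed

lemma cder_diagonal: "cder X \<Longrightarrow> X $ i $ i = 0"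
  unfolding cder_def using arg_cong[of "transpose X" "- X" "\<lambda>A. A $ i $ i"]
  by (auto simp: transpose_def eq_neg_iff_add_eq_0 simp flip: mult_2)

text \<open>Elements of \<open>G2\<close> commute with the cross product, which moves the claim from
  the point G e1 back to e1, where \<open>cross_column\<close> settles it. The matrices are complex
  but have real entries: \<open>rc\<close> extracts the real first column and \<open>cv\<close>
  embeds it again.\<close>

lemma almost_complex_curve:
  assumes k: "\<And>t. k t \<in> G2"
    and k': "\<And>t. (k has_vector_derivative k t ** (\<i> *\<^sub>C (u1 t - mconj (u1 t)))) (at t)"
    and conj: "\<And>t. transpose (k t) ** A ** k t = 2 *\<^sub>R u0 t + u1 t + mconj (u1 t)"
    and u: "\<And>t. u0 t \<in> tor" "\<And>t. u1 t \<in> eigsp (-1)"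
    and A: "cder A" "mconj A = A"
  shows "\<exists>f. (\<forall>s t i. complex_of_real (f (Complex s t) $ i) = (mexp (s *\<^sub>R A) *v column 1 (k t)) $ i) \<and> almost_complex f"
proof -
  define rc :: "cmat7 \<Rightarrow> real^7" where "rc H = (\<chi> i. Re (H $ i $ 1))" for H
  define cv :: "real^7 \<Rightarrow> complex^7" where "cv x = (\<chi> i. complex_of_real (x $ i))" for x
  define e :: "complex^7" where "e = axis 1 1"
  define G where "G z = mexp (Re z *\<^sub>R A) ** k (Im z)" for z
  define X where "X t = 2 *\<^sub>R u0 t + u1 t + mconj (u1 t)" for t
  define W where "W t = \<i> *\<^sub>C (u1 t - mconj (u1 t))" for t
  define f where "f z = rc (G z)" for z
  have cv_rc: "cv (rc H) = H *v e" if "mconj H = H" for H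
    using that unfolding vec_eq_iff cv_def rc_def e_def matrix_vector_axis
    by (auto simp: Reals_cnj_iff intro!: of_real_Re)
  have cv_inj: "cv x = cv y \<Longrightarrow> x = y" for x y by (simp add: cv_def vec_eq_iff)
  have cv_cross: "cv (cross x y) = cross (cv x) (cv y)" for x y
    by (simp add: cv_def cross_def vec_eq_iff forall_7)
  have cv_inner: "complex_of_real (x \<bullet> y) = dotp (cv x) (cv y)" for x y
    by (simp add: cv_def dotp_def inner_vec_def)
  have cv_minus: "cv (- x) = - cv x" for x by (simp add: cv_def vec_eq_iff)
  have G: "G z \<in> G2C" "mconj (G z) = G z" for z
    using G2C_mult[of "mexp (Re z *\<^sub>R A)" "k (Im z)"] k mexp_G2[OF A]
    by (auto simp: G_def G2_iff mconj_mult)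
  have XW: "mconj (X t) = X t" "mconj (W t) = W t" "cder (X t)" "cder (W t)" for t
  proof -
    have "cder (u0 t)" "mconj (u0 t) = u0 t" "cder (u1 t)"
      using u[of t] by (auto simp: tor_def g2_iff eigsp_iff)
    then show "mconj (X t) = X t" "mconj (W t) = W t" "cder (X t)" "cder (W t)"
      by (auto simp: X_def W_def mconj_add mconj_scaleR mconj_cscale mconj_diff cs.diff_right cs.minus_left
          intro!: cder_add cder_scaleR cder_cscale cder_diff cder_mconj)
  qed
  have rc_bl: "bounded_linear rc"
    unfolding linear_conv_bounded_linear[symmetric] by (intro linearI) (simp_all add: rc_def vec_eq_iff)
  \<comment> \<open>As A commutes with its exponential and A k = k X by the conjugation hypothesis,
    both partial derivatives of \<open>G\<close> are left translates by \<open>G\<close>, of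
    \<open>X\<close> and of \<open>W\<close>.\<close>
  have AG: "A ** G z = G z ** X (Im z)" for z
  proof -
    have kk: "k t ** transpose (k t) = mat 1" for t using k by (simp add: G2_iff G2C_inverse)
    have "k t ** X t = (k t ** transpose (k t)) ** A ** k t" for t
      unfolding X_def conj[symmetric] by (simp add: matrix_mul_assoc)
    then have "A ** k t = k t ** X t" for t by (simp add: kk)
    then have "mexp (Re z *\<^sub>R A) ** (A ** k (Im z)) = G z ** X (Im z)"
      by (simp add: G_def matrix_mul_assoc)
    then show ?thesis by (simp add: G_def mexp_commute matrix_mul_assoc)
  qed
  have dG: "(G has_derivative (\<lambda>v. Im v *\<^sub>R (G z ** W (Im z)) + Re v *\<^sub>R (G z ** X (Im z)))) (at z)" for z
  proof -
    have 1: "((\<lambda>z. mexp (Re z *\<^sub>R A)) has_derivative (\<lambda>v. Re v *\<^sub>R (A ** mexp (Re z *\<^sub>R A)))) (at z)"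
      using has_derivative_compose[OF bounded_linear_imp_has_derivative[OF bounded_linear_Re]
          mexp_scaleR_deriv[unfolded has_vector_derivative_def]] .
    have 2: "((\<lambda>z. k (Im z)) has_derivative (\<lambda>v. Im v *\<^sub>R (k (Im z) ** W (Im z)))) (at z)"
      unfolding W_def using has_derivative_compose[OF bounded_linear_imp_has_derivative[OF bounded_linear_Im]
          k'[unfolded has_vector_derivative_def]] .
    have "(G has_derivative (\<lambda>v. mexp (Re z *\<^sub>R A) ** (Im v *\<^sub>R (k (Im z) ** W (Im z))) +
        Re v *\<^sub>R (A ** mexp (Re z *\<^sub>R A)) ** k (Im z))) (at z)"
      unfolding G_def by (rule mm.FDERIV[OF 1 2])
    moreover have "mexp (Re z *\<^sub>R A) ** (Im v *\<^sub>R (k (Im z) ** W (Im z))) = Im v *\<^sub>R (G z ** W (Im z))" for v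
      by (simp add: mm.scaleR_right G_def matrix_mul_assoc)
    moreover have "Re v *\<^sub>R (A ** mexp (Re z *\<^sub>R A)) ** k (Im z) = Re v *\<^sub>R (G z ** X (Im z))" for v
      by (simp add: mm.scaleR_left flip: AG) (simp add: G_def matrix_mul_assoc)
    ultimately show ?thesis by simp
  qed
  have cross_G: "cross (rc (G z)) (rc (G z ** X (Im z))) = rc (G z ** W (Im z))"
    "cross (rc (G z)) (rc (G z ** W (Im z))) = - rc (G z ** X (Im z))" for z
  proof -
    have real: "cv (rc (G z ** X (Im z))) = G z *v (X (Im z) *v e)" "cv (rc (G z ** W (Im z))) = G z *v (W (Im z) *v e)"
      using G(2) XW by (simp_all add: cv_rc mconj_mult matrix_vector_mul_assoc)
    have Gc: "cross (G z *v x) (G z *v y) = G z *v cross x y" for x y using G by (simp add: G2C_iff)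
    have c: "cross e (X t *v e) = W t *v e" "cross e (W t *v e) = - (X t *v e)" for t
      unfolding e_def X_def W_def by (rule cross_column[OF u])+
    show "cross (rc (G z)) (rc (G z ** X (Im z))) = rc (G z ** W (Im z))"
      by (rule cv_inj) (simp add: cv_cross real cv_rc[OF G(2)] Gc c)
    show "cross (rc (G z)) (rc (G z ** W (Im z))) = - rc (G z ** X (Im z))"
      by (rule cv_inj) (simp add: cv_cross cv_minus real cv_rc[OF G(2)] Gc c mv.minus_right)
  qed
  \<comment> \<open>The scalar part of the octonion product of point and tangent vector has to
    vanish. This holds since G is orthogonal and a skew matrix has zero diagonal.\<close>
  have inner_G: "rc (G z) \<bullet> rc (G z ** Y) = 0" if "cder Y" "mconj Y = Y" for z Y
  proof -
    have "complex_of_real (rc (G z) \<bullet> rc (G z ** Y)) = dotp (G z *v e) ((G z ** Y) *v e)"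
      using G(2) that by (simp add: cv_inner cv_rc mconj_mult)
    also have "\<dots> = (transpose (G z) ** (G z ** Y)) $ 1 $ 1"
      unfolding dotp_matrix e_def by (rule dotp_axis)
    also have "\<dots> = 0" using that G by (simp add: matrix_mul_assoc G2C_inverse cder_diagonal)
    finally show ?thesis by simp
  qed
  have norm_f: "norm (f z) = 1" for z
  proof -
    have "complex_of_real (f z \<bullet> f z) = dotp (G z *v e) (G z *v e)"
      using G(2) by (simp add: f_def cv_inner cv_rc)
    also have "\<dots> = (transpose (G z) ** G z) $ 1 $ 1"
      unfolding dotp_matrix e_def by (rule dotp_axis)
    also have "\<dots> = 1" using G by (simp add: G2C_inverse mat_def)
    finally have "f z \<bullet> f z = 1" by simp
    then show ?thesis by (simp add: norm_eq_sqrt_inner)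
  qed
  have "almost_complex f"
    unfolding almost_complex_def
  proof (intro conjI allI)
    fix z
    show "f z \<in> sphere 0 1" by (simp add: norm_f)
    define a where "a = rc (G z ** X (Im z))"
    define b where "b = rc (G z ** W (Im z))"
    define D where "D v = Im v *\<^sub>R b + Re v *\<^sub>R a" for v
    have "(f has_derivative (\<lambda>v. rc (Im v *\<^sub>R (G z ** W (Im z)) + Re v *\<^sub>R (G z ** X (Im z))))) (at z)"
      unfolding f_def by (rule bounded_linear.has_derivative[OF rc_bl dG])
    moreover have "rc (Im v *\<^sub>R (G z ** W (Im z)) + Re v *\<^sub>R (G z ** X (Im z))) = D v" for v
      by (simp add: D_def a_def b_def rc_def vec_eq_iff)
    ultimately have "(f has_derivative D) (at z)" by simp
    moreover have "im_oct (D (\<i> * v)) = omult (im_oct (f z)) (im_oct (D v))" for v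
    proof -
      have fab: "cross (f z) a = b" "cross (f z) b = - a" "f z \<bullet> a = 0" "f z \<bullet> b = 0"
        using cross_G[of z] inner_G XW by (simp_all add: f_def a_def b_def)
      have "dotp (f z) (D v) = f z \<bullet> D v" by (simp add: dotp_def inner_vec_def)
      then have "dotp (f z) (D v) = 0" using fab by (simp add: D_def inner_add_right)
      moreover have "cross (f z) (D v) = D (\<i> * v)"
        by (simp add: D_def cr.add_right cr.scaleR_right fab)
      ultimately show ?thesis by (simp add: im_oct_eq oct_of_mult vec.scale_zero_left)
    qed
    ultimately show "\<exists>D. (f has_derivative D) (at z) \<and>
        (\<forall>v. im_oct (D (\<i> * v)) = omult (im_oct (f z)) (im_oct (D v)))" by blast
  qed
  moreover have "complex_of_real (f (Complex s t) $ i) = (mexp (s *\<^sub>R A) *v column 1 (k t)) $ i" for s t i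
  proof -
    have "cv (f (Complex s t)) = mexp (s *\<^sub>R A) *v (k t *v e)"
      unfolding f_def cv_rc[OF G(2)] by (simp add: G_def matrix_vector_mul_assoc)
    moreover have "k t *v e = column 1 (k t)" by (simp add: vec_eq_iff e_def matrix_vector_axis column_def)
    ultimately have "cv (f (Complex s t)) $ i = (mexp (s *\<^sub>R A) *v column 1 (k t)) $ i" by simp
    then show ?thesis by (simp add: cv_def)
  qed
  ultimately show ?thesis by blast
qed

text \<open>The factors are quantified universally after their unique existence, so every way of
  carrying out the steps is covered. The curve is a complex vector as a matrix expression, and
  \<open>f\<close> is its real form.\<close>

theorem theorem6p3:
  fixes A h0 h1 :: cmat7 and xi0 :: "complex \<Rightarrow> cmat7" and P :: "(cmat7 \<Rightarrow> real) set"
  assumes "positive_roots P"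
    and "h0 \<in> eigsp 0 \<inter> g2" and "h1 \<in> eigsp (-1)"
    and "A = 2 *\<^sub>R h0 + h1 + mconj h1"
    and "\<And>l. xi0 l = (2 * \<i>) *\<^sub>C h0 + (\<i> * inverse l) *\<^sub>C h1 + (\<i> * l) *\<^sub>C mconj h1"
  shows
    "(\<exists>!u. lax_solution (fst u) (snd u) \<and> 2 *\<^sub>R fst u 0 + snd u 0 + mconj (snd u 0) = A) \<and>
     (\<exists>!g. loop_flow xi0 g) \<and>
     (\<forall>g. loop_flow xi0 g \<longrightarrow>
        (\<forall>t. g t \<in> twisted loops \<and> (\<forall>l \<in> S1. g t l = mexp (t *\<^sub>R xi0 l))) \<and>
        (\<forall>t. \<exists>!p. loop_factors P (g t) (fst p) (snd p)) \<and>
        (\<forall>gp gm. (\<forall>t. loop_factors P (g t) (gp t) (gm t)) \<longrightarrow>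
          (\<exists>v0 v1.
             (\<forall>t. v0 t \<in> eigsp 0 \<inter> (\<lambda>X. \<i> *\<^sub>C X) ` g2 \<and> v1 t \<in> eigsp (-1)) \<and>
             (\<forall>t. \<forall>l \<in> S1. matrix_inv (gp t l) ** xi0 l ** gp t l =
                 v0 t + inverse l *\<^sub>C v1 t - l *\<^sub>C mconj (v1 t)) \<and>
             (\<forall>u0 u1 k.
                (\<forall>t. u0 t = (- \<i> / 2) *\<^sub>C v0 t) \<and> (\<forall>t. u1 t = (- \<i>) *\<^sub>C v1 t) \<and>
                (\<forall>t. k t = gp t 1) \<longrightarrow>
                  (\<forall>t. k t \<in> G2) \<and>
                  lax_solution u0 u1 \<and> 2 *\<^sub>R u0 0 + u1 0 + mconj (u1 0) = A \<and>
                  (\<forall>t. matrix_inv (k t) ** A ** k t = 2 *\<^sub>R u0 t + u1 t + mconj (u1 t)) \<and>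
                  (\<forall>t. left_log_deriv k t (\<i> *\<^sub>C (u1 t - mconj (u1 t)))) \<and>
                  (\<exists>f :: complex \<Rightarrow> real^7.
                     (\<forall>s t i. complex_of_real (f (Complex s t) $ i) =
                        (mexp (s *\<^sub>R A) *v column 1 (k t)) $ i) \<and>
                     almost_complex f)))))"
proof -
  have h: "h0 \<in> tor" "h1 \<in> eigsp (-1)" using assms by (auto simp: tor_def)
  obtain w0 w1 where w_0: "w0 0 = h0" "w1 0 = h1" and w: "\<And>t. w0 t \<in> tor" "\<And>t. w1 t \<in> eigsp (-1)"
    and d: "\<And>t. (w0 has_vector_derivative (- \<i>) *\<^sub>C bracket (w1 t) (mconj (w1 t))) (at t)"
      "\<And>t. (w1 has_vector_derivative (2 * \<i>) *\<^sub>C bracket (w0 t) (w1 t)) (at t)"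
    and bd: "\<exists>M. \<forall>t. norm (w0 t) \<le> M \<and> norm (w1 t) \<le> M"
    using lax_pair_solution[OF h] by blast
  obtain M where M: "\<And>t. norm (w0 t) \<le> M" "\<And>t. norm (w1 t) \<le> M" using bd by blast
  have lax: "lax_solution w0 w1" using w d by (simp add: lax_solution_iff)
  define xi where "xi t z = (2 * \<i>) *\<^sub>C w0 t + (\<i> * inverse z) *\<^sub>C w1 t + (\<i> * z) *\<^sub>C mconj (w1 t)" for t z
  have xi_0: "xi 0 = xi0" by (simp add: fun_eq_iff xi_def w_0 assms(5))
  obtain Gp Gm where F: "\<And>t. loop_factors P (\<lambda>l\<in>S1. mexp (t *\<^sub>R xi0 l)) (Gp t) (Gm t)"
    and tw: "\<And>t. (\<lambda>l\<in>S1. mexp (t *\<^sub>R xi0 l)) \<in> twisted loops"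
    and conj: "\<And>t l. l \<in> S1 \<Longrightarrow> transpose (Gp t l) ** xi0 l ** Gp t l = xi t l"
    and Gp': "\<And>t. ((\<lambda>t. Gp t 1) has_vector_derivative Gp t 1 ** (\<i> *\<^sub>C (w1 t - mconj (w1 t)))) (at t)"
    using loop_factorization[OF w d M xi_def, of P] unfolding xi_0 by blast
  have Gp_G2: "Gp t l \<in> G2" if "l \<in> S1" for t l
    using F[of t] that by (simp add: loop_factors_def twisted_def loops_plus_def)
  have Gp_inv: "matrix_inv (Gp t l) = transpose (Gp t l)" "invertible (Gp t l)" if "l \<in> S1" for t l
    using Gp_G2[OF that, of t] G2C_inverse by (auto simp: G2_iff)
  \<comment> \<open>At l = 1 the loop is i times the matrix of the Lax equation, which is why the
    plus factor at 1 conjugates \<open>A\<close> into the solution.\<close>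
  have A_xi: "xi t 1 = \<i> *\<^sub>C (2 *\<^sub>R w0 t + w1 t + mconj (w1 t))" for t
    by (simp add: xi_def cs.add_right cscale_scaleR mult.commute)
  have A_xi0: "xi0 1 = \<i> *\<^sub>C A" using A_xi[of 0] by (simp add: xi_0 w_0 assms(4))
  have conj_A: "transpose (Gp t 1) ** A ** Gp t 1 = 2 *\<^sub>R w0 t + w1 t + mconj (w1 t)" for t
  proof -
    have "\<i> *\<^sub>C (transpose (Gp t 1) ** A ** Gp t 1) = \<i> *\<^sub>C (2 *\<^sub>R w0 t + w1 t + mconj (w1 t))"
      using conj[of 1 t] by (simp add: A_xi0 A_xi cscale_mult_left cscale_mult_right)
    from arg_cong[OF this, of "(*\<^sub>C) (- \<i>)"] show ?thesis by simp
  qed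
  have A: "cder A" "mconj A = A"
    using h by (auto simp: assms(4) tor_def g2_iff eigsp_iff mconj_add mconj_scaleR
        intro!: cder_add cder_scaleR cder_mconj)
  have k_G2: "Gp t 1 \<in> G2" for t by (rule Gp_G2) simp
  have curve: "\<exists>f. (\<forall>s t i. complex_of_real (f (Complex s t) $ i) =
      (mexp (s *\<^sub>R A) *v column 1 (Gp t 1)) $ i) \<and> almost_complex f"
    by (rule almost_complex_curve[OF k_G2 Gp' conj_A w A])
  show ?thesis
  proof (intro conjI allI impI)
    show "\<exists>!u. lax_solution (fst u) (snd u) \<and> 2 *\<^sub>R fst u 0 + snd u 0 + mconj (snd u 0) = A"
      unfolding assms(4) by (rule lax_solution_ex1[OF assms(2,3)])
    show "\<exists>!g. loop_flow xi0 g" unfolding loop_flow_iff by simp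
    fix g assume "loop_flow xi0 g"
    then have g: "g t = (\<lambda>l\<in>S1. mexp (t *\<^sub>R xi0 l))" for t by (simp add: loop_flow_iff)
    show "g t \<in> twisted loops" "\<forall>l\<in>S1. g t l = mexp (t *\<^sub>R xi0 l)" for t
      unfolding g using tw by auto
    show "\<exists>!p. loop_factors P (g t) (fst p) (snd p)" for t
      unfolding g
    proof (rule ex1I[of _ "(Gp t, Gm t)"])
      show "loop_factors P (\<lambda>l\<in>S1. mexp (t *\<^sub>R xi0 l)) (fst (Gp t, Gm t)) (snd (Gp t, Gm t))" using F by simp
      fix p assume "loop_factors P (\<lambda>l\<in>S1. mexp (t *\<^sub>R xi0 l)) (fst p) (snd p)"
      from loop_factors_unique[OF assms(1) this F] show "p = (Gp t, Gm t)" by (cases p) simp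
    qed
    fix gp gm assume "\<forall>t. loop_factors P (g t) (gp t) (gm t)"
    \<comment> \<open>The given factors come separately for each \<open>t\<close>, without any
      regularity in time. Uniqueness identifies them with the constructed ones, whose derivative at
      l = 1 is known.\<close>
    then have "gp t = Gp t" for t
      unfolding g using loop_factors_unique[OF assms(1) _ F] by blast
    then have gp: "gp = Gp" by blast
    \<comment> \<open>\<open>v0\<close> and \<open>v1\<close> invert the relations u0 = - i/2 v0 and
      u1 = - i v1 for the solution \<open>w0\<close>, \<open>w1\<close>; the factor i in
      \<open>v1\<close> accounts for the minus sign in front of \<open>mconj (v1 t)\<close>.\<close>
    define v0 where "v0 t = (2 * \<i>) *\<^sub>C w0 t" for t
    define v1 where "v1 t = \<i> *\<^sub>C w1 t" for t
    show "\<exists>v0 v1.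
       (\<forall>t. v0 t \<in> eigsp 0 \<inter> (\<lambda>X. \<i> *\<^sub>C X) ` g2 \<and> v1 t \<in> eigsp (-1)) \<and>
       (\<forall>t. \<forall>l \<in> S1. matrix_inv (gp t l) ** xi0 l ** gp t l =
           v0 t + inverse l *\<^sub>C v1 t - l *\<^sub>C mconj (v1 t)) \<and>
       (\<forall>u0 u1 k.
          (\<forall>t. u0 t = (- \<i> / 2) *\<^sub>C v0 t) \<and> (\<forall>t. u1 t = (- \<i>) *\<^sub>C v1 t) \<and>
          (\<forall>t. k t = gp t 1) \<longrightarrow>
            (\<forall>t. k t \<in> G2) \<and>
            lax_solution u0 u1 \<and> 2 *\<^sub>R u0 0 + u1 0 + mconj (u1 0) = A \<and>
            (\<forall>t. matrix_inv (k t) ** A ** k t = 2 *\<^sub>R u0 t + u1 t + mconj (u1 t)) \<and>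
            (\<forall>t. left_log_deriv k t (\<i> *\<^sub>C (u1 t - mconj (u1 t)))) \<and>
            (\<exists>f :: complex \<Rightarrow> real^7.
               (\<forall>s t i. complex_of_real (f (Complex s t) $ i) =
                  (mexp (s *\<^sub>R A) *v column 1 (k t)) $ i) \<and>
               almost_complex f))"
    proof (rule exI[of _ v0], rule exI[of _ v1], intro conjI allI ballI impI)
      fix t
      have "v0 t = \<i> *\<^sub>C (2 *\<^sub>R w0 t)" by (simp add: v0_def cscale_scaleR mult.commute)
      moreover have "2 *\<^sub>R w0 t \<in> g2"
        using w(1)[of t] subspace_scale[OF tor_subspace, of "w0 t" 2] by (auto simp: tor_def)
      moreover have "v0 t \<in> eigsp 0" using w(1)[of t] by (simp add: v0_def tor_def eigsp_cscale)
      ultimately show "v0 t \<in> eigsp 0 \<inter> (\<lambda>X. \<i> *\<^sub>C X) ` g2" by blast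
      show "v1 t \<in> eigsp (-1)" using w(2) by (simp add: v1_def eigsp_cscale)
      fix l :: complex assume l: "l \<in> S1"
      have "matrix_inv (gp t l) ** xi0 l ** gp t l = xi t l"
        unfolding gp Gp_inv(1)[OF l] by (rule conj[OF l])
      also have "\<dots> = v0 t + inverse l *\<^sub>C v1 t - l *\<^sub>C mconj (v1 t)"
        by (simp add: xi_def v0_def v1_def mconj_cscale cs.minus_left cs.minus_right mult.commute)
      finally show "matrix_inv (gp t l) ** xi0 l ** gp t l = v0 t + inverse l *\<^sub>C v1 t - l *\<^sub>C mconj (v1 t)" .
    next
      fix u0 u1 k
      assume "(\<forall>t. u0 t = (- \<i> / 2) *\<^sub>C v0 t) \<and> (\<forall>t. u1 t = (- \<i>) *\<^sub>C v1 t) \<and> (\<forall>t. k t = gp t 1)"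
      then have uk: "u0 = w0" "u1 = w1" "k = (\<lambda>t. Gp t 1)"
        by (simp_all add: fun_eq_iff v0_def v1_def gp)
      show "k t \<in> G2" for t using k_G2 by (simp add: uk)
      show "lax_solution u0 u1" using lax by (simp add: uk)
      show "2 *\<^sub>R u0 0 + u1 0 + mconj (u1 0) = A" by (simp add: uk w_0 assms(4))
      show "matrix_inv (k t) ** A ** k t = 2 *\<^sub>R u0 t + u1 t + mconj (u1 t)" for t
        using conj_A by (simp add: uk Gp_inv)
      show "left_log_deriv k t (\<i> *\<^sub>C (u1 t - mconj (u1 t)))" for t
        using Gp' by (simp add: uk left_log_deriv_iff Gp_inv)
      show "\<exists>f. (\<forall>s t i. complex_of_real (f (Complex s t) $ i) =
          (mexp (s *\<^sub>R A) *v column 1 (k t)) $ i) \<and> almost_complex f"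
        using curve by (simp add: uk)
    qed
  qed
qed

end
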